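(* Assume Conditions 1, 2 and 3. Then the extended empirical log-likelihood ratio $l^*(\theta)=l(h_n^{-C}(\theta))$, $\theta\in\mathbb{R}^p$, satisfies $$l^*(\theta_0)\longrightarrow\chi^2_q\quad\text{in distribution as } n\to+\infty.$$
   Context: Setting. $X\in\mathbb{R}^d$ is a random vector with a parameter $\theta_0\in\mathbb{R}^p$; $g(X,\theta)\in\mathbb{R}^q$ is an estimating function for $\theta_0$, with $E[g(X,\theta_0)]=0$; $X_1,\dots,X_n$ are independent copies of $X$, with $n>q$. The conditions are: Condition 1. $E[g(X,\theta_0)]=0$ and the variance matrix $V[g(X,\theta_0)]\in\mathbb{R}^{q\times q}$ is positive definite. Condition 2. $\partial g(X,\theta)/\partial\theta$ and $\partial^2 g(X,\theta)/\partial\theta\,\partial\theta^T$ are both continuous in $\theta$, and for $\theta$ in a neighbourhood of $\theta_0$ they are both bounded in norm by some integrable function of $X$. Condition 3. $\limsup_{\|t\|\to\infty}|E[\exp\{it^Tg(X,\theta_0)\}]|<1$ and $E\|g(X,\theta_0)\|^{15}<\infty$. Original empirical likelihood (OEL). For $\theta\in\mathbb{R}^p$, $$R(\theta)=\sup\Big\{\prod_{i=1}^n nw_i:\ \sum_{i=1}^n w_ig(X_i,\theta)=0,\ w_i\ge 0,\ \sum_{i=1}^n w_i=1\Big\},\qquad l(\theta)=-2\log R(\theta).$$ The domain of $l$ is $$\Theta_n=\Big\{\theta\in\mathbb{R}^p:\ \text{there exist } w_1,\dots,w_n>0 \text{ with } \sum_{i=1}^n w_i=1 \text{ and } \sum_{i=1}^n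 w_ig(X_i,\theta)=0\Big\}.$$ For $\theta\in\Theta_n$, $l(\theta)=2\sum_{i=1}^n\log\{1+\lambda^Tg(X_i,\theta)\}$, where $\lambda=\lambda(\theta)\in\mathbb{R}^q$ satisfies $\sum_{i=1}^n g(X_i,\theta)/\{1+\lambda^Tg(X_i,\theta)\}=0$. Standing assumptions. $\Theta_n$ is a non-empty open subset of $\mathbb{R}^p$ containing $\theta_0$ (for all sufficiently large $n$). $\tilde\theta\in\Theta_n$ denotes the $\sqrt n$-consistent maximum empirical likelihood estimator of $\theta_0$, i.e. the maximizer of $R$ (minimizer of $l$) over $\Theta_n$, with $\tilde\theta-\theta_0=O_p(n^{-1/2})$; in the just-determined case $p=q$ it is the solution of $\sum_{i=1}^n g(X_i,\theta)=0$, so that $l(\tilde\theta)=0$. Composite similarity mapping. $h_n^C:\Theta_n\to\mathbb{R}^p$ is defined by $$h_n^C(\theta)=\tilde\theta+\gamma(n,l(\theta))(\theta-\tilde\theta),\qquad \gamma(n,l(\theta))=1+\frac{l(\theta)}{2n}.$$ It is surjective. For $\theta\in\mathbb{R}^p$ let $s(\theta)=\{\theta'\in\Theta_n: h_n^C(\theta')=\theta\}$, which is non-empty, and define the generalized inverse $h_n^{-C}:\mathbb{R}^p\to\Theta_n$ by $$h_n^{-C}(\theta)=\operatorname*{arg\,min}_{\theta'\in s(\theta)}\|\theta'-\theta\|.$$ *)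

theory Defs
  imports "HOL-Probability.Probability"
begin

section \<open>Convergence in distribution and stochastic order\<close>

text \<open>
  The random elements below are built with suprema and arg-mins over uncountable sets, so they
  need not be measurable. Convergence in distribution is therefore stated with
  outer probabilities of both tails. For measurable sequences it is exactly the notion
  \<^const>\<open>weak_conv_m\<close> of the library, see \<open>converges_in_distribution_iff_weak_conv_m\<close>.
\<close>

definition converges_in_distribution ::
    "'w measure \<Rightarrow> (nat \<Rightarrow> 'w \<Rightarrow> real) \<Rightarrow> real measure \<Rightarrow> bool" where
  "converges_in_distribution M Z \<nu> \<longleftrightarrow>
     (\<forall>x. isCont (cdf \<nu>) x \<longrightarrow>
        (\<lambda>n. outer_measure_of M {\<omega> \<in> space M. Z n \<omega> \<le> x}) \<longlonglongrightarrow> ennreal (cdf \<nu> x) \<and>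
        (\<lambda>n. outer_measure_of M {\<omega> \<in> space M. x < Z n \<omega>}) \<longlonglongrightarrow> ennreal (1 - cdf \<nu> x))"

lemma converges_in_distribution_iff_weak_conv_m:
  assumes "prob_space M" and "real_distribution \<nu>"
    and Z: "\<And>n. Z n \<in> borel_measurable M"
  shows "converges_in_distribution M Z \<nu> \<longleftrightarrow> weak_conv_m (\<lambda>n. distr M borel (Z n)) \<nu>"
proof -
  interpret M: prob_space M by fact
  interpret \<nu>: real_distribution \<nu> by fact
  note [measurable] = Z
  have cdf_eq: "cdf (distr M borel (Z n)) x = M.prob {\<omega> \<in> space M. Z n \<omega> \<le> x}" for n x
    unfolding cdf_def by (subst measure_distr) (auto intro!: arg_cong[where f = M.prob])
  have le: "outer_measure_of M {\<omega> \<in> space M. Z n \<omega> \<le> x} =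
      ennreal (cdf (distr M borel (Z n)) x)" for n x
    by (subst outer_measure_of_eq) (auto simp: cdf_eq M.emeasure_eq_measure)
  have gr: "outer_measure_of M {\<omega> \<in> space M. x < Z n \<omega>} =
      ennreal (1 - cdf (distr M borel (Z n)) x)" for n x
  proof -
    have "M.prob {\<omega> \<in> space M. x < Z n \<omega>} = M.prob (space M - {\<omega> \<in> space M. Z n \<omega> \<le> x})"
      by (rule arg_cong[where f = M.prob]) auto
    also have "\<dots> = 1 - M.prob {\<omega> \<in> space M. Z n \<omega> \<le> x}"
      by (rule M.prob_compl) measurable
    finally show ?thesis
      by (subst outer_measure_of_eq) (auto simp: cdf_eq M.emeasure_eq_measure)
  qed
  have nn: "0 \<le> cdf (distr M borel (Z n)) x" "0 \<le> 1 - cdf (distr M borel (Z n)) x" for n x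
    by (simp_all add: cdf_eq)
  have nn': "0 \<le> cdf \<nu> x" "0 \<le> 1 - cdf \<nu> x" for x
    by (simp_all add: cdf_def)
  have "((\<lambda>n. ennreal (cdf (distr M borel (Z n)) x)) \<longlonglongrightarrow> ennreal (cdf \<nu> x) \<and>
         (\<lambda>n. ennreal (1 - cdf (distr M borel (Z n)) x)) \<longlonglongrightarrow> ennreal (1 - cdf \<nu> x)) \<longleftrightarrow>
        (\<lambda>n. cdf (distr M borel (Z n)) x) \<longlonglongrightarrow> cdf \<nu> x" for x
    by (auto simp: tendsto_ennreal_iff nn nn' intro!: tendsto_ennrealI tendsto_diff)
  then show ?thesis
    unfolding converges_in_distribution_def weak_conv_m_def weak_conv_def le gr by simp
qed

definition big_O_in_probability ::
    "'w measure \<Rightarrow> (nat \<Rightarrow> 'w \<Rightarrow> 'b::real_normed_vector) \<Rightarrow> (nat \<Rightarrow> real) \<Rightarrow> bool" where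
  "big_O_in_probability M Y a \<longleftrightarrow>
     (\<forall>\<epsilon>>0. \<exists>K. \<forall>\<^sub>F n in sequentially.
        measure M {\<omega> \<in> space M. norm (Y n \<omega>) > K * a n} < \<epsilon>)"

definition chi_squared_distribution :: "nat \<Rightarrow> real measure" where
  "chi_squared_distribution q =
     distr (\<Pi>\<^sub>M i\<in>{..<q}. std_normal_distribution) borel (\<lambda>z. \<Sum>i<q. (z i)\<^sup>2)"


section \<open>Conditions on the estimating function\<close>

text \<open>Throughout, \<open>P\<close> is the law of \<open>X\<close>, so expectations over \<open>X\<close> are integrals against \<open>P\<close>.\<close>

definition variance_matrix ::
    "(real ^ 'd) measure \<Rightarrow> (real ^ 'd \<Rightarrow> real ^ 'q) \<Rightarrow> real ^ 'q ^ 'q" where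
  "variance_matrix P f =
     (\<chi> i j. LINT x|P. (f x $ i - (LINT y|P. f y $ i)) * (f x $ j - (LINT y|P. f y $ j)))"

definition positive_definite :: "real ^ 'q ^ 'q \<Rightarrow> bool" where
  "positive_definite A \<longleftrightarrow> transpose A = A \<and> (\<forall>v. v \<noteq> 0 \<longrightarrow> 0 < v \<bullet> (A *v v))"

text \<open>
  The integrability clauses say that mean and variance exist; a Bochner integral of a
  non-integrable function would be \<open>0\<close>.
\<close>

definition condition1 ::
    "(real ^ 'd) measure \<Rightarrow> (real ^ 'd \<Rightarrow> real ^ 'p \<Rightarrow> real ^ 'q) \<Rightarrow> real ^ 'p \<Rightarrow> bool" where
  "condition1 P g \<theta>\<^sub>0 \<longleftrightarrow>
     integrable P (\<lambda>x. g x \<theta>\<^sub>0) \<and> (LINT x|P. g x \<theta>\<^sub>0) = 0 \<and>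
     integrable P (\<lambda>x. (norm (g x \<theta>\<^sub>0))\<^sup>2) \<and>
     positive_definite (variance_matrix P (\<lambda>x. g x \<theta>\<^sub>0))"

text \<open>
  \<open>Dg x\<close> and \<open>D2g x\<close> are the first and second total derivatives of \<open>g x\<close> in \<open>\<theta>\<close>, with operator
  norms. The exceptional null set and the neighbourhood \<open>N\<close> do not depend on \<open>\<theta>\<close> and \<open>x\<close>,
  respectively.
\<close>

definition condition2 ::
    "(real ^ 'd) measure \<Rightarrow> (real ^ 'd \<Rightarrow> real ^ 'p \<Rightarrow> real ^ 'q) \<Rightarrow> real ^ 'p \<Rightarrow> bool" where
  "condition2 P g \<theta>\<^sub>0 \<longleftrightarrow>
     (\<exists>(Dg :: real ^ 'd \<Rightarrow> real ^ 'p \<Rightarrow> ((real ^ 'p) \<Rightarrow>\<^sub>L (real ^ 'q)))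
       (D2g :: real ^ 'd \<Rightarrow> real ^ 'p \<Rightarrow> ((real ^ 'p) \<Rightarrow>\<^sub>L ((real ^ 'p) \<Rightarrow>\<^sub>L (real ^ 'q)))) N G.
        open N \<and> \<theta>\<^sub>0 \<in> N \<and> integrable P (G :: real ^ 'd \<Rightarrow> real) \<and>
        (AE x in P.
           (\<forall>\<theta>. (g x has_derivative blinfun_apply (Dg x \<theta>)) (at \<theta>)) \<and>
           (\<forall>\<theta>. (Dg x has_derivative blinfun_apply (D2g x \<theta>)) (at \<theta>)) \<and>
           continuous_on UNIV (Dg x) \<and> continuous_on UNIV (D2g x) \<and>
           (\<forall>\<theta>\<in>N. norm (Dg x \<theta>) \<le> G x \<and> norm (D2g x \<theta>) \<le> G x)))"

definition condition3 ::
    "(real ^ 'd) measure \<Rightarrow> (real ^ 'd \<Rightarrow> real ^ 'p \<Rightarrow> real ^ 'q) \<Rightarrow> real ^ 'p \<Rightarrow> bool" where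
  "condition3 P g \<theta>\<^sub>0 \<longleftrightarrow>
     Limsup at_infinity (\<lambda>t. ereal (cmod (LINT x|P. iexp (t \<bullet> g x \<theta>\<^sub>0)))) < 1 \<and>
     integrable P (\<lambda>x. (norm (g x \<theta>\<^sub>0)) ^ 15)"


section \<open>Empirical likelihood\<close>

text \<open>A sample of size \<open>n\<close> is given by the values \<open>x 0, \<dots>, x (n - 1)\<close> of a sequence \<open>x\<close>.\<close>

definition el_domain ::
    "(real ^ 'd \<Rightarrow> real ^ 'p \<Rightarrow> real ^ 'q) \<Rightarrow> nat \<Rightarrow> (nat \<Rightarrow> real ^ 'd) \<Rightarrow> (real ^ 'p) set" where
  "el_domain g n x =
     {\<theta>. \<exists>w :: nat \<Rightarrow> real. (\<forall>i<n. 0 < w i) \<and> (\<Sum>i<n. w i) = 1 \<and>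
           (\<Sum>i<n. w i *\<^sub>R g (x i) \<theta>) = 0}"

text \<open>
  The supremum is over a non-empty bounded set when \<open>\<theta> \<in> el_domain g n x\<close>; then
  \<open>0 < el_ratio g n x \<theta> \<le> 1\<close>. The value for an infeasible \<open>\<theta>\<close> is irrelevant: the likelihood
  is only ever evaluated on the domain.
\<close>

definition el_ratio ::
    "(real ^ 'd \<Rightarrow> real ^ 'p \<Rightarrow> real ^ 'q) \<Rightarrow> nat \<Rightarrow> (nat \<Rightarrow> real ^ 'd) \<Rightarrow> real ^ 'p \<Rightarrow> real" where
  "el_ratio g n x \<theta> =
     Sup {(\<Prod>i<n. real n * w i) | w. (\<Sum>i<n. w i *\<^sub>R g (x i) \<theta>) = 0 \<and>
                                    (\<forall>i<n. 0 \<le> w i) \<and> (\<Sum>i<n. w i) = 1}"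

definition el_log_ratio ::
    "(real ^ 'd \<Rightarrow> real ^ 'p \<Rightarrow> real ^ 'q) \<Rightarrow> nat \<Rightarrow> (nat \<Rightarrow> real ^ 'd) \<Rightarrow> real ^ 'p \<Rightarrow> real" where
  "el_log_ratio g n x \<theta> = - 2 * ln (el_ratio g n x \<theta>)"


section \<open>Extended empirical likelihood\<close>

definition expansion_factor :: "nat \<Rightarrow> real \<Rightarrow> real" where
  "expansion_factor n l = 1 + l / (2 * real n)"

text \<open>In the following, \<open>\<theta>\<^sub>t\<close> is the value of the maximum empirical likelihood estimate.\<close>

definition composite_similarity ::
    "(real ^ 'd \<Rightarrow> real ^ 'p \<Rightarrow> real ^ 'q) \<Rightarrow> nat \<Rightarrow> (nat \<Rightarrow> real ^ 'd) \<Rightarrow>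
       real ^ 'p \<Rightarrow> real ^ 'p \<Rightarrow> real ^ 'p" where
  "composite_similarity g n x \<theta>\<^sub>t \<theta> =
     \<theta>\<^sub>t + expansion_factor n (el_log_ratio g n x \<theta>) *\<^sub>R (\<theta> - \<theta>\<^sub>t)"

definition similarity_fibre ::
    "(real ^ 'd \<Rightarrow> real ^ 'p \<Rightarrow> real ^ 'q) \<Rightarrow> nat \<Rightarrow> (nat \<Rightarrow> real ^ 'd) \<Rightarrow>
       real ^ 'p \<Rightarrow> real ^ 'p \<Rightarrow> (real ^ 'p) set" where
  "similarity_fibre g n x \<theta>\<^sub>t \<theta> =
     {\<theta>' \<in> el_domain g n x. composite_similarity g n x \<theta>\<^sub>t \<theta>' = \<theta>}"

text \<open>
  All points of a fibre lie on one ray from \<open>\<theta>\<close> (towards \<open>\<theta>\<^sub>t\<close>), so a closest point, if there is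
  one, is unique.
\<close>

definition similarity_inverse ::
    "(real ^ 'd \<Rightarrow> real ^ 'p \<Rightarrow> real ^ 'q) \<Rightarrow> nat \<Rightarrow> (nat \<Rightarrow> real ^ 'd) \<Rightarrow>
       real ^ 'p \<Rightarrow> real ^ 'p \<Rightarrow> real ^ 'p" where
  "similarity_inverse g n x \<theta>\<^sub>t \<theta> =
     arg_min_on (\<lambda>\<theta>'. norm (\<theta>' - \<theta>)) (similarity_fibre g n x \<theta>\<^sub>t \<theta>)"

definition eel_log_ratio ::
    "(real ^ 'd \<Rightarrow> real ^ 'p \<Rightarrow> real ^ 'q) \<Rightarrow> nat \<Rightarrow> (nat \<Rightarrow> real ^ 'd) \<Rightarrow>
       real ^ 'p \<Rightarrow> real ^ 'p \<Rightarrow> real" where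
  "eel_log_ratio g n x \<theta>\<^sub>t \<theta> = el_log_ratio g n x (similarity_inverse g n x \<theta>\<^sub>t \<theta>)"

end

theory Submission
  imports Defs "HOL-Real_Asymp.Real_Asymp"
begin

text \<open>
  Close to \<open>\<theta>\<^sub>0\<close> the empirical log-likelihood ratio is, with high probability, almost a quadratic form. A linear change of the
  estimating function leaves the empirical likelihood unchanged, so its covariance matrix may be
  taken to be the identity; then \<open>l(\<theta>) = n \<parallel>m(\<theta>)\<parallel>\<^sup>2 (1 + o(1))\<close>, where \<open>m(\<theta>)\<close> is the mean of
  \<open>g(X\<^sub>1,\<theta>), \<dots>, g(X\<^sub>n,\<theta>)\<close>, uniformly over \<open>\<parallel>\<theta> - \<theta>\<^sub>0\<parallel> \<le> K / \<surd>n\<close> (\<open>el_log_ratio_quadratic\<close>).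
  The Lagrange multiplier is avoided by bounding the two sides separately. From above, the
  explicit weights \<open>(1 - \<mu> \<bullet> (g\<^sub>i - m)) / n\<close> are feasible for a suitable \<open>\<mu> \<approx> m\<close>. From below, weak
  duality bounds the likelihood of all feasible weights by any dual vector, and the vector \<open>m\<close> is
  already good enough.

  A preimage of \<open>\<theta>\<^sub>0\<close> under the composite similarity has the form
  \<open>\<theta>\<^sub>t + s (\<theta>\<^sub>0 - \<theta>\<^sub>t)\<close> with \<open>s = 1 / (1 + l / 2n) \<le> 1\<close>, so it lies on the segment from \<open>\<theta>\<^sub>t\<close> to \<open>\<theta>\<^sub>0\<close>.
  On this segment \<open>l\<close> is continuous and bounded: the intermediate value theorem yields a preimage,
  compactness a closest one, and its distance from \<open>\<theta>\<^sub>0\<close> is at most \<open>sup l / (2n)\<close> times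
  \<open>\<parallel>\<theta>\<^sub>t - \<theta>\<^sub>0\<parallel>\<close> (\<open>similarity_inverse_near\<close>). That is of order \<open>n\<^bsup>-3/2\<^esup>\<close>, while near \<open>\<theta>\<^sub>0\<close> the mean \<open>m\<close>
  is Lipschitz with a constant bounded in probability. Hence \<open>l\<^sup>*(\<theta>\<^sub>0)\<close> differs from \<open>n \<parallel>m(\<theta>\<^sub>0)\<parallel>\<^sup>2\<close> by \<open>o(1)\<close>
  (\<open>eel_log_ratio_approx\<close>, which is free of probability).

  The limit of \<open>n \<parallel>m(\<theta>\<^sub>0)\<parallel>\<^sup>2\<close> follows from the one-dimensional central limit theorem, applied to
  every projection of \<open>m(\<theta>\<^sub>0)\<close>: it gives the limit of the characteristic functions of
  \<open>Z\<^sub>n = \<surd>n m(\<theta>\<^sub>0)\<close>. Averaging the characteristic function of \<open>Z\<close> over a Gaussian argument gives the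
  Laplace transform of \<open>\<parallel>Z\<parallel>\<^sup>2\<close>, and Laplace transforms, even on the multiples of one point,
  determine weak limits of nonnegative variables (\<open>weak_conv_norm_square_chi_squared\<close>).
  Finally an error that is small outside an event of small probability does not change the
  limit in distribution (\<open>converges_in_distribution_of_weak_conv_m\<close>).
\<close>

section \<open>Feasible weights and duality\<close>

lemma ln_one_plus_ge_cubic:
  fixes x :: real
  assumes "\<bar>x\<bar> \<le> 1/2"
  shows "x - x\<^sup>2 / 2 - \<bar>x\<bar> ^ 3 \<le> ln (1 + x)"
proof (cases "0 \<le> x")
  case True
  let ?f = "\<lambda>x::real. ln (1 + x) - x + x\<^sup>2 / 2 + x ^ 3"
  have "?f 0 \<le> ?f x"
  proof (rule DERIV_nonneg_imp_nondecreasing[of 0 x ?f, OF True])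
    fix y :: real assume y: "0 \<le> y" "y \<le> x"
    have "(?f has_real_derivative (1 / (1 + y) - 1 + y + 3 * y\<^sup>2)) (at y)"
      using y by (auto intro!: derivative_eq_intros simp: field_simps power2_eq_square)
    moreover have "1 / (1 + y) - 1 + y + 3 * y\<^sup>2 = y\<^sup>2 / (1 + y) + 3 * y\<^sup>2"
      using y by (simp add: field_simps power2_eq_square)
    ultimately show "\<exists>d. (?f has_real_derivative d) (at y) \<and> 0 \<le> d"
      using y by (intro exI[of _ "1 / (1 + y) - 1 + y + 3 * y\<^sup>2"]) simp
  qed
  with True show ?thesis by simp
next
  case False
  let ?f = "\<lambda>x::real. ln (1 + x) - x + x\<^sup>2 / 2 - x ^ 3"
  have "?f x \<ge> ?f 0"
  proof (rule DERIV_nonpos_imp_nonincreasing[of x 0 ?f])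
    show "x \<le> 0" using False by simp
    fix y :: real assume y: "x \<le> y" "y \<le> 0"
    have y': "1 + y \<ge> 1/2" using y assms by auto
    have "(?f has_real_derivative (1 / (1 + y) - 1 + y - 3 * y\<^sup>2)) (at y)"
      using y' by (auto intro!: derivative_eq_intros simp: field_simps power2_eq_square)
    moreover have "1 / (1 + y) - 1 + y - 3 * y\<^sup>2 = y\<^sup>2 * (1 / (1 + y) - 3)"
      using y' by (simp add: field_simps power2_eq_square)
    moreover have "1 / (1 + y) \<le> 2" using y' by (simp add: field_simps)
    ultimately show "\<exists>d. (?f has_real_derivative d) (at y) \<and> d \<le> 0"
      using y by (intro exI[of _ "1 / (1 + y) - 1 + y - 3 * y\<^sup>2"]) (simp add: mult_nonneg_nonpos)
  qed
  moreover have "\<bar>x\<bar> ^ 3 = - (x ^ 3)" using False by (simp add: power3_eq_cube)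
  ultimately show ?thesis by simp
qed

definition el_weights :: "nat \<Rightarrow> (nat \<Rightarrow> 'a::real_vector) \<Rightarrow> (nat \<Rightarrow> real) set" where
  "el_weights n a = {w. (\<forall>i<n. 0 \<le> w i) \<and> (\<Sum>i<n. w i) = 1 \<and> (\<Sum>i<n. w i *\<^sub>R a i) = 0}"

definition el_prod :: "nat \<Rightarrow> (nat \<Rightarrow> real) \<Rightarrow> real" where
  "el_prod n w = (\<Prod>i<n. real n * w i)"

lemma el_ratio_eq_SUP:
  "el_ratio g n x \<theta> = (SUP w\<in>el_weights n (\<lambda>i. g (x i) \<theta>). el_prod n w)"
  unfolding el_ratio_def el_weights_def el_prod_def image_def
  by (rule arg_cong[of _ _ Sup]) auto

lemma el_domain_iff_pos_weights:
  "\<theta> \<in> el_domain g n x \<longleftrightarrow> (\<exists>w\<in>el_weights n (\<lambda>i. g (x i) \<theta>). \<forall>i<n. 0 < w i)"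
  unfolding el_domain_def el_weights_def by (auto intro: less_imp_le)

lemma el_weights_imp_sample_pos: "w \<in> el_weights n a \<Longrightarrow> 0 < n"
  unfolding el_weights_def by (cases n) auto

text \<open>
  Weak duality: multiply the likelihood by the product of the factors \<open>1 + l \<bullet> a\<^sub>i\<close> and bound each
  new factor \<open>z\<close> by \<open>exp (z - 1)\<close>. The constraints on the weights make the exponents add up to zero.
\<close>

lemma el_prod_dual_bound:
  fixes a :: "nat \<Rightarrow> 'a::real_inner"
  assumes w: "w \<in> el_weights n a" and pos: "\<And>i. i < n \<Longrightarrow> 0 < 1 + l \<bullet> a i"
  shows "el_prod n w \<le> exp (- (\<Sum>i<n. ln (1 + l \<bullet> a i)))"
proof -
  have n: "0 < n" using w by (rule el_weights_imp_sample_pos)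
  have w0: "0 \<le> w i" if "i < n" for i using w that by (auto simp: el_weights_def)
  have "el_prod n w * (\<Prod>i<n. 1 + l \<bullet> a i) = (\<Prod>i<n. real n * w i * (1 + l \<bullet> a i))"
    by (simp add: el_prod_def prod.distrib)
  also have "\<dots> \<le> (\<Prod>i<n. exp (real n * w i * (1 + l \<bullet> a i) - 1))"
  proof (rule prod_mono, safe)
    fix i assume "i < n"
    then show "0 \<le> real n * w i * (1 + l \<bullet> a i)"
      using w0 pos by (auto intro!: mult_nonneg_nonneg simp: less_imp_le)
    show "real n * w i * (1 + l \<bullet> a i) \<le> exp (real n * w i * (1 + l \<bullet> a i) - 1)"
      using exp_ge_add_one_self[of "real n * w i * (1 + l \<bullet> a i) - 1"] by linarith
  qed
  also have "\<dots> = exp (\<Sum>i<n. real n * w i * (1 + l \<bullet> a i) - 1)"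
    by (simp add: exp_sum)
  also have "(\<Sum>i<n. real n * w i * (1 + l \<bullet> a i) - 1) = 0"
  proof -
    have "(\<Sum>i<n. real n * w i * (1 + l \<bullet> a i) - 1) =
        real n * (\<Sum>i<n. w i) + real n * (l \<bullet> (\<Sum>i<n. w i *\<^sub>R a i)) - real n"
      by (simp add: algebra_simps sum.distrib sum_subtractf sum_distrib_left inner_sum_right)
    then show ?thesis using w by (simp add: el_weights_def)
  qed
  finally have "el_prod n w * (\<Prod>i<n. 1 + l \<bullet> a i) \<le> 1" by simp
  moreover have "(\<Prod>i<n. 1 + l \<bullet> a i) = exp (\<Sum>i<n. ln (1 + l \<bullet> a i))"
    using pos by (subst exp_sum) (auto intro!: prod.cong)
  ultimately show ?thesis
    by (simp add: exp_minus field_simps)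
qed

lemma el_prod_le_1:
  fixes a :: "nat \<Rightarrow> 'a::real_inner"
  assumes "w \<in> el_weights n a" shows "el_prod n w \<le> 1"
  using el_prod_dual_bound[OF assms, of 0] by simp

lemma bdd_above_el_prod: 
  fixes a :: "nat \<Rightarrow> 'a::real_inner"
  shows "bdd_above (el_prod n ` el_weights n a)"
  by (auto intro!: bdd_aboveI[of _ 1] el_prod_le_1)

lemma el_prod_le_ratio:
  assumes "w \<in> el_weights n (\<lambda>i. g (x i) \<theta>)"
  shows "el_prod n w \<le> el_ratio g n x \<theta>"
  unfolding el_ratio_eq_SUP by (intro cSUP_upper assms bdd_above_el_prod)

lemma el_ratio_bounds:
  assumes "\<theta> \<in> el_domain g n x"
  shows "0 < el_ratio g n x \<theta>" "el_ratio g n x \<theta> \<le> 1"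
proof -
  obtain w where w: "w \<in> el_weights n (\<lambda>i. g (x i) \<theta>)" "\<And>i. i < n \<Longrightarrow> 0 < w i"
    using assms unfolding el_domain_iff_pos_weights by blast
  have "0 < n" using w(1) by (rule el_weights_imp_sample_pos)
  then have "0 < el_prod n w" unfolding el_prod_def by (intro prod_pos) (auto simp: w)
  also have "\<dots> \<le> el_ratio g n x \<theta>" by (rule el_prod_le_ratio) fact
  finally show "0 < el_ratio g n x \<theta>" .
  show "el_ratio g n x \<theta> \<le> 1"
    unfolding el_ratio_eq_SUP using w(1) by (intro cSUP_least) (auto intro: el_prod_le_1)
qed

text \<open>
  Repairing the constraint. Any positive weights \<open>w\<close> become feasible after multiplication by factors
  \<open>1 - \<mu> \<bullet> (a\<^sub>i - m)\<close>: their sum stays one because the \<open>a\<^sub>i - m\<close> have weighted mean zero, and the weighted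
  mean of the \<open>a\<^sub>i\<close> moves from \<open>m\<close> to \<open>m - S \<mu>\<close>, where \<open>S\<close> is the weighted covariance matrix. The vector
  \<open>\<mu> = S\<^sup>-\<^sup>1 m\<close> is no longer than \<open>\<parallel>m\<parallel> / \<kappa>\<close> if \<open>\<kappa>\<close> bounds \<open>S\<close> from below. Equal weights \<open>w\<close> give the
  upper bound on the likelihood ratio at one parameter; weights that are optimal for a neighbouring
  parameter give continuity.
\<close>

lemma tilted_weights:
  fixes a :: "nat \<Rightarrow> 'a::euclidean_space"
  assumes w: "\<And>i. i < n \<Longrightarrow> 0 < w i" "(\<Sum>i<n. w i) = 1"
    and m: "m = (\<Sum>i<n. w i *\<^sub>R a i)"
    and \<kappa>: "0 < \<kappa>" "\<And>v. \<kappa> * (norm v)\<^sup>2 \<le> (\<Sum>i<n. w i * (v \<bullet> (a i - m))\<^sup>2)"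
  obtains \<mu> where "norm \<mu> \<le> norm m / \<kappa>"
    "(\<Sum>i<n. w i * (\<mu> \<bullet> (a i - m))\<^sup>2) = \<mu> \<bullet> m" 
    "(\<Sum>i<n. w i * (\<mu> \<bullet> (a i - m))) = 0"
    "(\<forall>i<n. \<mu> \<bullet> (a i - m) < 1) \<longrightarrow> (\<lambda>i. w i * (1 - \<mu> \<bullet> (a i - m))) \<in> el_weights n a"
proof -
  define S where "S v = (\<Sum>i<n. (w i * (v \<bullet> (a i - m))) *\<^sub>R (a i - m))" for v
  have lin: "linear S"
    unfolding S_def by (intro linearI) (simp_all add: inner_add_left distrib_left scaleR_add_left sum.distrib scaleR_sum_right mult.left_commute)
  have vSv: "v \<bullet> S v = (\<Sum>i<n. w i * (v \<bullet> (a i - m))\<^sup>2)" for v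
    by (simp add: S_def inner_sum_right power2_eq_square mult_ac)
  have "inj S"
  proof (rule linear_injective_0[OF lin, THEN iffD2], safe)
    fix v assume "S v = 0"
    then have "\<kappa> * (norm v)\<^sup>2 \<le> 0" using \<kappa>(2)[of v] vSv[of v] by simp
    then show "v = 0" using \<kappa>(1) by (auto simp: mult_le_0_iff)
  qed
  then have "surj S" using lin by (simp add: linear_injective_imp_surjective)
  then obtain \<mu> where \<mu>: "S \<mu> = m" by (metis surjD)
  have sum_c: "(\<Sum>i<n. w i *\<^sub>R (a i - m)) = 0"
    using w(2) m by (simp add: scaleR_diff_right sum_subtractf flip: scaleR_sum_left)
  have 0: "(\<Sum>i<n. w i * (\<mu> \<bullet> (a i - m))) = 0"
    using arg_cong[OF sum_c, of "inner \<mu>"] by (simp add: inner_sum_right)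
  have 1: "norm \<mu> \<le> norm m / \<kappa>"
  proof (cases "\<mu> = 0")
    case False
    have "\<kappa> * (norm \<mu>)\<^sup>2 \<le> \<mu> \<bullet> m" using \<kappa>(2)[of \<mu>] vSv[of \<mu>] \<mu> by simp
    also have "\<dots> \<le> norm \<mu> * norm m" by (rule norm_cauchy_schwarz)
    finally show ?thesis using False \<kappa>(1) by (simp add: power2_eq_square field_simps)
  qed (use \<kappa>(1) in simp)
  show thesis
  proof (rule that[OF 1 _ 0])
    show "(\<Sum>i<n. w i * (\<mu> \<bullet> (a i - m))\<^sup>2) = \<mu> \<bullet> m" using vSv[of \<mu>] \<mu> by simp
    have "(\<Sum>i<n. (w i * (1 - \<mu> \<bullet> (a i - m))) *\<^sub>R a i) =
       (\<Sum>i<n. w i *\<^sub>R a i) - (\<Sum>i<n. (w i * (\<mu> \<bullet> (a i - m))) *\<^sub>R (a i - m))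
          - (\<Sum>i<n. w i * (\<mu> \<bullet> (a i - m))) *\<^sub>R m"
      by (simp add: scaleR_sum_left scaleR_diff_right algebra_simps flip: sum_subtractf sum.distrib)
    also have "\<dots> = 0" using \<mu> 0 m by (simp add: S_def)
    finally show "(\<forall>i<n. \<mu> \<bullet> (a i - m) < 1) \<longrightarrow>
        (\<lambda>i. w i * (1 - \<mu> \<bullet> (a i - m))) \<in> el_weights n a"
      using w 0 by (auto simp: el_weights_def right_diff_distrib sum_subtractf less_imp_le)
  qed
qed

lemma sum_weighted_centred_square:
  fixes a :: "nat \<Rightarrow> 'a::real_inner"
  assumes "(\<Sum>i<n. w i) = 1"
    and m: "m = (\<Sum>i<n. w i *\<^sub>R a i)"
  shows "(\<Sum>i<n. w i * (v \<bullet> (a i - c))\<^sup>2) = (\<Sum>i<n. w i * (v \<bullet> (a i - m))\<^sup>2) + (v \<bullet> (m - c))\<^sup>2"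
proof -
  have vm: "v \<bullet> m = (\<Sum>i<n. w i * (v \<bullet> a i))" by (simp add: m inner_sum_right)
  have *: "(\<Sum>i<n. w i * (v \<bullet> (a i - c))\<^sup>2) = (\<Sum>i<n. w i * (v \<bullet> a i)\<^sup>2) - 2 * (v \<bullet> c) * (v \<bullet> m) + (v \<bullet> c)\<^sup>2" for c
  proof -
    have "(\<Sum>i<n. w i * (v \<bullet> (a i - c))\<^sup>2) =
        (\<Sum>i<n. w i * (v \<bullet> a i)\<^sup>2 - 2 * (v \<bullet> c) * (w i * (v \<bullet> a i)) + w i * (v \<bullet> c)\<^sup>2)"
      by (intro sum.cong) (simp_all add: inner_diff_right power2_eq_square algebra_simps)
    also have "\<dots> = (\<Sum>i<n. w i * (v \<bullet> a i)\<^sup>2) - 2 * (v \<bullet> c) * (v \<bullet> m) + (\<Sum>i<n. w i) * (v \<bullet> c)\<^sup>2"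
      unfolding vm by (simp add: sum.distrib sum_subtractf sum_distrib_left sum_distrib_right)
    finally show ?thesis using assms(1) by simp
  qed
  show ?thesis unfolding *[of c] *[of m] by (simp add: inner_diff_right power2_eq_square algebra_simps)
qed

section \<open>Quadratic expansion of the log-likelihood ratio\<close>

lemma norm_mean_le:
  fixes a :: "nat \<Rightarrow> 'a::real_normed_vector"
  assumes "\<And>i. i < n \<Longrightarrow> 0 \<le> w i" "(\<Sum>i<n. w i) = 1" "\<And>i. i < n \<Longrightarrow> norm (a i) \<le> D"
  shows "norm (\<Sum>i<n. w i *\<^sub>R a i) \<le> D"
proof -
  have "norm (\<Sum>i<n. w i *\<^sub>R a i) \<le> (\<Sum>i<n. w i * D)"
    using assms by (intro sum_norm_le) (auto intro!: mult_left_mono)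
  also have "\<dots> = D" using assms(2) by (simp flip: sum_distrib_right)
  finally show ?thesis .
qed

lemma el_log_ratio_le:
  assumes w: "w \<in> el_weights n (\<lambda>i. g (x i) \<theta>)" and pos: "\<And>i. i < n \<Longrightarrow> 0 < w i"
  shows "el_log_ratio g n x \<theta> \<le> - 2 * (\<Sum>i<n. ln (real n * w i))"
proof -
  have "0 < n" using w by (rule el_weights_imp_sample_pos)
  then have "el_prod n w = exp (\<Sum>i<n. ln (real n * w i))"
    unfolding el_prod_def by (subst exp_sum) (auto intro!: prod.cong simp: pos)
  with el_prod_le_ratio[of w n g x \<theta>, OF w] have le: "exp (\<Sum>i<n. ln (real n * w i)) \<le> el_ratio g n x \<theta>" by simp
  then have "0 < el_ratio g n x \<theta>" using less_le_trans[OF exp_gt_zero] by blast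
  with le have "(\<Sum>i<n. ln (real n * w i)) \<le> ln (el_ratio g n x \<theta>)" by (simp add: ln_ge_iff)
  then show ?thesis by (simp add: el_log_ratio_def)
qed

lemma el_log_ratio_ge:
  assumes "\<theta> \<in> el_domain g n x" "\<And>i. i < n \<Longrightarrow> 0 < 1 + l \<bullet> g (x i) \<theta>"
  shows "2 * (\<Sum>i<n. ln (1 + l \<bullet> g (x i) \<theta>)) \<le> el_log_ratio g n x \<theta>"
proof -
  have "el_ratio g n x \<theta> \<le> exp (- (\<Sum>i<n. ln (1 + l \<bullet> g (x i) \<theta>)))"
    using assms unfolding el_ratio_eq_SUP el_domain_iff_pos_weights
    by (intro cSUP_least el_prod_dual_bound) auto
  then have "ln (el_ratio g n x \<theta>) \<le> - (\<Sum>i<n. ln (1 + l \<bullet> g (x i) \<theta>))"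
    using el_ratio_bounds(1)[OF assms(1)] by (metis exp_gt_zero ln_exp ln_mono)
  then show ?thesis by (simp add: el_log_ratio_def)
qed

lemma el_log_ratio_nonneg:
  assumes "\<theta> \<in> el_domain g n x" shows "0 \<le> el_log_ratio g n x \<theta>"
  using el_ratio_bounds[OF assms] by (simp add: el_log_ratio_def)

lemma mean_centred_quadratic_ge:
  fixes a :: "nat \<Rightarrow> 'a::real_inner"
  assumes n: "0 < n" and m: "m = (\<Sum>i<n. (1 / real n) *\<^sub>R a i)"
    and S: "\<bar>(\<Sum>i<n. (v \<bullet> a i)\<^sup>2) / real n - (norm v)\<^sup>2\<bar> \<le> \<eta> * (norm v)\<^sup>2"
    and "(norm m)\<^sup>2 \<le> \<eta>"
  shows "(1 - 2 * \<eta>) * (norm v)\<^sup>2 \<le> (\<Sum>i<n. (1 / real n) * (v \<bullet> (a i - m))\<^sup>2)"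
proof -
  have "(v \<bullet> m)\<^sup>2 \<le> (norm v * norm m)\<^sup>2"
    by (meson Cauchy_Schwarz_ineq2 abs_ge_zero order.trans power2_abs power_mono power2_le_iff_abs_le norm_ge_zero zero_le_mult_iff)
  also have "\<dots> \<le> (norm v)\<^sup>2 * \<eta>" using assms(4) by (simp add: power_mult_distrib mult_left_mono)
  finally have "(v \<bullet> m)\<^sup>2 \<le> \<eta> * (norm v)\<^sup>2" by (simp add: mult.commute)
  moreover have "(\<Sum>i<n. (1 / real n) * (v \<bullet> (a i - 0))\<^sup>2) =
      (\<Sum>i<n. (1 / real n) * (v \<bullet> (a i - m))\<^sup>2) + (v \<bullet> (m - 0))\<^sup>2"
    using n by (intro sum_weighted_centred_square m) simp
  ultimately show ?thesis using S by (simp add: algebra_simps abs_le_iff sum_divide_distrib)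
qed

text \<open>
  Here \<open>\<eta>\<close> collects the three relative errors: the second moments differ from the identity by at most
  \<open>\<eta>\<close>, and \<open>D \<parallel>m\<parallel>\<close>, which controls the arguments of the logarithm, and \<open>\<parallel>m\<parallel>\<^sup>2\<close>, the effect of centring, are at
  most of order \<open>\<eta>\<close>. The upper bound uses the tilted equal weights, the lower bound the dual vector \<open>m\<close>;
  in both cases the expansion of the logarithm to second order leaves \<open>n \<parallel>m\<parallel>\<^sup>2\<close>.
\<close>

lemma el_log_ratio_quadratic:
  fixes g :: "real ^ 'd \<Rightarrow> real ^ 'p \<Rightarrow> real ^ 'q"
  assumes n: "0 < n" and m: "m = (\<Sum>i<n. (1 / real n) *\<^sub>R g (x i) \<theta>)"
    and \<eta>: "0 \<le> \<eta>" "\<eta> \<le> 1/4"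
    and S: "\<And>v. \<bar>(\<Sum>i<n. (v \<bullet> g (x i) \<theta>)\<^sup>2) / real n - (norm v)\<^sup>2\<bar> \<le> \<eta> * (norm v)\<^sup>2"
    and D: "\<And>i. i < n \<Longrightarrow> norm (g (x i) \<theta>) \<le> D"
    and small: "4 * D * norm m \<le> \<eta>" "(norm m)\<^sup>2 \<le> \<eta>"
  shows "\<theta> \<in> el_domain g n x"
    and "\<bar>el_log_ratio g n x \<theta> - n * (norm m)\<^sup>2\<bar> \<le> 8 * \<eta> * (n * (norm m)\<^sup>2)"
proof -
  define a where "a i = g (x i) \<theta>" for i
  define \<kappa> where "\<kappa> = 1 - 2 * \<eta>"
  have \<kappa>: "1/2 \<le> \<kappa>" using \<eta> by (simp add: \<kappa>_def)
  have D': "norm (a i) \<le> D" if "i < n" for i using D that by (simp add: a_def)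
  have D0: "0 \<le> D" using D'[of 0] n by (meson norm_ge_zero order_trans)
  have mD: "norm m \<le> D" unfolding m using n D by (intro norm_mean_le) auto
  have m': "m = (\<Sum>i<n. (1 / real n) *\<^sub>R a i)" by (simp add: m a_def)
  (* Centring costs the second moments another |m|^2 <= eta, hence kappa = 1 - 2 eta. *)
  obtain \<mu> where \<mu>: "norm \<mu> \<le> norm m / \<kappa>"
    "(\<Sum>i<n. (1 / real n) * (\<mu> \<bullet> (a i - m))\<^sup>2) = \<mu> \<bullet> m" 
    "(\<Sum>i<n. (1 / real n) * (\<mu> \<bullet> (a i - m))) = 0"
    "(\<forall>i<n. \<mu> \<bullet> (a i - m) < 1) \<longrightarrow> (\<lambda>i. (1 / real n) * (1 - \<mu> \<bullet> (a i - m))) \<in> el_weights n a"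
  proof (rule tilted_weights[of n "\<lambda>_. 1 / real n" m a \<kappa>])
    show "0 < 1 / real n" "(\<Sum>i<n. 1 / real n) = 1" using n by auto
    show "m = (\<Sum>i<n. (1 / real n) *\<^sub>R a i)" by fact
    show "0 < \<kappa>" using \<kappa> by simp
    fix v show "\<kappa> * (norm v)\<^sup>2 \<le> (\<Sum>i<n. 1 / real n * (v \<bullet> (a i - m))\<^sup>2)"
      unfolding \<kappa>_def using S small(2) by (intro mean_centred_quadratic_ge n m') (auto simp: a_def)
  qed blast
  define y where "y i = \<mu> \<bullet> (a i - m)" for i
  have y: "\<bar>y i\<bar> \<le> \<eta>" if "i < n" for i
  proof -
    have "norm (a i - m) \<le> D + D" using norm_triangle_ineq4[of "a i" m] D'[OF that] mD by linarith
    have "\<bar>y i\<bar> \<le> norm \<mu> * norm (a i - m)" unfolding y_def by (rule Cauchy_Schwarz_ineq2)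
    also have "\<dots> \<le> (norm m / (1/2)) * (D + D)"
    proof (rule mult_mono)
      have "norm m / \<kappa> \<le> norm m / (1/2)" using \<kappa> by (intro divide_left_mono) auto
      then show "norm \<mu> \<le> norm m / (1/2)" using \<mu>(1) by linarith
    qed (fact | simp)+
    also have "\<dots> \<le> \<eta>" using small(1) by (simp add: algebra_simps)
    finally show ?thesis .
  qed
  have y1: "y i < 1" if "i < n" for i using y[OF that] \<eta> by linarith
  have wy: "(\<lambda>i. (1 / real n) * (1 - y i)) \<in> el_weights n (\<lambda>i. g (x i) \<theta>)"
    using \<mu>(4) y1 unfolding y_def a_def by blast
  then show dom: "\<theta> \<in> el_domain g n x"
    unfolding el_domain_iff_pos_weights using n y1 by (intro bexI[OF _ wy]) auto
  (* For |z| <= eta the cubic remainder is absorbed into the quadratic term. *)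
  have cubic: "z - (1/2 + \<eta>) * z\<^sup>2 \<le> ln (1 + z)" if "\<bar>z\<bar> \<le> \<eta>" for z
  proof -
    have "\<bar>z\<bar> ^ 3 = \<bar>z\<bar> * z\<^sup>2" by (simp add: power3_eq_cube power2_eq_square)
    also have "\<dots> \<le> \<eta> * z\<^sup>2" using that by (intro mult_right_mono) auto
    finally show ?thesis using ln_one_plus_ge_cubic[of z] that \<eta> by (simp add: algebra_simps)
  qed
  have sy: "(\<Sum>i<n. y i) = 0" using \<mu>(3) n by (simp add: y_def flip: sum_divide_distrib)
  have "(\<Sum>i<n. (y i)\<^sup>2) = n * (\<mu> \<bullet> m)" using \<mu>(2) n by (simp add: y_def field_simps flip: sum_divide_distrib)
  also have "\<mu> \<bullet> m \<le> (norm m / \<kappa>) * norm m"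
    by (rule order_trans[OF norm_cauchy_schwarz]) (intro mult_right_mono \<mu>(1) norm_ge_zero)
  finally have sy2: "(\<Sum>i<n. (y i)\<^sup>2) \<le> n * (norm m)\<^sup>2 / \<kappa>"
    using n by (simp add: power2_eq_square)
  have "el_log_ratio g n x \<theta> \<le> - 2 * (\<Sum>i<n. ln (real n * ((1 / real n) * (1 - y i))))"
    using n y1 by (intro el_log_ratio_le wy) simp
  also have "\<dots> = - 2 * (\<Sum>i<n. ln (1 + (- y i)))" using n by simp
  also have "\<dots> \<le> - 2 * (\<Sum>i<n. (- y i) - (1/2 + \<eta>) * (- y i)\<^sup>2)"
    using y by (intro mult_left_mono_neg sum_mono cubic) auto
  also have "\<dots> = (1 + 2 * \<eta>) * (\<Sum>i<n. (y i)\<^sup>2)"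
    using sy by (simp add: sum_subtractf sum_negf algebra_simps flip: sum_distrib_left sum_divide_distrib)
      (simp add: sum.distrib algebra_simps flip: sum_distrib_left sum_divide_distrib)
  also have "\<dots> \<le> (1 + 2 * \<eta>) * (n * (norm m)\<^sup>2 / \<kappa>)" using sy2 \<eta> by (intro mult_left_mono) auto
  also have "\<dots> = ((1 + 2 * \<eta>) / \<kappa>) * (n * (norm m)\<^sup>2)" by simp
  also have "\<dots> \<le> (1 + 8 * \<eta>) * (n * (norm m)\<^sup>2)"
  proof (rule mult_right_mono)
    have "\<eta> * \<eta> \<le> \<eta> * (1/4)" using \<eta> by (intro mult_left_mono) auto
    then have "1 + 2 * \<eta> \<le> (1 + 8 * \<eta>) * \<kappa>" by (simp add: \<kappa>_def algebra_simps)
    then show "(1 + 2 * \<eta>) / \<kappa> \<le> 1 + 8 * \<eta>" using \<kappa> by (simp add: divide_le_eq)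
  qed simp
  finally have upper: "el_log_ratio g n x \<theta> \<le> (1 + 8 * \<eta>) * (n * (norm m)\<^sup>2)" .
  (* The lower bound takes m itself, the first-order solution, as dual vector. *)
  have z: "\<bar>m \<bullet> a i\<bar> \<le> \<eta>" if "i < n" for i
  proof -
    have "\<bar>m \<bullet> a i\<bar> \<le> norm m * norm (a i)" by (rule Cauchy_Schwarz_ineq2)
    also have "\<dots> \<le> norm m * D" using D'[OF that] by (intro mult_left_mono) auto
    also have "\<dots> \<le> 4 * D * norm m" using D0 by (simp add: mult.commute)
    finally show ?thesis using small(1) by linarith
  qed
  have "(\<Sum>i<n. m \<bullet> a i) = n * (m \<bullet> m)"
    using arg_cong[OF m', of "inner m"] n by (simp add: inner_sum_right flip: sum_divide_distrib)
  then have sz: "(\<Sum>i<n. m \<bullet> a i) = n * (norm m)\<^sup>2" by (simp add: power2_norm_eq_inner)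
  have sz2: "(\<Sum>i<n. (m \<bullet> a i)\<^sup>2) \<le> (1 + \<eta>) * (n * (norm m)\<^sup>2)"
    using S[of m] n by (simp add: a_def abs_le_iff field_simps)
  have "\<eta> * \<eta> \<le> \<eta> * (1/4)" using \<eta> by (intro mult_left_mono) auto
  then have "(1 - 8 * \<eta>) * (n * (norm m)\<^sup>2) \<le> (2 - (1 + 2 * \<eta>) * (1 + \<eta>)) * (n * (norm m)\<^sup>2)"
    using \<eta> by (intro mult_right_mono) (auto simp: algebra_simps)
  also have "\<dots> = 2 * (n * (norm m)\<^sup>2) - (1 + 2 * \<eta>) * ((1 + \<eta>) * (n * (norm m)\<^sup>2))"
    by (simp add: left_diff_distrib mult.assoc)
  also have "\<dots> \<le> 2 * (\<Sum>i<n. m \<bullet> a i) - (1 + 2 * \<eta>) * (\<Sum>i<n. (m \<bullet> a i)\<^sup>2)"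
    using sz2 \<eta> unfolding sz by (intro diff_left_mono mult_left_mono) auto
  also have "\<dots> = 2 * (\<Sum>i<n. (m \<bullet> a i) - (1/2 + \<eta>) * (m \<bullet> a i)\<^sup>2)"
    by (simp add: sum_subtractf algebra_simps flip: sum_distrib_left sum_divide_distrib)
      (simp add: sum.distrib algebra_simps flip: sum_distrib_left sum_divide_distrib)
  also have "\<dots> \<le> 2 * (\<Sum>i<n. ln (1 + m \<bullet> a i))"
    using z by (intro mult_left_mono sum_mono cubic) auto
  also have "\<dots> \<le> el_log_ratio g n x \<theta>"
  proof -
    have "0 < 1 + m \<bullet> g (x i) \<theta>" if "i < n" for i using z[OF that] \<eta> by (simp add: a_def)
    then show ?thesis unfolding a_def by (intro el_log_ratio_ge dom)
  qed
  finally show "\<bar>el_log_ratio g n x \<theta> - n * (norm m)\<^sup>2\<bar> \<le> 8 * \<eta> * (n * (norm m)\<^sup>2)"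
    using upper by (simp add: abs_le_iff algebra_simps)
qed

section \<open>Continuity of the log-likelihood ratio\<close>

text \<open>
  No factor of the likelihood exceeds \<open>n\<close>, so a likelihood bounded away from zero keeps every single
  weight away from zero.
\<close>

lemma el_weight_ge:
  assumes w: "w \<in> el_weights n a" and \<rho>: "\<rho> \<le> el_prod n w" and i: "i < n"
  shows "\<rho> / real n ^ n \<le> w i"
proof -
  have n: "0 < n" using i by simp
  have w0: "0 \<le> w j" if "j < n" for j using w that by (auto simp: el_weights_def)
  have w1: "w j \<le> 1" if "j < n" for j
    using w that member_le_sum[of j "{..<n}" w] by (auto simp: el_weights_def)
  have "\<rho> \<le> real n * w i * (\<Prod>j\<in>{..<n}-{i}. real n * w j)"
    using \<rho> i by (simp add: el_prod_def prod.remove[of "{..<n}" i])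
  also have "(\<Prod>j\<in>{..<n}-{i}. real n * w j) \<le> (\<Prod>j\<in>{..<n}-{i}. real n)"
    using w0 w1 by (intro prod_mono) (auto intro!: mult_left_le)
  also have "\<dots> = real n ^ (n - 1)" using i by simp
  finally have "\<rho> \<le> (real n * w i) * real n ^ (n - 1)"
    using w0[OF i] by (simp add: mult_left_mono)
  also have "\<dots> = w i * real n ^ n" using n by (simp add: power_eq_if)
  finally show ?thesis using n by (simp add: divide_le_eq)
qed

text \<open>
  Weights that are feasible at \<open>\<theta>\<close> have a mean of size at most \<open>h\<close> at \<open>\<theta>'\<close>, so a tilt of size \<open>\<delta>\<close>
  repairs them and costs at most the factor \<open>exp (- 2 n \<delta>)\<close>. Only weights of likelihood above \<open>\<rho>\<close>
  matter for the supremum, and these are bounded below. The resulting constants are very poor in \<open>n\<close>,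
  but \<open>n\<close> is fixed while \<open>\<theta>'\<close> tends to \<open>\<theta>\<close>.
\<close>

lemma el_ratio_perturbation:
  fixes g :: "real ^ 'd \<Rightarrow> real ^ 'p \<Rightarrow> real ^ 'q"
  assumes n: "0 < n" and m': "m' = (\<Sum>i<n. (1 / real n) *\<^sub>R g (x i) \<theta>')"
    and \<kappa>: "0 < \<kappa>" "\<And>v. \<kappa> * (norm v)\<^sup>2 \<le> (\<Sum>i<n. (1 / real n) * (v \<bullet> (g (x i) \<theta>' - m'))\<^sup>2)"
    and D: "\<And>i. i < n \<Longrightarrow> norm (g (x i) \<theta>') \<le> D"
    and h: "\<And>i. i < n \<Longrightarrow> norm (g (x i) \<theta>' - g (x i) \<theta>) \<le> h"
    and dom: "\<theta> \<in> el_domain g n x" 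
    and \<rho>: "0 < \<rho>" "\<rho> < el_ratio g n x \<theta>" 
    and \<delta>: "\<delta> = 2 * D * h / (\<kappa> * \<rho> / real n ^ n)" "\<delta> \<le> 1/2"
  shows "exp (- 2 * real n * \<delta>) * el_ratio g n x \<theta> \<le> el_ratio g n x \<theta>'"
proof (rule ccontr)
  define R where "R = el_ratio g n x \<theta>'"
  assume "\<not> ?thesis"
  then have "max \<rho> (exp (2 * n * \<delta>) * R) < el_ratio g n x \<theta>"
    using \<rho> by (simp add: R_def exp_minus field_simps)
  then obtain w where w: "w \<in> el_weights n (\<lambda>i. g (x i) \<theta>)" "\<rho> < el_prod n w" "exp (2 * n * \<delta>) * R < el_prod n w"
    using dom unfolding el_ratio_eq_SUP el_domain_iff_pos_weights
    by (subst (asm) less_cSUP_iff) (auto intro: bdd_above_el_prod)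
  have w1: "(\<Sum>i<n. w i) = 1" using w(1) by (simp add: el_weights_def)
  define \<omega> where "\<omega> = \<rho> / real n ^ n"
  have \<omega>: "0 < \<omega>" using \<rho> n by (simp add: \<omega>_def)
  have w\<omega>: "\<omega> \<le> w i" if "i < n" for i
    unfolding \<omega>_def using w that by (intro el_weight_ge) auto
  have w0: "0 < w i" if "i < n" for i using w\<omega>[OF that] \<omega> by linarith
  have w0': "0 \<le> w i" if "i < n" for i using w0[OF that] by linarith
  define a where "a i = g (x i) \<theta>'" for i
  define m where "m = (\<Sum>i<n. w i *\<^sub>R a i)"
  have "m = (\<Sum>i<n. w i *\<^sub>R (g (x i) \<theta>' - g (x i) \<theta>))"
    using w(1) by (simp add: m_def a_def scaleR_diff_right sum_subtractf el_weights_def)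
  also have "norm \<dots> \<le> h" by (intro norm_mean_le w0' w1 h)
  finally have mh: "norm m \<le> h" .
  have mD: "norm m \<le> D" unfolding m_def a_def by (intro norm_mean_le w0' w1 D)
  have \<kappa>': "(\<kappa> * \<omega>) * (norm v)\<^sup>2 \<le> (\<Sum>i<n. w i * (v \<bullet> (a i - m))\<^sup>2)" for v
  proof -
    have "\<kappa> * (norm v)\<^sup>2 \<le> (\<Sum>i<n. (1 / real n) * (v \<bullet> (a i - m'))\<^sup>2)" using \<kappa>(2)[of v] by (simp add: a_def)
    also have "\<dots> \<le> (\<Sum>i<n. (1 / real n) * (v \<bullet> (a i - m))\<^sup>2)"
      using n by (subst (2) sum_weighted_centred_square[where m = m']) (simp_all add: m' a_def)
    also have "\<dots> \<le> (\<Sum>i<n. (v \<bullet> (a i - m))\<^sup>2)"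
      using n by (intro sum_mono) (auto simp: divide_le_eq mult_left_le mult_le_cancel_left1)
    finally have "\<omega> * (\<kappa> * (norm v)\<^sup>2) \<le> \<omega> * (\<Sum>i<n. (v \<bullet> (a i - m))\<^sup>2)"
      using \<omega> by (intro mult_left_mono) auto
    also have "\<dots> \<le> (\<Sum>i<n. w i * (v \<bullet> (a i - m))\<^sup>2)"
      unfolding sum_distrib_left using w\<omega> by (intro sum_mono mult_right_mono) auto
    finally show ?thesis by (simp add: mult_ac)
  qed
  have c: "0 < \<kappa> * \<omega>" using \<kappa>(1) \<omega> by simp
  obtain \<mu> where \<mu>: "norm \<mu> \<le> norm m / (\<kappa> * \<omega>)"
    "(\<forall>i<n. \<mu> \<bullet> (a i - m) < 1) \<longrightarrow> (\<lambda>i. w i * (1 - \<mu> \<bullet> (a i - m))) \<in> el_weights n a"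
    by (rule tilted_weights[OF w0 w1 m_def c \<kappa>']) blast
  define y where "y i = \<mu> \<bullet> (a i - m)" for i
  have y: "\<bar>y i\<bar> \<le> \<delta>" if "i < n" for i
  proof -
    have *: "norm (a i - m) \<le> D + D" 
      using norm_triangle_ineq4[of "a i" m] D[OF that] mD by (simp add: a_def)
    have "\<bar>y i\<bar> \<le> norm \<mu> * norm (a i - m)" unfolding y_def by (rule Cauchy_Schwarz_ineq2)
    also have "\<dots> \<le> (h / (\<kappa> * \<omega>)) * (D + D)"
    proof (rule mult_mono[OF _ *])
      show "norm \<mu> \<le> h / (\<kappa> * \<omega>)"
        using \<mu>(1) divide_right_mono[OF mh, of "\<kappa> * \<omega>"] c by linarith
      then show "0 \<le> h / (\<kappa> * \<omega>)" using norm_ge_zero order_trans by blast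
    qed simp
    also have "\<dots> = \<delta>" by (simp add: \<delta>(1) \<omega>_def field_simps)
    finally show ?thesis .
  qed
  have y1: "y i < 1" if "i < n" for i using y[OF that] \<delta>(2) by linarith
  have "el_prod n (\<lambda>i. w i * (1 - y i)) = el_prod n w * (\<Prod>i<n. 1 - y i)"
    by (simp add: el_prod_def prod.distrib mult.assoc flip: prod.distrib)
  moreover have "(\<Prod>i<n. exp (- 2 * \<delta>)) \<le> (\<Prod>i<n. 1 - y i)"
  proof (rule prod_mono, safe)
    fix i assume i: "i < n"
    have "\<bar>ln (1 + - y i) - - y i\<bar> \<le> 2 * (- y i)\<^sup>2"
      using y[OF i] \<delta>(2) by (intro abs_ln_one_plus_x_minus_x_bound) simp
    moreover have "2 * (y i)\<^sup>2 \<le> \<bar>y i\<bar>"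
    proof -
      have "\<bar>y i\<bar> * \<bar>y i\<bar> \<le> \<bar>y i\<bar> * (1/2)" using y[OF i] \<delta>(2) by (intro mult_left_mono) auto
      then show ?thesis by (simp add: power2_eq_square)
    qed
    ultimately have "- 2 * \<delta> \<le> ln (1 - y i)"
      using y[OF i] by (simp add: abs_le_iff) linarith
    then show "exp (- 2 * \<delta>) \<le> 1 - y i" using y1[OF i] by (simp add: ln_ge_iff)
  qed simp
  ultimately have "exp (- 2 * real n * \<delta>) * el_prod n w \<le> el_prod n (\<lambda>i. w i * (1 - y i))"
    using w(2) \<rho>(1) by (simp add: mult_left_mono mult.commute flip: exp_of_nat_mult) (simp add: mult_ac)
  also have "\<dots> \<le> R"
    unfolding R_def using \<mu>(2) y1 by (intro el_prod_le_ratio) (simp add: y_def a_def[abs_def])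
  finally show False using w(3) by (simp add: exp_minus field_simps)
qed

text \<open>
  The upper bound \<open>L\<close> keeps the likelihood ratio above a common \<open>\<rho>\<close>, so the perturbation bound applies with the same
  constants to every pair of parameters, in both directions: \<open>l\<close> is Lipschitz at small distances.
\<close>

lemma continuous_on_el_log_ratio:
  fixes g :: "real ^ 'd \<Rightarrow> real ^ 'p \<Rightarrow> real ^ 'q"
  assumes n: "0 < n" and "\<Theta> \<subseteq> el_domain g n x"
    and \<kappa>: "0 < \<kappa>" "\<And>\<theta> v. \<theta> \<in> \<Theta> \<Longrightarrow> \<kappa> * (norm v)\<^sup>2 \<le>
       (\<Sum>i<n. (1 / real n) * (v \<bullet> (g (x i) \<theta> - (\<Sum>i<n. (1 / real n) *\<^sub>R g (x i) \<theta>)))\<^sup>2)"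
    and D: "\<And>\<theta> i. \<theta> \<in> \<Theta> \<Longrightarrow> i < n \<Longrightarrow> norm (g (x i) \<theta>) \<le> D"
    and C: "\<And>\<theta> \<theta>' i. \<theta> \<in> \<Theta> \<Longrightarrow> \<theta>' \<in> \<Theta> \<Longrightarrow> i < n \<Longrightarrow> norm (g (x i) \<theta>' - g (x i) \<theta>) \<le> C * norm (\<theta>' - \<theta>)"
    and L: "\<And>\<theta>. \<theta> \<in> \<Theta> \<Longrightarrow> el_log_ratio g n x \<theta> \<le> L"
  shows "continuous_on \<Theta> (el_log_ratio g n x)"
proof (rule continuous_onI)
  fix \<theta>\<^sub>1 and e :: real assume \<theta>1: "\<theta>\<^sub>1 \<in> \<Theta>" and e: "0 < e"
  define \<rho> where "\<rho> = exp (- L / 2) / 2"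
  have \<rho>: "0 < \<rho>" by (simp add: \<rho>_def)
  have R: "\<rho> < el_ratio g n x \<theta>" if "\<theta> \<in> \<Theta>" for \<theta>
  proof -
    have "- L / 2 \<le> ln (el_ratio g n x \<theta>)" using L[OF that] by (simp add: el_log_ratio_def)
    then have "exp (- L / 2) \<le> el_ratio g n x \<theta>"
      using that assms(2) by (subst (asm) ln_ge_iff) (auto intro: el_ratio_bounds)
    moreover have "exp (- L / 2) / 2 < exp (- L / 2)" by simp
    ultimately show ?thesis unfolding \<rho>_def by linarith
  qed
  define K where "K = \<bar>2 * D * C / (\<kappa> * \<rho> / real n ^ n)\<bar> + 1"
  have K: "0 < K" unfolding K_def by linarith
  have step: "el_log_ratio g n x \<theta>' \<le> el_log_ratio g n x \<theta> + 4 * n * (K * norm (\<theta>' - \<theta>))"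
    if \<theta>: "\<theta> \<in> \<Theta>" "\<theta>' \<in> \<Theta>" and small: "K * norm (\<theta>' - \<theta>) \<le> 1/2" for \<theta> \<theta>'
  proof -
    define \<delta> where "\<delta> = 2 * D * (C * norm (\<theta>' - \<theta>)) / (\<kappa> * \<rho> / real n ^ n)"
    have "\<delta> = (2 * D * C / (\<kappa> * \<rho> / real n ^ n)) * norm (\<theta>' - \<theta>)" by (simp add: \<delta>_def)
    also have "\<dots> \<le> K * norm (\<theta>' - \<theta>)"
      unfolding K_def by (intro mult_right_mono norm_ge_zero add_increasing2 abs_ge_self) simp
    finally have \<delta>: "\<delta> \<le> K * norm (\<theta>' - \<theta>)" .
    have le: "exp (- 2 * real n * \<delta>) * el_ratio g n x \<theta> \<le> el_ratio g n x \<theta>'"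
      using \<theta> assms(2) small \<delta>
      by (intro el_ratio_perturbation[OF n refl \<kappa>(1) \<kappa>(2)[OF \<theta>(2)] D[OF \<theta>(2)] C[OF \<theta>] _ \<rho> R[OF \<theta>(1)] \<delta>_def]) auto
    have pos: "0 < el_ratio g n x \<theta>" using \<theta> assms(2) by (auto intro: el_ratio_bounds)
    have "ln (exp (- 2 * real n * \<delta>) * el_ratio g n x \<theta>) \<le> ln (el_ratio g n x \<theta>')"
      using le pos by (intro ln_mono) auto
    then have "- 2 * real n * \<delta> + ln (el_ratio g n x \<theta>) \<le> ln (el_ratio g n x \<theta>')"
      using pos by (simp add: ln_mult)
    then have "el_log_ratio g n x \<theta>' \<le> el_log_ratio g n x \<theta> + 4 * n * \<delta>"
      by (simp add: el_log_ratio_def)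
    also have "4 * n * \<delta> \<le> 4 * n * (K * norm (\<theta>' - \<theta>))" using \<delta> by (intro mult_left_mono) auto
    finally show ?thesis by simp
  qed
  define d where "d = min (1 / (2 * K)) (e / (4 * n * K))"
  have "0 < d" using K e n by (simp add: d_def)
  moreover have "dist (el_log_ratio g n x \<theta>\<^sub>2) (el_log_ratio g n x \<theta>\<^sub>1) \<le> e"
    if \<theta>2: "\<theta>\<^sub>2 \<in> \<Theta>" and "dist \<theta>\<^sub>2 \<theta>\<^sub>1 < d" for \<theta>\<^sub>2
  proof -
    have 1: "K * norm (\<theta>\<^sub>2 - \<theta>\<^sub>1) \<le> 1/2" and 2: "4 * n * (K * norm (\<theta>\<^sub>2 - \<theta>\<^sub>1)) \<le> e"
      using that(2) K n by (auto simp: d_def dist_norm field_simps)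
    from step[OF \<theta>1 \<theta>2 1] step[OF \<theta>2 \<theta>1] 1 2 show ?thesis
      by (simp add: dist_real_def norm_minus_commute abs_le_iff)
  qed
  ultimately show "\<exists>d>0. \<forall>\<theta>\<^sub>2\<in>\<Theta>. dist \<theta>\<^sub>2 \<theta>\<^sub>1 < d \<longrightarrow> dist (el_log_ratio g n x \<theta>\<^sub>2) (el_log_ratio g n x \<theta>\<^sub>1) \<le> e"
    by blast
qed

section \<open>The inverse of the composite similarity\<close>

text \<open>
  A point \<open>\<theta>\<^sub>t + s (\<theta> - \<theta>\<^sub>t)\<close> of the segment is mapped to \<open>\<theta>\<close> when \<open>s \<gamma> = 1\<close>. As \<open>\<gamma> \<ge> 1\<close> on the whole
  domain, the fibre contains no other points, and its closest point belongs to the largest such \<open>s\<close>.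
  The expression \<open>s \<gamma>\<close> is \<open>0\<close> at \<open>s = 0\<close> and at least \<open>1\<close> at \<open>s = 1\<close>.
\<close>

lemma similarity_inverse_near:
  fixes g :: "real ^ 'd \<Rightarrow> real ^ 'p \<Rightarrow> real ^ 'q" and \<theta>\<^sub>t \<theta> :: "real ^ 'p"
  assumes n: "0 < n"
    and dom: "closed_segment \<theta>\<^sub>t \<theta> \<subseteq> el_domain g n x"
    and cont: "continuous_on (closed_segment \<theta>\<^sub>t \<theta>) (el_log_ratio g n x)"
    and L: "\<And>\<theta>'. \<theta>' \<in> closed_segment \<theta>\<^sub>t \<theta> \<Longrightarrow> el_log_ratio g n x \<theta>' \<le> L"
  shows "similarity_inverse g n x \<theta>\<^sub>t \<theta> \<in> closed_segment \<theta>\<^sub>t \<theta>"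
    and "norm (similarity_inverse g n x \<theta>\<^sub>t \<theta> - \<theta>) \<le> L / (2 * n) * norm (\<theta>\<^sub>t - \<theta>)"
proof -
  define p where "p s = \<theta>\<^sub>t + s *\<^sub>R (\<theta> - \<theta>\<^sub>t)" for s :: real
  define \<gamma> where "\<gamma> \<theta>' = expansion_factor n (el_log_ratio g n x \<theta>')" for \<theta>'
  define T where "T = {s\<in>{0..1}. s * \<gamma> (p s) = 1}"
  define F where "F = similarity_fibre g n x \<theta>\<^sub>t \<theta>"
  have p_seg: "p s \<in> closed_segment \<theta>\<^sub>t \<theta>" if "s \<in> {0..1}" for s
    using that by (auto simp: p_def closed_segment_def algebra_simps intro!: exI[of _ s])
  have \<gamma>1: "1 \<le> \<gamma> \<theta>'" if "\<theta>' \<in> el_domain g n x" for \<theta>'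
    using el_log_ratio_nonneg[OF that] by (simp add: \<gamma>_def expansion_factor_def)
  have contp: "continuous_on {0..1} (\<lambda>s. s * \<gamma> (p s))"
  proof -
    have "continuous_on {0..1} (\<lambda>s. el_log_ratio g n x (p s))"
      by (rule continuous_on_compose2[OF cont]) (use p_seg in \<open>auto intro!: continuous_intros simp: p_def[abs_def]\<close>)
    then show ?thesis unfolding \<gamma>_def expansion_factor_def using n by (intro continuous_intros) auto
  qed
  have F_eq: "F = p ` T"
  proof (intro set_eqI iffI)
    fix \<theta>' assume "\<theta>' \<in> F"
    then have dom': "\<theta>' \<in> el_domain g n x" and eq: "\<theta>\<^sub>t + \<gamma> \<theta>' *\<^sub>R (\<theta>' - \<theta>\<^sub>t) = \<theta>"
      by (auto simp: F_def similarity_fibre_def composite_similarity_def \<gamma>_def)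
    have \<gamma>: "1 \<le> \<gamma> \<theta>'" by (rule \<gamma>1) fact
    have "p (1 / \<gamma> \<theta>') = \<theta>'" using \<gamma> by (simp add: p_def flip: eq)
    then show "\<theta>' \<in> p ` T" using \<gamma> by (intro image_eqI[of _ _ "1 / \<gamma> \<theta>'"]) (auto simp: T_def)
  next
    fix \<theta>' assume "\<theta>' \<in> p ` T"
    then obtain s where s: "\<theta>' = p s" "s \<in> {0..1}" "s * \<gamma> (p s) = 1" by (auto simp: T_def)
    have "\<theta>\<^sub>t + \<gamma> \<theta>' *\<^sub>R (\<theta>' - \<theta>\<^sub>t) = \<theta>\<^sub>t + (s * \<gamma> (p s)) *\<^sub>R (\<theta> - \<theta>\<^sub>t)"
      by (simp add: s(1) p_def mult.commute)
    also have "\<dots> = \<theta>" by (simp add: s(3))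
    finally show "\<theta>' \<in> F" using s p_seg dom
      by (auto simp: F_def similarity_fibre_def composite_similarity_def \<gamma>_def)
  qed
  have "T \<noteq> {}"
  proof -
    have "\<exists>s\<ge>0. s \<le> 1 \<and> s * \<gamma> (p s) = 1"
      using \<gamma>1[of "p 1"] p_seg[of 1] dom contp by (intro IVT') auto
    then show ?thesis by (auto simp: T_def)
  qed
  have "compact T"
  proof -
    have "closed T" unfolding T_def
      using contp by (intro continuous_closed_preimage_constant) auto
    then have "compact ({0..1} \<inter> T)" by (intro compact_Int_closed) auto
    moreover have "{0..1} \<inter> T = T" by (auto simp: T_def)
    ultimately show ?thesis by simp
  qed
  then obtain s where s: "s \<in> T" "\<And>t. t \<in> T \<Longrightarrow> t \<le> s"
    using compact_attains_sup[OF _ \<open>T \<noteq> {}\<close>] by auto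
  have norm_p: "norm (p t - \<theta>) = (1 - t) * norm (\<theta>\<^sub>t - \<theta>)" if "t \<in> T" for t
  proof -
    have "p t - \<theta> = (1 - t) *\<^sub>R (\<theta>\<^sub>t - \<theta>)" by (simp add: p_def algebra_simps)
    then show ?thesis using that by (simp add: T_def)
  qed
  have "is_arg_min (\<lambda>\<theta>'. norm (\<theta>' - \<theta>)) (\<lambda>\<theta>'. \<theta>' \<in> F) (p s)"
    unfolding is_arg_min_def F_eq using s norm_p
    by (auto simp: not_less intro!: mult_right_mono)
  then have "is_arg_min (\<lambda>\<theta>'. norm (\<theta>' - \<theta>)) (\<lambda>\<theta>'. \<theta>' \<in> F) (similarity_inverse g n x \<theta>\<^sub>t \<theta>)"
    unfolding similarity_inverse_def arg_min_on_def arg_min_def F_def by (rule someI)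
  then have "similarity_inverse g n x \<theta>\<^sub>t \<theta> \<in> p ` T" by (simp add: is_arg_min_def F_eq)
  then obtain t where t: "t \<in> T" "similarity_inverse g n x \<theta>\<^sub>t \<theta> = p t" by auto
  show "similarity_inverse g n x \<theta>\<^sub>t \<theta> \<in> closed_segment \<theta>\<^sub>t \<theta>"
    using t p_seg by (simp add: T_def)
  have pt: "p t \<in> closed_segment \<theta>\<^sub>t \<theta>" using t p_seg by (simp add: T_def)
  have "1 - t \<le> \<gamma> (p t) - 1"
  proof -
    have "t * \<gamma> (p t) = 1" "0 \<le> t" "1 \<le> \<gamma> (p t)" using t \<gamma>1 pt dom by (auto simp: T_def)
    then have "(1 - t) * (\<gamma> (p t) - 1) \<ge> 0" using t by (auto simp: T_def)
    then show ?thesis using \<open>t * \<gamma> (p t) = 1\<close> by (simp add: algebra_simps)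
  qed
  also have "\<gamma> (p t) - 1 \<le> L / (2 * n)"
    using L[OF pt] n by (simp add: \<gamma>_def expansion_factor_def divide_right_mono)
  finally show "norm (similarity_inverse g n x \<theta>\<^sub>t \<theta> - \<theta>) \<le> L / (2 * n) * norm (\<theta>\<^sub>t - \<theta>)"
    unfolding t(2) norm_p[OF t(1)] by (intro mult_right_mono) auto
qed

section \<open>The extended log-likelihood ratio on a typical sample\<close>

lemma mean_diff_le:
  fixes a b :: "nat \<Rightarrow> 'a::real_normed_vector"
  assumes n: "0 < n" and ab: "\<And>i. i < n \<Longrightarrow> norm (a i - b i) \<le> G i * \<rho>" and "(\<Sum>i<n. G i) \<le> K * n" "0 \<le> \<rho>"
  shows "norm ((\<Sum>i<n. (1 / real n) *\<^sub>R a i) - (\<Sum>i<n. (1 / real n) *\<^sub>R b i)) \<le> K * \<rho>"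
proof -
  have "norm ((\<Sum>i<n. (1 / real n) *\<^sub>R a i) - (\<Sum>i<n. (1 / real n) *\<^sub>R b i)) =
      norm (\<Sum>i<n. (1 / real n) *\<^sub>R (a i - b i))" by (simp add: scaleR_diff_right sum_subtractf)
  also have "\<dots> \<le> (\<Sum>i<n. (1 / real n) * (G i * \<rho>))"
    by (intro sum_norm_le) (auto intro!: divide_right_mono ab)
  also have "\<dots> = (\<Sum>i<n. G i) * \<rho> / n" by (simp add: sum_distrib_right sum_divide_distrib)
  also have "\<dots> \<le> (K * n) * \<rho> / n" using assms by (intro divide_right_mono mult_right_mono) auto
  finally show ?thesis using n by simp
qed

lemma second_moment_perturbation:
  fixes a f :: "nat \<Rightarrow> 'a::real_inner"
  assumes n: "0 < n" and d: "\<And>i. i < n \<Longrightarrow> norm (a i - f i) \<le> G i * \<rho>"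
    and b: "\<And>i. i < n \<Longrightarrow> norm (a i) + norm (f i) \<le> B" and "(\<Sum>i<n. G i) \<le> K * n" "0 \<le> \<rho>" "0 \<le> B"
  shows "\<bar>(\<Sum>i<n. (v \<bullet> a i)\<^sup>2) / n - (\<Sum>i<n. (v \<bullet> f i)\<^sup>2) / n\<bar> \<le> K * \<rho> * B * (norm v)\<^sup>2"
proof -
  have "\<bar>(v \<bullet> a i)\<^sup>2 - (v \<bullet> f i)\<^sup>2\<bar> \<le> G i * (\<rho> * B * (norm v)\<^sup>2)" if i: "i < n" for i
  proof -
    have "\<bar>(v \<bullet> a i)\<^sup>2 - (v \<bullet> f i)\<^sup>2\<bar> = \<bar>v \<bullet> (a i - f i)\<bar> * \<bar>v \<bullet> (a i + f i)\<bar>"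
      by (simp add: power2_eq_square inner_diff_right inner_add_right algebra_simps flip: abs_mult)
    also have "\<dots> \<le> (norm v * norm (a i - f i)) * (norm v * norm (a i + f i))"
      by (intro mult_mono Cauchy_Schwarz_ineq2) auto
    also have "\<dots> \<le> (norm v * (G i * \<rho>)) * (norm v * B)"
      using d[OF i] b[OF i] norm_triangle_ineq[of "a i" "f i"]
      by (intro mult_mono mult_left_mono mult_nonneg_nonneg order_trans[OF norm_ge_zero d[OF i]]) auto
    finally show ?thesis by (simp add: power2_eq_square mult_ac)
  qed
  then have "(\<Sum>i<n. \<bar>(v \<bullet> a i)\<^sup>2 - (v \<bullet> f i)\<^sup>2\<bar>) \<le> (\<Sum>i<n. G i * (\<rho> * B * (norm v)\<^sup>2))"
    by (intro sum_mono) auto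
  also have "\<dots> = (\<Sum>i<n. G i) * (\<rho> * B * (norm v)\<^sup>2)" by (simp add: sum_distrib_right)
  also have "\<dots> \<le> (K * n) * (\<rho> * B * (norm v)\<^sup>2)" using assms by (intro mult_right_mono) auto
  finally have "(\<Sum>i<n. \<bar>(v \<bullet> a i)\<^sup>2 - (v \<bullet> f i)\<^sup>2\<bar>) \<le> K * n * (\<rho> * B * (norm v)\<^sup>2)" .
  then have "\<bar>(\<Sum>i<n. (v \<bullet> a i)\<^sup>2) - (\<Sum>i<n. (v \<bullet> f i)\<^sup>2)\<bar> \<le> K * n * (\<rho> * B * (norm v)\<^sup>2)"
    using sum_abs[of "\<lambda>i. (v \<bullet> a i)\<^sup>2 - (v \<bullet> f i)\<^sup>2" "{..<n}"] by (simp add: sum_subtractf)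
  then have "\<bar>(\<Sum>i<n. (v \<bullet> a i)\<^sup>2) - (\<Sum>i<n. (v \<bullet> f i)\<^sup>2)\<bar> / n \<le> K * n * (\<rho> * B * (norm v)\<^sup>2) / n"
    by (rule divide_right_mono) simp
  then show ?thesis using n by (simp add: abs_divide mult_ac flip: diff_divide_distrib)
qed

text \<open>
  The factor between \<open>\<eta>\<close>, the precision with which a sample is typical in \<open>eel_log_ratio_approx\<close>, and
  the relative error of the quadratic expansion at parameters within \<open>K / \<surd>n\<close> of \<open>\<theta>\<^sub>0\<close>.
\<close>

definition approx_const :: "real \<Rightarrow> real" where
  "approx_const K = 2 + 2 * K\<^sup>2 + K ^ 3 + 4 * (1 + K) * (K + K\<^sup>2) + (K + K\<^sup>2)\<^sup>2"

text \<open>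
  The assumptions describe a typical sample: \<open>K\<close> bounds the quantities that are bounded in probability
  (the normalized mean, the average Lipschitz constant, the normalized estimation error), and \<open>\<eta>\<close>
  those that tend to zero in probability. For fixed \<open>K\<close> the error is of order \<open>\<eta>\<close>: one part stems from
  the quadratic expansion at the preimage \<open>\<theta>'\<close> of \<open>\<theta>\<^sub>0\<close>, the other from moving the quadratic form from \<open>\<theta>'\<close> to
  \<open>\<theta>\<^sub>0\<close>.
\<close>

lemma eel_log_ratio_approx:
  fixes g :: "real ^ 'd \<Rightarrow> real ^ 'p \<Rightarrow> real ^ 'q" and \<theta>\<^sub>t \<theta>\<^sub>0 :: "real ^ 'p"
  assumes \<eta>: "0 < \<eta>" "1 \<le> \<eta> * n" and K: "1 \<le> K" "4 * approx_const K * \<eta> \<le> 1"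
    and m\<^sub>0: "m\<^sub>0 = (\<Sum>i<n. (1 / real n) *\<^sub>R g (x i) \<theta>\<^sub>0)" "sqrt n * norm m\<^sub>0 \<le> K"
    and S: "\<And>v. \<bar>(\<Sum>i<n. (v \<bullet> g (x i) \<theta>\<^sub>0)\<^sup>2) / real n - (norm v)\<^sup>2\<bar> \<le> \<eta> * (norm v)\<^sup>2"
    and f: "\<And>i. i < n \<Longrightarrow> norm (g (x i) \<theta>\<^sub>0) \<le> \<eta> * sqrt n"
    and G: "\<And>i. i < n \<Longrightarrow> 0 \<le> G i \<and> G i \<le> \<eta> * n" "(\<Sum>i<n. G i) \<le> K * n"
    and lip: "\<And>i \<theta> \<theta>'. i < n \<Longrightarrow> \<theta> \<in> ball \<theta>\<^sub>0 r \<Longrightarrow> \<theta>' \<in> ball \<theta>\<^sub>0 r \<Longrightarrow>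
        norm (g (x i) \<theta> - g (x i) \<theta>') \<le> G i * norm (\<theta> - \<theta>')"
    and r: "K / sqrt n < r"
    and \<theta>\<^sub>t: "norm (\<theta>\<^sub>t - \<theta>\<^sub>0) \<le> K / sqrt n"
  shows "\<bar>eel_log_ratio g n x \<theta>\<^sub>t \<theta>\<^sub>0 - n * (norm m\<^sub>0)\<^sup>2\<bar> \<le>
    (8 * approx_const K * (K + K\<^sup>2)\<^sup>2 + 3 * K\<^sup>2 * (K + K\<^sup>2) ^ 3) * \<eta>"
proof -
  have n: "0 < n" using \<eta> by (cases n) auto
  define s where "s = sqrt n"
  have s: "0 < s" "s * s = n" using n by (simp_all add: s_def)
  define H where "H = approx_const K * \<eta>"
  define K\<^sub>1 where "K\<^sub>1 = K + K\<^sup>2"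
  have K1: "K \<le> K\<^sub>1" "1 \<le> K\<^sub>1" "0 \<le> K" using K(1) by (auto simp: K\<^sub>1_def intro: add_increasing2)
  have "0 \<le> approx_const K" using K(1) by (simp add: approx_const_def)
  then have H: "0 \<le> H" "H \<le> 1/4" using K(2) \<eta>(1) by (simp_all add: H_def)
  define \<rho> where "\<rho> = K / s"
  have \<rho>: "0 \<le> \<rho>" "\<rho> < r" using K(1) s r by (auto simp: \<rho>_def s_def)
  define seg where "seg = closed_segment \<theta>\<^sub>t \<theta>\<^sub>0"
  have seg_near: "norm (\<theta> - \<theta>\<^sub>0) \<le> \<rho>" if "\<theta> \<in> seg" for \<theta>
  proof -
    have "norm (\<theta> - \<theta>\<^sub>0) \<le> norm (\<theta>\<^sub>t - \<theta>\<^sub>0)" 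
      using that segment_bound(2)[of \<theta> \<theta>\<^sub>t \<theta>\<^sub>0] by (simp add: seg_def norm_minus_commute)
    then show ?thesis using \<theta>\<^sub>t by (simp add: \<rho>_def s_def)
  qed
  have seg_ball: "\<theta> \<in> ball \<theta>\<^sub>0 r" if "\<theta> \<in> seg" for \<theta>
    using seg_near[OF that] \<rho> by (simp add: dist_norm norm_minus_commute)
  have \<theta>0: "\<theta>\<^sub>0 \<in> ball \<theta>\<^sub>0 r" "\<theta>\<^sub>0 \<in> seg" using \<rho> by (auto simp: seg_def)
  define m where "m \<theta> = (\<Sum>i<n. (1 / real n) *\<^sub>R g (x i) \<theta>)" for \<theta>
  have lip0: "norm (g (x i) \<theta> - g (x i) \<theta>\<^sub>0) \<le> G i * \<rho>" if "i < n" "\<theta> \<in> seg" for i \<theta>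
    using lip[OF that(1) seg_ball[OF that(2)] \<theta>0(1)] mult_left_mono[OF seg_near[OF that(2)], of "G i"] G(1)[OF that(1)]
    by linarith
  have mdiff: "norm (m \<theta> - m\<^sub>0) \<le> K * norm (\<theta> - \<theta>\<^sub>0)" if "\<theta> \<in> seg" for \<theta>
    unfolding m_def m\<^sub>0(1) using n lip \<theta>0(1) seg_ball[OF that] G(2) by (intro mean_diff_le) auto
  have sm: "s * norm (m \<theta>) \<le> K\<^sub>1" if "\<theta> \<in> seg" for \<theta>
  proof -
    have "norm (m \<theta> - m\<^sub>0) \<le> K * \<rho>"
      using mdiff[OF that] mult_left_mono[OF seg_near[OF that], of K] K1 by linarith
    then have "s * norm (m \<theta> - m\<^sub>0) \<le> s * (K * \<rho>)" using s by (intro mult_left_mono) auto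
    also have "\<dots> = K\<^sup>2" using s by (simp add: \<rho>_def power2_eq_square)
    finally have "s * norm (m \<theta> - m\<^sub>0) \<le> K\<^sup>2" .
    moreover have "s * norm (m \<theta>) \<le> s * (norm m\<^sub>0 + norm (m \<theta> - m\<^sub>0))"
      using norm_triangle_ineq[of m\<^sub>0 "m \<theta> - m\<^sub>0"] s by (intro mult_left_mono) auto
    ultimately show ?thesis using m\<^sub>0(2) by (simp add: K\<^sub>1_def s_def distrib_left)
  qed
  have nm: "n * (norm (m \<theta>))\<^sup>2 \<le> K\<^sub>1\<^sup>2" if "\<theta> \<in> seg" for \<theta>
  proof -
    have "n * (norm (m \<theta>))\<^sup>2 = (s * norm (m \<theta>))\<^sup>2" by (simp add: power_mult_distrib power2_eq_square flip: s(2))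
    also have "\<dots> \<le> K\<^sub>1\<^sup>2" using sm[OF that] s by (intro power_mono) auto
    finally show ?thesis .
  qed
  define D where "D = \<eta> * s * (1 + K)"
  have Gs: "G i * \<rho> \<le> \<eta> * s * K" if "i < n" for i
  proof -
    have "G i * \<rho> \<le> (\<eta> * n) * \<rho>" using G(1)[OF that] \<rho> by (intro mult_right_mono) auto
    also have "\<dots> = \<eta> * s * K" using s by (simp add: \<rho>_def flip: s(2))
    finally show ?thesis .
  qed
  have f': "norm (g (x i) \<theta>\<^sub>0) \<le> \<eta> * s" if "i < n" for i using f[OF that] by (simp add: s_def)
  have aD: "norm (g (x i) \<theta>) \<le> D" if "i < n" "\<theta> \<in> seg" for i \<theta>
    using lip0[OF that] Gs[OF that(1)] f'[OF that(1)] norm_triangle_ineq[of "g (x i) \<theta>\<^sub>0" "g (x i) \<theta> - g (x i) \<theta>\<^sub>0"]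
    by (simp add: D_def distrib_left)
  have Kpow: "0 \<le> K\<^sup>2" "0 \<le> K ^ 3" "0 \<le> (1 + K) * K\<^sub>1" "0 \<le> K\<^sub>1\<^sup>2" using K1 by auto
  have Hval: "H = 2 * \<eta> + 2 * K\<^sup>2 * \<eta> + K ^ 3 * \<eta> + 4 * ((1 + K) * K\<^sub>1) * \<eta> + K\<^sub>1\<^sup>2 * \<eta>"
    by (simp add: H_def approx_const_def K\<^sub>1_def algebra_simps)
  have Hpos: "0 \<le> 2 * \<eta>" "0 \<le> 2 * K\<^sup>2 * \<eta>" "0 \<le> K ^ 3 * \<eta>" "0 \<le> 4 * ((1 + K) * K\<^sub>1) * \<eta>" "0 \<le> K\<^sub>1\<^sup>2 * \<eta>"
    using Kpow \<eta>(1) by auto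
  have small: "4 * D * norm (m \<theta>) \<le> H" "(norm (m \<theta>))\<^sup>2 \<le> H" if "\<theta> \<in> seg" for \<theta>
  proof -
    have "4 * D * norm (m \<theta>) = 4 * \<eta> * (1 + K) * (s * norm (m \<theta>))" by (simp add: D_def)
    also have "\<dots> \<le> 4 * \<eta> * (1 + K) * K\<^sub>1" using sm[OF that] \<eta> K1 by (intro mult_left_mono) auto
    also have "\<dots> = 4 * ((1 + K) * K\<^sub>1) * \<eta>" by simp
    finally show "4 * D * norm (m \<theta>) \<le> H" using Hval Hpos by linarith
    have "(norm (m \<theta>))\<^sup>2 \<le> K\<^sub>1\<^sup>2 / n" using nm[OF that] n by (simp add: field_simps)
    also have "\<dots> \<le> K\<^sub>1\<^sup>2 * \<eta>" using \<eta> n mult_left_mono[OF \<eta>(2), of "K\<^sub>1\<^sup>2"] by (simp add: field_simps)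
    finally show "(norm (m \<theta>))\<^sup>2 \<le> H" using Hval Hpos by linarith
  qed
  have S': "\<bar>(\<Sum>i<n. (v \<bullet> g (x i) \<theta>)\<^sup>2) / n - (norm v)\<^sup>2\<bar> \<le> H * (norm v)\<^sup>2" if "\<theta> \<in> seg" for \<theta> v
  proof -
    have "\<bar>(\<Sum>i<n. (v \<bullet> g (x i) \<theta>)\<^sup>2) / n - (\<Sum>i<n. (v \<bullet> g (x i) \<theta>\<^sub>0)\<^sup>2) / n\<bar> \<le> K * \<rho> * (D + \<eta> * s) * (norm v)\<^sup>2"
      using lip0 aD f' that n G(2) \<rho> \<eta> s K1
      by (intro second_moment_perturbation[where G = G]) (auto simp: D_def intro!: add_mono)
    also have "K * \<rho> * (D + \<eta> * s) = K ^ 3 * \<eta> + 2 * K\<^sup>2 * \<eta>"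
      using s by (simp add: \<rho>_def D_def field_simps power2_eq_square power3_eq_cube)
    finally have "\<bar>(\<Sum>i<n. (v \<bullet> g (x i) \<theta>)\<^sup>2) / n - (norm v)\<^sup>2\<bar> \<le>
        \<eta> * (norm v)\<^sup>2 + (K ^ 3 * \<eta> + 2 * K\<^sup>2 * \<eta>) * (norm v)\<^sup>2"
      using S[of v] by linarith
    also have "\<dots> = (\<eta> + K ^ 3 * \<eta> + 2 * K\<^sup>2 * \<eta>) * (norm v)\<^sup>2" by (simp add: algebra_simps)
    also have "\<dots> \<le> H * (norm v)\<^sup>2"
      using Hval Hpos \<eta>(1) by (intro mult_right_mono) auto
    finally show ?thesis .
  qed
  have dom: "\<theta> \<in> el_domain g n x"
    and quad: "\<bar>el_log_ratio g n x \<theta> - n * (norm (m \<theta>))\<^sup>2\<bar> \<le> 8 * H * (n * (norm (m \<theta>))\<^sup>2)" if "\<theta> \<in> seg" for \<theta>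
    using el_log_ratio_quadratic[where m = "m \<theta>" and \<eta> = H and D = D and g = g and x = x and n = n and \<theta> = \<theta>, OF n m_def H S'[OF that] aD[OF _ that] small[OF that]]
    by blast+
  have quad': "\<bar>el_log_ratio g n x \<theta> - n * (norm (m \<theta>))\<^sup>2\<bar> \<le> 8 * H * K\<^sub>1\<^sup>2" if "\<theta> \<in> seg" for \<theta>
    using quad[OF that] mult_left_mono[OF nm[OF that], of "8 * H"] H by linarith
  (* H <= 1/4 makes the relative error 8 H of the expansion at most 2. *)
  define L where "L = 3 * K\<^sub>1\<^sup>2"
  have L: "el_log_ratio g n x \<theta> \<le> L" if "\<theta> \<in> seg" for \<theta>
    using quad'[OF that] nm[OF that] mult_right_mono[OF H(2) Kpow(4)] by (simp add: L_def)
  have cont: "continuous_on seg (el_log_ratio g n x)"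
  proof (rule continuous_on_el_log_ratio[OF n])
    show "seg \<subseteq> el_domain g n x" using dom by blast
    show "0 < 1 - 2 * H" using H by simp
    show "(1 - 2 * H) * (norm v)\<^sup>2 \<le>
       (\<Sum>i<n. (1 / real n) * (v \<bullet> (g (x i) \<theta> - (\<Sum>i<n. (1 / real n) *\<^sub>R g (x i) \<theta>)))\<^sup>2)" if "\<theta> \<in> seg" for \<theta> v
      using small(2)[OF that] S'[OF that] by (intro mean_centred_quadratic_ge n refl) (auto simp: m_def)
    show "norm (g (x i) \<theta>) \<le> D" if "\<theta> \<in> seg" "i < n" for \<theta> i using aD that by blast
    show "norm (g (x i) \<theta>' - g (x i) \<theta>) \<le> (\<eta> * n) * norm (\<theta>' - \<theta>)" if "\<theta> \<in> seg" "\<theta>' \<in> seg" "i < n" for \<theta> \<theta>' i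
      using lip[OF that(3) seg_ball seg_ball, OF that(2,1)] G(1)[OF that(3)]
      by (meson mult_right_mono norm_ge_zero order_trans)
    show "el_log_ratio g n x \<theta> \<le> L" if "\<theta> \<in> seg" for \<theta> by (rule L[OF that])
  qed
  define \<theta>' where "\<theta>' = similarity_inverse g n x \<theta>\<^sub>t \<theta>\<^sub>0"
  have near: "\<theta>' \<in> seg" "norm (\<theta>' - \<theta>\<^sub>0) \<le> L / (2 * n) * norm (\<theta>\<^sub>t - \<theta>\<^sub>0)"
    using similarity_inverse_near[OF n, of \<theta>\<^sub>t \<theta>\<^sub>0 g x L] dom cont L unfolding \<theta>'_def seg_def by blast+
  have "norm (\<theta>' - \<theta>\<^sub>0) \<le> L / (2 * n) * \<rho>"
    using near(2) mult_left_mono[OF \<theta>\<^sub>t, of "L / (2 * n)"] Kpow(4) by (simp add: L_def \<rho>_def s_def)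
  then have "K * norm (\<theta>' - \<theta>\<^sub>0) \<le> K * (L / (2 * n) * \<rho>)" using K1(3) by (rule mult_left_mono)
  then have "s * norm (m \<theta>' - m\<^sub>0) \<le> s * (K * (L / (2 * n) * \<rho>))"
    using mdiff[OF near(1)] s by (intro mult_left_mono) auto
  also have "\<dots> = K\<^sup>2 * L / 2 * (1 / n)" using s by (simp add: \<rho>_def power2_eq_square)
  also have "\<dots> \<le> K\<^sup>2 * L / 2 * \<eta>"
    using \<eta> n Kpow by (intro mult_left_mono) (auto simp: L_def field_simps)
  finally have sdiff: "s * norm (m \<theta>' - m\<^sub>0) \<le> K\<^sup>2 * L / 2 * \<eta>" .
  have "\<bar>n * (norm (m \<theta>'))\<^sup>2 - n * (norm m\<^sub>0)\<^sup>2\<bar> =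
      \<bar>(s * norm (m \<theta>') - s * norm m\<^sub>0) * (s * norm (m \<theta>') + s * norm m\<^sub>0)\<bar>"
    by (simp add: algebra_simps power2_eq_square flip: s(2))
  also have "\<dots> = (s * \<bar>norm (m \<theta>') - norm m\<^sub>0\<bar>) * (s * norm (m \<theta>') + s * norm m\<^sub>0)"
    using s by (simp add: abs_mult flip: right_diff_distrib)
  also have "\<dots> \<le> (K\<^sup>2 * L / 2 * \<eta>) * (K\<^sub>1 + K\<^sub>1)"
  proof (rule mult_mono)
    have "s * \<bar>norm (m \<theta>') - norm m\<^sub>0\<bar> \<le> s * norm (m \<theta>' - m\<^sub>0)"
      using s by (intro mult_left_mono norm_triangle_ineq3) auto
    then show "s * \<bar>norm (m \<theta>') - norm m\<^sub>0\<bar> \<le> K\<^sup>2 * L / 2 * \<eta>" using sdiff by linarith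
    show "s * norm (m \<theta>') + s * norm m\<^sub>0 \<le> K\<^sub>1 + K\<^sub>1"
      using sm[OF near(1)] m\<^sub>0(2) K1 by (simp add: s_def)
    show "0 \<le> K\<^sup>2 * L / 2 * \<eta>" using Kpow \<eta> by (simp add: L_def)
  qed (use s in auto)
  also have "\<dots> = 3 * K\<^sup>2 * K\<^sub>1 ^ 3 * \<eta>" by (simp add: L_def power2_eq_square power3_eq_cube)
  finally have "\<bar>n * (norm (m \<theta>'))\<^sup>2 - n * (norm m\<^sub>0)\<^sup>2\<bar> \<le> 3 * K\<^sup>2 * K\<^sub>1 ^ 3 * \<eta>" .
  then have "\<bar>el_log_ratio g n x \<theta>' - n * (norm m\<^sub>0)\<^sup>2\<bar> \<le> 8 * H * K\<^sub>1\<^sup>2 + 3 * K\<^sup>2 * K\<^sub>1 ^ 3 * \<eta>"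
    using quad'[OF near(1)] by linarith
  then show ?thesis
    unfolding eel_log_ratio_def \<theta>'_def[symmetric] by (simp add: H_def K\<^sub>1_def algebra_simps)
qed

section \<open>Convergence to the chi-squared distribution\<close>

text \<open>
  A continuous test function of \<open>t \<ge> 0\<close> that vanishes for large \<open>t\<close> is a continuous function of \<open>exp (- t) \<in> [0, 1]\<close>, hence by
  Weierstrass uniformly close to a polynomial in \<open>exp (- t)\<close>, and the integral of that polynomial is a
  combination of Laplace transforms. The step functions \<open>cts_step\<close>, which suffice for weak
  convergence, are of this kind.
\<close>

lemma weak_conv_of_laplace_transforms:
  fixes \<mu> :: "nat \<Rightarrow> real measure" and \<nu> :: "real measure"
  assumes \<mu>: "\<And>n. real_distribution (\<mu> n)" "\<And>n. AE t in \<mu> n. 0 \<le> t"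
    and \<nu>: "real_distribution \<nu>" "AE t in \<nu>. 0 \<le> t"
    and conv: "\<And>k::nat. (\<lambda>n. LINT t|\<mu> n. exp (- (k * t))) \<longlonglongrightarrow> (LINT t|\<nu>. exp (- (k * t)))"
  shows "weak_conv_m \<mu> \<nu>"
proof (rule integral_cts_step_conv_imp_weak_conv[OF \<mu>(1) \<nu>(1)])
  fix x y :: real assume xy: "x < y"
  define f where "f u = (if u \<le> 0 then 0 else cts_step x y (- ln u))" for u :: real
  have f_exp: "f (exp (- t)) = cts_step x y t" for t by (simp add: f_def)
  have "continuous_on ({..<exp (- y)} \<union> {0<..}) f"
  proof (rule continuous_on_open_Un)
    have "f u = 0" if "u < exp (- y)" for u
    proof (cases "u \<le> 0")
      case False
      then have "ln u < - y" using that by (metis exp_gt_zero ln_exp ln_less_cancel_iff not_le)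
      then show ?thesis using xy False by (simp add: f_def cts_step_def)
    qed (simp add: f_def)
    then show "continuous_on {..<exp (- y)} f" by (auto intro: continuous_on_cong[THEN iffD2, OF refl _ continuous_on_const])
    have "continuous_on UNIV (cts_step x y)"
      using cts_step_uniformly_continuous[OF xy] by (rule uniformly_continuous_imp_continuous)
    then have "continuous_on {0<..} (\<lambda>u. cts_step x y (- ln u))"
      by (rule continuous_on_compose2) (auto intro!: continuous_intros)
    then show "continuous_on {0<..} f"
      by (rule continuous_on_cong[THEN iffD1, OF refl, rotated]) (simp add: f_def)
  qed auto
  then have contf: "continuous_on {0..1} f"
    by (rule continuous_on_subset) (auto simp: not_less intro: less_le_trans[OF exp_gt_zero])
  show "(\<lambda>n. integral\<^sup>L (\<mu> n) (cts_step x y)) \<longlonglongrightarrow> integral\<^sup>L \<nu> (cts_step x y)"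
  proof (rule metric_LIMSEQ_I)
    fix e :: real assume e: "0 < e"
    obtain p where p: "real_polynomial_function p" "\<And>u. u \<in> {0..1} \<Longrightarrow> \<bar>f u - p u\<bar> < e / 3"
      using Stone_Weierstrass_real_polynomial_function[OF _ contf, of "e / 3"] e by (auto simp: compact_Icc)
    then obtain c m where cm: "p = (\<lambda>u. \<Sum>i\<le>m. c i * u ^ i)"
      unfolding real_polynomial_function_iff_sum by blast
    define b where "b t = (\<Sum>i\<le>m. c i * exp (- (i * t)))" for t :: real
    have b: "b t = p (exp (- t))" for t
      by (simp add: b_def cm flip: exp_of_nat_mult)
    have close: "\<bar>integral\<^sup>L \<rho> (cts_step x y) - (\<Sum>i\<le>m. c i * (LINT t|\<rho>. exp (- (i * t))))\<bar> \<le> e / 3"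
      if \<rho>: "real_distribution \<rho>" "AE t in \<rho>. 0 \<le> t" for \<rho>
    proof -
      interpret \<rho>: real_distribution \<rho> by fact
      have int_exp: "integrable \<rho> (\<lambda>t. exp (- (real i * t)))" for i
        using \<rho>(2) by (intro \<rho>.integrable_const_bound[of _ 1]) auto
      have int_b: "integrable \<rho> b" unfolding b_def by (intro Bochner_Integration.integrable_sum integrable_mult_right int_exp)
      have "(\<Sum>i\<le>m. c i * (LINT t|\<rho>. exp (- (i * t)))) = integral\<^sup>L \<rho> b"
        unfolding b_def by (simp add: Bochner_Integration.integral_sum int_exp)
      then have "\<bar>integral\<^sup>L \<rho> (cts_step x y) - (\<Sum>i\<le>m. c i * (LINT t|\<rho>. exp (- (i * t))))\<bar>
          = \<bar>LINT t|\<rho>. cts_step x y t - b t\<bar>"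
        using int_b \<rho>.integrable_cts_step[OF xy] by simp
      also have "\<dots> \<le> (LINT t|\<rho>. \<bar>cts_step x y t - b t\<bar>)" by (rule integral_abs_bound)
      also have "\<dots> \<le> (LINT t|\<rho>. e / 3)"
      proof (rule integral_mono_AE)
        show "integrable \<rho> (\<lambda>t. \<bar>cts_step x y t - b t\<bar>)" "integrable \<rho> (\<lambda>t. e / 3)"
          using int_b \<rho>.integrable_cts_step[OF xy] by auto
        show "AE t in \<rho>. \<bar>cts_step x y t - b t\<bar> \<le> e / 3"
          using \<rho>(2) by eventually_elim (use p(2) in \<open>auto simp: b less_imp_le simp flip: f_exp\<close>)
      qed
      also have "\<dots> = e / 3" using \<rho>.prob_space by simp
      finally show ?thesis .
    qed
    have "(\<lambda>n. \<Sum>i\<le>m. c i * (LINT t|\<mu> n. exp (- (i * t)))) \<longlonglongrightarrow> (\<Sum>i\<le>m. c i * (LINT t|\<nu>. exp (- (i * t))))"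
      by (intro tendsto_intros conv)
    then obtain N where N: "\<And>n. n \<ge> N \<Longrightarrow>
        dist (\<Sum>i\<le>m. c i * (LINT t|\<mu> n. exp (- (i * t)))) (\<Sum>i\<le>m. c i * (LINT t|\<nu>. exp (- (i * t)))) < e / 3"
      using metric_LIMSEQ_D[of _ _ "e / 3"] e by fastforce
    have "dist (integral\<^sup>L (\<mu> n) (cts_step x y)) (integral\<^sup>L \<nu> (cts_step x y)) < e" if "n \<ge> N" for n
      using N[OF that] close[OF \<mu>(1)[of n] \<mu>(2)[of n]] close[OF \<nu>] unfolding dist_real_def by linarith
    then show "\<exists>N. \<forall>n\<ge>N. dist (integral\<^sup>L (\<mu> n) (cts_step x y)) (integral\<^sup>L \<nu> (cts_step x y)) < e"
      by blast
  qed
qed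

text \<open>
  The chi-squared distribution is defined on a product indexed by numbers; the enumeration \<open>e\<close> of the
  coordinates turns the points of that product into vectors.
\<close>

definition gaussian_vector :: "('q::finite \<Rightarrow> nat) \<Rightarrow> (nat \<Rightarrow> real) \<Rightarrow> real ^ 'q" where
  "gaussian_vector e z = (\<Sum>j\<in>UNIV. z (e j) *\<^sub>R axis j 1)"

abbreviation gaussian_product :: "nat \<Rightarrow> (nat \<Rightarrow> real) measure" where
  "gaussian_product q \<equiv> \<Pi>\<^sub>M i\<in>{..<q}. std_normal_distribution"

lemma prob_space_gaussian_product: "prob_space (gaussian_product q)"
  using real_dist_normal_dist by (intro prob_space_PiM) (simp add: real_distribution_def)

lemma gaussian_vector_nth: "gaussian_vector e z $ j = z (e j)"
proof -
  have "gaussian_vector e z $ j = (\<Sum>k\<in>UNIV. if k = j then z (e k) else 0)"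
    unfolding gaussian_vector_def sum_component by (intro sum.cong) (auto simp: axis_def)
  then show ?thesis by simp
qed

lemma norm_square_vec: "(norm v)\<^sup>2 = (\<Sum>j\<in>UNIV. (v $ j)\<^sup>2)" for v :: "real ^ 'n"
  unfolding power2_norm_eq_inner inner_vec_def by (simp add: power2_eq_square)

context
  fixes e :: "'q::finite \<Rightarrow> nat"
  assumes e: "bij_betw e UNIV {..<CARD('q)}"
begin

lemma measurable_gaussian_vector:
  "gaussian_vector e \<in> borel_measurable (gaussian_product CARD('q))"
proof -
  have "(\<lambda>z. z (e j)) \<in> borel_measurable (gaussian_product CARD('q))" for j
    using bij_betwE[OF e] measurable_component_singleton[of "e j" "{..<CARD('q)}" "\<lambda>_. std_normal_distribution"]
    by (simp add: measurable_cong_sets[OF refl sets_density])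
  then show ?thesis unfolding gaussian_vector_def[abs_def]
    by (intro borel_measurable_sum borel_measurable_scaleR) auto
qed

lemma norm_gaussian_vector: "(norm (gaussian_vector e z))\<^sup>2 = (\<Sum>i<CARD('q). (z i)\<^sup>2)"
proof -
  have "(norm (gaussian_vector e z))\<^sup>2 = (\<Sum>j\<in>UNIV. (z (e j))\<^sup>2)"
    by (simp add: norm_square_vec gaussian_vector_nth)
  also have "\<dots> = (\<Sum>i<CARD('q). (z i)\<^sup>2)" by (rule sum.reindex_bij_betw[OF e])
  finally show ?thesis .
qed

lemma char_gaussian_vector:
  "(LINT z|gaussian_product CARD('q). iexp (v \<bullet> gaussian_vector e z)) = exp (- (norm v)\<^sup>2 / 2)"
proof -
  interpret N: real_distribution std_normal_distribution by (rule real_dist_normal_dist)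
  interpret product_sigma_finite "\<lambda>_::nat. std_normal_distribution" by standard
  define d where "d = inv e"
  have d: "v $ (d (e j)) = v $ j" for j 
    using e by (simp add: d_def bij_betw_def inv_f_f)
  have "v \<bullet> gaussian_vector e z = (\<Sum>i<CARD('q). v $ d i * z i)" for z
  proof -
    have "v \<bullet> gaussian_vector e z = (\<Sum>j\<in>UNIV. v $ d (e j) * z (e j))"
      by (simp add: inner_vec_def gaussian_vector_nth d)
    also have "\<dots> = (\<Sum>i<CARD('q). v $ d i * z i)" by (rule sum.reindex_bij_betw[OF e])
    finally show ?thesis .
  qed
  then have "(LINT z|gaussian_product CARD('q). iexp (v \<bullet> gaussian_vector e z)) =
      (LINT z|gaussian_product CARD('q). (\<Prod>i<CARD('q). iexp (v $ d i * z i)))"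
    by (intro Bochner_Integration.integral_cong) (simp_all add: exp_sum sum_distrib_left)
  also have "\<dots> = (\<Prod>i<CARD('q). LINT t|std_normal_distribution. iexp (v $ d i * t))"
    by (intro product_integral_prod) (auto intro!: N.integrable_const_bound[of _ 1])
  also have "\<dots> = (\<Prod>i<CARD('q). char std_normal_distribution (v $ d i))"
    by (simp add: char_def)
  also have "\<dots> = (\<Prod>i<CARD('q). complex_of_real (exp (- ((v $ d i)\<^sup>2) / 2)))"
    unfolding char_std_normal_distribution ..
  also have "\<dots> = complex_of_real (exp (\<Sum>i<CARD('q). - ((v $ d i)\<^sup>2) / 2))"
    unfolding of_real_prod[symmetric] by (subst exp_sum) simp_all
  also have "(\<Sum>i<CARD('q). - ((v $ d i)\<^sup>2) / 2) = (\<Sum>j\<in>UNIV. - ((v $ d (e j))\<^sup>2) / 2)"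
    by (rule sum.reindex_bij_betw[OF e, symmetric])
  also have "\<dots> = - (norm v)\<^sup>2 / 2"
    by (simp add: d norm_square_vec sum_negf flip: sum_divide_distrib)
  finally show ?thesis .
qed

lemma chi_squared_eq_gaussian_vector:
  "chi_squared_distribution CARD('q) =
    distr (gaussian_product CARD('q)) borel (\<lambda>z. (norm (gaussian_vector e z))\<^sup>2)"
  unfolding chi_squared_distribution_def norm_gaussian_vector ..

text \<open>
  For a standard Gaussian vector \<open>N\<close> independent of \<open>Z\<close>, the expectation of \<open>exp (i c N \<bullet> Z)\<close> is
  computed in two ways: integrating over \<open>N\<close> first gives the left-hand side, over \<open>Z\<close> first the
  right-hand side.
\<close>

lemma laplace_norm_square_eq_char_average:
  fixes Z :: "'w \<Rightarrow> real ^ 'q"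
  assumes "prob_space M" and [measurable]: "Z \<in> borel_measurable M"
  shows "complex_of_real (LINT \<omega>|M. exp (- (norm (c *\<^sub>R Z \<omega>))\<^sup>2 / 2)) =
    (LINT z|gaussian_product CARD('q). (LINT \<omega>|M. iexp ((c *\<^sub>R gaussian_vector e z) \<bullet> Z \<omega>)))"
proof -
  interpret M: prob_space M by fact
  interpret G: prob_space "gaussian_product CARD('q)" by (rule prob_space_gaussian_product)
  interpret pair_prob_space "gaussian_product CARD('q)" M ..
  note [measurable] = measurable_gaussian_vector
  have "complex_of_real (LINT \<omega>|M. exp (- (norm (c *\<^sub>R Z \<omega>))\<^sup>2 / 2)) =
      (LINT \<omega>|M. complex_of_real (exp (- (norm (c *\<^sub>R Z \<omega>))\<^sup>2 / 2)))"
    by simp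
  also have "\<dots> = (LINT \<omega>|M. (LINT z|gaussian_product CARD('q). iexp ((c *\<^sub>R Z \<omega>) \<bullet> gaussian_vector e z)))"
    unfolding char_gaussian_vector ..
  also have "\<dots> = (LINT \<omega>|M. (LINT z|gaussian_product CARD('q). iexp ((c *\<^sub>R gaussian_vector e z) \<bullet> Z \<omega>)))"
    by (simp add: inner_commute)
  also have "\<dots> = (LINT z|gaussian_product CARD('q). (LINT \<omega>|M. iexp ((c *\<^sub>R gaussian_vector e z) \<bullet> Z \<omega>)))"
    by (intro Fubini_integral integrable_const_bound[of _ 1]) (auto simp: case_prod_beta')
  finally show ?thesis .
qed

end

lemma real_distribution_chi_squared: "real_distribution (chi_squared_distribution CARD('q::finite))"
proof -
  obtain e :: "'q \<Rightarrow> nat" where e: "bij_betw e UNIV {..<CARD('q)}"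
    using ex_bij_betw_finite_nat[of "UNIV :: 'q set"] by (auto simp: atLeast0LessThan)
  interpret G: prob_space "gaussian_product CARD('q)" by (rule prob_space_gaussian_product)
  note [measurable] = measurable_gaussian_vector[OF e]
  show ?thesis unfolding chi_squared_eq_gaussian_vector[OF e] by (intro G.real_distribution_distr) measurable
qed

text \<open>
  By dominated convergence the Gaussian averages of the characteristic functions converge, so the
  Laplace transforms of \<open>\<parallel>Z\<^sub>n\<parallel>\<^sup>2\<close> converge to that of \<open>\<parallel>N\<parallel>\<^sup>2\<close> with \<open>N\<close> a standard Gaussian vector. The
  limit needs no computation, because this is the variable that defines the chi-squared distribution.
\<close>

lemma weak_conv_norm_square_chi_squared:
  fixes Z :: "nat \<Rightarrow> 'w \<Rightarrow> real ^ 'q"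
  assumes "prob_space M" and Z[measurable]: "\<And>n. Z n \<in> borel_measurable M"
    and char: "\<And>t. (\<lambda>n. LINT \<omega>|M. iexp (t \<bullet> Z n \<omega>)) \<longlonglongrightarrow> exp (- (norm t)\<^sup>2 / 2)"
  shows "weak_conv_m (\<lambda>n. distr M borel (\<lambda>\<omega>. (norm (Z n \<omega>))\<^sup>2)) (chi_squared_distribution CARD('q))"
proof -
  interpret M: prob_space M by fact
  let ?G = "gaussian_product CARD('q)"
  interpret G: prob_space ?G by (rule prob_space_gaussian_product)
  obtain e :: "'q \<Rightarrow> nat" where e: "bij_betw e UNIV {..<CARD('q)}"
    using ex_bij_betw_finite_nat[of "UNIV :: 'q set"] by (auto simp: atLeast0LessThan)
  note [measurable] = measurable_gaussian_vector[OF e]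
  show ?thesis
  proof (rule weak_conv_of_laplace_transforms)
    show "real_distribution (distr M borel (\<lambda>\<omega>. (norm (Z n \<omega>))\<^sup>2))" for n
      by (intro M.real_distribution_distr) measurable
    show "real_distribution (chi_squared_distribution CARD('q))" by (rule real_distribution_chi_squared)
    show "AE t in distr M borel (\<lambda>\<omega>. (norm (Z n \<omega>))\<^sup>2). 0 \<le> t" for n
      by (subst AE_distr_iff) auto
    show "AE t in chi_squared_distribution CARD('q). 0 \<le> t"
      unfolding chi_squared_eq_gaussian_vector[OF e] by (subst AE_distr_iff) auto
    fix k :: nat
    (* With c^2 / 2 = k the Laplace transform is evaluated at k. *)
    define c where "c = sqrt (2 * real k)"
    have c: "exp (- (norm (c *\<^sub>R v))\<^sup>2 / 2) = exp (- (k * (norm v)\<^sup>2))" for v :: "real ^ 'q"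
      by (simp add: c_def power_mult_distrib)
    have "(\<lambda>n. LINT z|?G. (LINT \<omega>|M. iexp ((c *\<^sub>R gaussian_vector e z) \<bullet> Z n \<omega>))) \<longlonglongrightarrow>
        (LINT z|?G. complex_of_real (exp (- (norm (c *\<^sub>R gaussian_vector e z))\<^sup>2 / 2)))"
    proof (rule integral_dominated_convergence[where w = "\<lambda>_. 1"])
      show "AE z in ?G. (\<lambda>n. LINT \<omega>|M. iexp ((c *\<^sub>R gaussian_vector e z) \<bullet> Z n \<omega>)) \<longlonglongrightarrow>
          complex_of_real (exp (- (norm (c *\<^sub>R gaussian_vector e z))\<^sup>2 / 2))"
        by (intro always_eventually allI char)
      show "AE z in ?G. norm (LINT \<omega>|M. iexp ((c *\<^sub>R gaussian_vector e z) \<bullet> Z n \<omega>)) \<le> 1" for n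
      proof (intro always_eventually allI)
        fix z
        have "norm (LINT \<omega>|M. iexp ((c *\<^sub>R gaussian_vector e z) \<bullet> Z n \<omega>)) \<le>
            (LINT \<omega>|M. norm (iexp ((c *\<^sub>R gaussian_vector e z) \<bullet> Z n \<omega>)))" by (rule integral_norm_bound)
        then show "norm (LINT \<omega>|M. iexp ((c *\<^sub>R gaussian_vector e z) \<bullet> Z n \<omega>)) \<le> 1"
          by (simp add: M.prob_space)
      qed
      show "(\<lambda>z. complex_of_real (exp (- (norm (c *\<^sub>R gaussian_vector e z))\<^sup>2 / 2))) \<in> borel_measurable ?G"
        by measurable
      show "(\<lambda>z. LINT \<omega>|M. iexp ((c *\<^sub>R gaussian_vector e z) \<bullet> Z n \<omega>)) \<in> borel_measurable ?G" for n
        by (rule M.borel_measurable_lebesgue_integral) (simp add: case_prod_beta')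
      show "integrable ?G (\<lambda>_. 1 :: real)" by simp
    qed
    then have "(\<lambda>n. complex_of_real (LINT \<omega>|M. exp (- (norm (c *\<^sub>R Z n \<omega>))\<^sup>2 / 2))) \<longlonglongrightarrow>
        complex_of_real (LINT z|?G. exp (- (norm (c *\<^sub>R gaussian_vector e z))\<^sup>2 / 2))"
      unfolding laplace_norm_square_eq_char_average[OF e \<open>prob_space M\<close> Z] integral_complex_of_real .
    then have "(\<lambda>n. LINT \<omega>|M. exp (- (k * (norm (Z n \<omega>))\<^sup>2))) \<longlonglongrightarrow>
        (LINT z|?G. exp (- (k * (norm (gaussian_vector e z))\<^sup>2)))"
      unfolding tendsto_of_real_iff c .
    then show "(\<lambda>n. LINT t|distr M borel (\<lambda>\<omega>. (norm (Z n \<omega>))\<^sup>2). exp (- (k * t))) \<longlonglongrightarrow>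
        (LINT t|chi_squared_distribution CARD('q). exp (- (k * t)))"
      unfolding chi_squared_eq_gaussian_vector[OF e] by (simp add: integral_distr)
  qed
qed

section \<open>Perturbation of limits in distribution\<close>

text \<open>
  A version of Slutsky's lemma for functions \<open>Z\<^sub>n\<close> that need not be measurable. It suffices to bound the
  two outer probabilities from above: they add up to at least one, so each upper bound is
  also a lower bound for the other. The upper bounds compare \<open>Z\<^sub>n\<close> with \<open>Y\<^sub>n\<close> at continuity points slightly to the
  right and to the left of \<open>x\<close>, which exist because a distribution function has only countably many jumps.
\<close>

lemma converges_in_distribution_of_weak_conv_m:
  assumes "prob_space M" "real_distribution \<nu>"
    and Y[measurable]: "\<And>n. Y n \<in> borel_measurable M"
    and conv: "weak_conv_m (\<lambda>n. distr M borel (Y n)) \<nu>"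
    and close: "\<And>\<epsilon>. 0 < \<epsilon> \<Longrightarrow> \<forall>\<^sub>F n in sequentially.
      \<exists>A\<in>sets M. measure M A \<le> \<epsilon> \<and> (\<forall>\<omega>\<in>space M - A. \<bar>Z n \<omega> - Y n \<omega>\<bar> \<le> \<epsilon>)"
  shows "converges_in_distribution M Z \<nu>"
  unfolding converges_in_distribution_def
proof (intro allI impI)
  interpret M: prob_space M by fact
  interpret \<nu>: real_distribution \<nu> by fact
  fix x assume x: "isCont (cdf \<nu>) x"
  define p where "p n = enn2real (outer_measure_of M {\<omega> \<in> space M. Z n \<omega> \<le> x})" for n
  define q where "q n = enn2real (outer_measure_of M {\<omega> \<in> space M. x < Z n \<omega>})" for n
  have om_eq: "\<exists>E\<in>sets M. S \<subseteq> E \<and> outer_measure_of M S = ennreal (M.prob E)" if "S \<subseteq> space M" for S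
    using outer_measure_of_attain[OF that] by (auto simp: M.emeasure_eq_measure)
  have p: "outer_measure_of M {\<omega> \<in> space M. Z n \<omega> \<le> x} = ennreal (p n)"
    and q: "outer_measure_of M {\<omega> \<in> space M. x < Z n \<omega>} = ennreal (q n)" for n
    using om_eq[of "{\<omega> \<in> space M. Z n \<omega> \<le> x}"] om_eq[of "{\<omega> \<in> space M. x < Z n \<omega>}"]
    by (auto simp: p_def q_def)
  have pq: "1 \<le> p n + q n" for n
  proof -
    obtain E where E: "E \<in> sets M" "{\<omega> \<in> space M. Z n \<omega> \<le> x} \<subseteq> E" "p n = M.prob E"
      using om_eq[of "{\<omega> \<in> space M. Z n \<omega> \<le> x}"] unfolding p_def by auto
    obtain E' where E': "E' \<in> sets M" "{\<omega> \<in> space M. x < Z n \<omega>} \<subseteq> E'" "q n = M.prob E'"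
      using om_eq[of "{\<omega> \<in> space M. x < Z n \<omega>}"] unfolding q_def by auto
    have "space M \<subseteq> E \<union> E'" using E(2) E'(2) by (auto simp: not_le[symmetric])
    then have "M.prob (space M) \<le> M.prob (E \<union> E')" using E E' by (intro M.finite_measure_mono) auto
    also have "\<dots> \<le> M.prob E + M.prob E'" using E E' by (intro measure_Un_le)
    finally show ?thesis using E E' by (simp add: M.prob_space)
  qed
  have outer_le: "enn2real (outer_measure_of M S) \<le> M.prob E" if "E \<in> sets M" "S \<subseteq> E" for S E
    using outer_measure_of_mono[OF that(2), of M] that(1)
    by (simp add: M.emeasure_eq_measure enn2real_leI)
  have bounds: "\<forall>\<^sub>F n in sequentially. p n \<le> cdf \<nu> x + 3 * \<delta> \<and> q n \<le> 1 - cdf \<nu> x + 3 * \<delta>"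
    if \<delta>: "0 < \<delta>" for \<delta>
  proof -
    obtain d where d: "0 < d" "\<And>y. \<bar>y - x\<bar> < d \<Longrightarrow> \<bar>cdf \<nu> y - cdf \<nu> x\<bar> < \<delta>"
      using x \<delta> unfolding continuous_at_eps_delta dist_real_def by metis
    have ctble: "countable {a. \<not> isCont (cdf \<nu>) a}"
      by (intro mono_ctble_discont monoI \<nu>.cdf_nondecreasing)
    obtain y where y: "x < y" "y < x + d" "isCont (cdf \<nu>) y"
      using open_minus_countable[OF ctble, of "{x<..<x + d}"] d(1) by auto
    obtain y' where y': "x - d < y'" "y' < x" "isCont (cdf \<nu>) y'"
      using open_minus_countable[OF ctble, of "{x - d<..<x}"] d(1) by auto
    define \<epsilon> where "\<epsilon> = Min {\<delta>, y - x, x - y'}"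
    have \<epsilon>: "0 < \<epsilon>" "\<epsilon> \<le> \<delta>" "\<epsilon> \<le> y - x" "\<epsilon> \<le> x - y'" using \<delta> y y' by (auto simp: \<epsilon>_def min_less_iff_disj)
    have cdf_eq: "cdf (distr M borel (Y n)) u = M.prob {\<omega> \<in> space M. Y n \<omega> \<le> u}" for n u
      unfolding cdf_def by (subst measure_distr) (auto intro!: arg_cong[where f = M.prob])
    have lim: "(\<lambda>n. M.prob {\<omega> \<in> space M. Y n \<omega> \<le> u}) \<longlonglongrightarrow> cdf \<nu> u" if "isCont (cdf \<nu>) u" for u
      using conv that unfolding weak_conv_m_def weak_conv_def cdf_eq by blast
    have 1: "\<forall>\<^sub>F n in sequentially. M.prob {\<omega> \<in> space M. Y n \<omega> \<le> y} < cdf \<nu> x + 2 * \<delta>"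
      using d(2)[of y] y \<delta> by (intro order_tendstoD(2)[OF lim]) auto
    have 2: "\<forall>\<^sub>F n in sequentially. cdf \<nu> x - 2 * \<delta> < M.prob {\<omega> \<in> space M. Y n \<omega> \<le> y'}"
      using d(2)[of y'] y' \<delta> by (intro order_tendstoD(1)[OF lim]) auto
    show ?thesis using close[OF \<epsilon>(1)] 1 2
    proof eventually_elim
      case (elim n)
      then obtain A where A: "A \<in> sets M" "M.prob A \<le> \<epsilon>" "\<And>\<omega>. \<omega> \<in> space M - A \<Longrightarrow> \<bar>Z n \<omega> - Y n \<omega>\<bar> \<le> \<epsilon>"
        by blast
      have "p n \<le> M.prob ({\<omega> \<in> space M. Y n \<omega> \<le> y} \<union> A)"
        unfolding p_def
      proof (rule outer_le)
        show "{\<omega> \<in> space M. Z n \<omega> \<le> x} \<subseteq> {\<omega> \<in> space M. Y n \<omega> \<le> y} \<union> A"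
          using A(3) \<epsilon> by (fastforce simp: abs_le_iff)
      qed (use A(1) in measurable)
      also have "\<dots> \<le> M.prob {\<omega> \<in> space M. Y n \<omega> \<le> y} + M.prob A"
        using A(1) by (intro measure_Un_le) measurable
      finally have p': "p n \<le> cdf \<nu> x + 3 * \<delta>" using elim(2) A(2) \<epsilon>(2) by linarith
      have "q n \<le> M.prob ((space M - {\<omega> \<in> space M. Y n \<omega> \<le> y'}) \<union> A)"
        unfolding q_def
      proof (rule outer_le)
        show "{\<omega> \<in> space M. x < Z n \<omega>} \<subseteq> (space M - {\<omega> \<in> space M. Y n \<omega> \<le> y'}) \<union> A"
          using A(3) \<epsilon> by (fastforce simp: abs_le_iff)
      qed (use A(1) in measurable)
      also have "\<dots> \<le> M.prob (space M - {\<omega> \<in> space M. Y n \<omega> \<le> y'}) + M.prob A"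
        using A(1) by (intro measure_Un_le) measurable
      also have "M.prob (space M - {\<omega> \<in> space M. Y n \<omega> \<le> y'}) = 1 - M.prob {\<omega> \<in> space M. Y n \<omega> \<le> y'}"
        by (rule M.prob_compl) measurable
      finally show ?case using p' elim(3) A(2) \<epsilon>(2) by linarith
    qed
  qed
  have "p \<longlonglongrightarrow> cdf \<nu> x \<and> q \<longlonglongrightarrow> 1 - cdf \<nu> x"
  proof (intro conjI tendstoI)
    fix r :: real assume r: "0 < r"
    then have b: "\<forall>\<^sub>F n in sequentially. p n \<le> cdf \<nu> x + 3 * (r / 6) \<and> q n \<le> 1 - cdf \<nu> x + 3 * (r / 6)"
      by (intro bounds) simp
    show "\<forall>\<^sub>F n in sequentially. dist (p n) (cdf \<nu> x) < r"
      using b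
    proof eventually_elim
      case (elim n)
      with pq[of n] r show ?case unfolding dist_real_def abs_less_iff by linarith
    qed
    show "\<forall>\<^sub>F n in sequentially. dist (q n) (1 - cdf \<nu> x) < r"
      using b
    proof eventually_elim
      case (elim n)
      with pq[of n] r show ?case unfolding dist_real_def abs_less_iff by linarith
    qed
  qed
  then show "(\<lambda>n. outer_measure_of M {\<omega> \<in> space M. Z n \<omega> \<le> x}) \<longlonglongrightarrow> ennreal (cdf \<nu> x) \<and>
        (\<lambda>n. outer_measure_of M {\<omega> \<in> space M. x < Z n \<omega>}) \<longlonglongrightarrow> ennreal (1 - cdf \<nu> x)"
    unfolding p q by (auto intro: tendsto_ennrealI)
qed

section \<open>Statements of high probability\<close>

text \<open>
  The property \<open>Q n\<close> may fail to be measurable, as it involves arg-mins over uncountable sets; so its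
  failure is only required to be covered by a measurable set of small measure.
\<close>

definition likely :: "'w measure \<Rightarrow> real \<Rightarrow> (nat \<Rightarrow> 'w \<Rightarrow> bool) \<Rightarrow> bool" where
  "likely M \<epsilon> Q \<longleftrightarrow>
     (\<forall>\<^sub>F n in sequentially. \<exists>A\<in>sets M. measure M A \<le> \<epsilon> \<and> (\<forall>\<omega>\<in>space M - A. Q n \<omega>))"

lemma likely_conj:
  assumes "finite_measure M" "likely M \<epsilon> Q" "likely M \<epsilon>' Q'"
  shows "likely M (\<epsilon> + \<epsilon>') (\<lambda>n \<omega>. Q n \<omega> \<and> Q' n \<omega>)"
  using assms(2,3) unfolding likely_def
proof eventually_elim
  interpret finite_measure M by fact
  case (elim n)
  then obtain A A' where "A \<in> sets M" "A' \<in> sets M" "measure M A \<le> \<epsilon>" "measure M A' \<le> \<epsilon>'"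
      "\<forall>\<omega>\<in>space M - A. Q n \<omega>" "\<forall>\<omega>\<in>space M - A'. Q' n \<omega>" by blast
  then show ?case
    using measure_Un_le[of A M A'] by (intro bexI[of _ "A \<union> A'"]) auto
qed

lemma likely_mono:
  assumes "likely M \<epsilon> Q" "\<epsilon> \<le> \<epsilon>'" "\<forall>\<^sub>F n in sequentially. \<forall>\<omega>\<in>space M. Q n \<omega> \<longrightarrow> Q' n \<omega>"
  shows "likely M \<epsilon>' Q'"
  using assms(1,3) unfolding likely_def
proof eventually_elim
  case (elim n)
  then show ?case using assms(2) by (meson DiffD1 order_trans)
qed

lemma likely_AE:
  assumes "AE \<omega> in M. \<forall>n. Q n \<omega>" "0 \<le> \<epsilon>"
  shows "likely M \<epsilon> Q"
proof -
  obtain A where A: "{\<omega>\<in>space M. \<not> (\<forall>n. Q n \<omega>)} \<subseteq> A" "A \<in> sets M" "emeasure M A = 0"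
    using assms(1) by (auto elim: AE_E)
  have "measure M A = 0" using A by (simp add: measure_def)
  then show ?thesis unfolding likely_def using A assms(2) by (intro always_eventually allI bexI[of _ A]) auto
qed

lemma likely_Ball_finite:
  fixes \<epsilon> :: real
  assumes "finite_measure M" "finite J" "\<And>j. j \<in> J \<Longrightarrow> likely M \<epsilon> (Q j)"
  shows "likely M (real (card J) * \<epsilon>) (\<lambda>n \<omega>. \<forall>j\<in>J. Q j n \<omega>)"
  using assms(2,3)
proof (induction J)
  case empty
  show ?case unfolding likely_def by (intro always_eventually allI bexI[of _ "{}"]) auto
next
  case (insert j J)
  have "likely M (\<epsilon> + real (card J) * \<epsilon>) (\<lambda>n \<omega>. Q j n \<omega> \<and> (\<forall>j\<in>J. Q j n \<omega>))"
    using insert by (intro likely_conj assms(1)) auto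
  then show ?case using insert by (simp add: algebra_simps)
qed

section \<open>Independent identically distributed samples\<close>

locale iid_sample = prob_space M for M :: "'w measure" +
  fixes Xs :: "nat \<Rightarrow> 'w \<Rightarrow> 'x::topological_space" and P :: "'x measure"
  assumes indep: "indep_vars (\<lambda>_. borel) Xs UNIV"
    and distr: "\<And>i. distr M borel (Xs i) = P"
begin

lemma measurable_Xs [measurable]: "Xs i \<in> borel_measurable M"
  using indep by (simp add: indep_vars_def2)

lemma sets_P [simp, measurable_cong]: "sets P = sets borel"
  using distr[of 0] by (metis sets_distr)

lemma space_P [simp]: "space P = UNIV"
  using sets_eq_imp_space_eq[OF sets_P] by simp

lemma integral_sample:
  fixes h :: "'x \<Rightarrow> 'b::{banach,second_countable_topology}"
  assumes "h \<in> borel_measurable borel"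
  shows "(LINT \<omega>|M. h (Xs i \<omega>)) = integral\<^sup>L P h"
  unfolding distr[of i, symmetric] using assms by (subst integral_distr) auto

lemma integrable_sample:
  fixes h :: "'x \<Rightarrow> 'b::{banach,second_countable_topology}"
  assumes "h \<in> borel_measurable borel"
  shows "integrable M (\<lambda>\<omega>. h (Xs i \<omega>)) \<longleftrightarrow> integrable P h"
  unfolding distr[of i, symmetric] using assms by (subst integrable_distr_eq) auto

lemma prob_sample:
  assumes "{x. Q x} \<in> sets borel"
  shows "prob {\<omega>\<in>space M. Q (Xs i \<omega>)} = measure P {x. Q x}"
  unfolding distr[of i, symmetric] using assms by (subst measure_distr) (auto intro!: arg_cong[where f = prob])

lemma prob_space_P: "prob_space P"
  using prob_space_distr[OF measurable_Xs, of 0] by (simp add: distr)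

lemma second_moment_sum:
  fixes h :: "'x \<Rightarrow> real"
  assumes h[measurable]: "h \<in> borel_measurable borel"
    and int: "integrable P (\<lambda>x. (h x)\<^sup>2)" and zero: "integral\<^sup>L P h = 0"
  shows "integrable M (\<lambda>\<omega>. (\<Sum>i<n. h (Xs i \<omega>))\<^sup>2)"
    and "expectation (\<lambda>\<omega>. (\<Sum>i<n. h (Xs i \<omega>))\<^sup>2) = n * (LINT x|P. (h x)\<^sup>2)"
proof -
  interpret P: prob_space P by (rule prob_space_P)
  have int1: "integrable P h" using int by (rule P.square_integrable_imp_integrable[rotated]) simp
  have eq: "(\<Sum>i<n. h (Xs i \<omega>))\<^sup>2 = (\<Sum>i<n. \<Sum>j<n. h (Xs i \<omega>) * h (Xs j \<omega>))" for \<omega>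
    by (simp add: power2_eq_square sum_product)
  have ind: "indep_vars (\<lambda>_. borel) (\<lambda>i \<omega>. h (Xs i \<omega>)) {i, j}" for i j
    by (rule indep_vars_compose2[OF indep_vars_subset[OF indep]]) auto
  have cross: "integrable M (\<lambda>\<omega>. h (Xs i \<omega>) * h (Xs j \<omega>)) \<and>
     expectation (\<lambda>\<omega>. h (Xs i \<omega>) * h (Xs j \<omega>)) = (if i = j then LINT x|P. (h x)\<^sup>2 else 0)" for i j
  proof (cases "i = j")
    case True
    then show ?thesis
      using integrable_sample[of "\<lambda>x. (h x)\<^sup>2" i] integral_sample[of "\<lambda>x. (h x)\<^sup>2" i] int
      by (simp add: power2_eq_square)
  next
    case False
    then show ?thesis
      using indep_vars_integrable[OF _ ind[of i j]] indep_vars_lebesgue_integral[OF _ ind[of i j]]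
        integrable_sample[of h] integral_sample[of h] int1 zero by simp
  qed
  show "integrable M (\<lambda>\<omega>. (\<Sum>i<n. h (Xs i \<omega>))\<^sup>2)"
    unfolding eq using cross by auto
  have "expectation (\<lambda>\<omega>. (\<Sum>i<n. h (Xs i \<omega>))\<^sup>2) = (\<Sum>i<n. \<Sum>j<n. (if i = j then LINT x|P. (h x)\<^sup>2 else 0))"
    unfolding eq using cross by (simp add: Bochner_Integration.integral_sum Bochner_Integration.integrable_sum)
  then show "expectation (\<lambda>\<omega>. (\<Sum>i<n. h (Xs i \<omega>))\<^sup>2) = n * (LINT x|P. (h x)\<^sup>2)"
    by simp
qed

lemma likely_mean_near_expectation:
  fixes h :: "'x \<Rightarrow> real"
  assumes h[measurable]: "h \<in> borel_measurable borel"
    and int: "integrable P (\<lambda>x. (h x)\<^sup>2)" and "0 < \<epsilon>" "0 < \<eta>"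
  shows "likely M \<epsilon> (\<lambda>n \<omega>. \<bar>(\<Sum>i<n. h (Xs i \<omega>)) / n - integral\<^sup>L P h\<bar> \<le> \<eta>)"
proof -
  interpret P: prob_space P by (rule prob_space_P)
  define c where "c = integral\<^sup>L P h"
  define h' where "h' x = h x - c" for x
  have [measurable]: "h' \<in> borel_measurable borel" unfolding h'_def by measurable
  have int1: "integrable P h" using int by (rule P.square_integrable_imp_integrable[rotated]) simp
  have int': "integrable P (\<lambda>x. (h' x)\<^sup>2)" "integral\<^sup>L P h' = 0"
    using int int1 P.prob_space unfolding h'_def[abs_def] power2_diff by (auto simp: c_def)
  define v where "v = (LINT x|P. (h' x)\<^sup>2)"
  have v: "0 \<le> v" unfolding v_def by simp
  have "\<forall>\<^sub>F n in sequentially. v / (\<epsilon> * \<eta>\<^sup>2) < real n" by real_asymp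
  then show ?thesis unfolding likely_def c_def[symmetric]
  proof eventually_elim
    case (elim n)
    have n: "0 < real n" using elim v \<open>0 < \<epsilon>\<close> by (smt (verit) divide_nonneg_nonneg mult_nonneg_nonneg zero_le_power2)
    define A where "A = {\<omega>\<in>space M. (\<eta> * n)\<^sup>2 \<le> (\<Sum>i<n. h' (Xs i \<omega>))\<^sup>2}"
    have "prob A \<le> expectation (\<lambda>\<omega>. (\<Sum>i<n. h' (Xs i \<omega>))\<^sup>2) / (\<eta> * n)\<^sup>2"
      unfolding A_def using int' n \<open>0 < \<eta>\<close>
      by (intro integral_Markov_inequality_measure[where A = "{}"] second_moment_sum) auto
    also have "\<dots> = v / (\<eta>\<^sup>2 * n)"
      unfolding second_moment_sum(2)[OF _ int', simplified] v_def[symmetric]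
      using n by (simp add: power2_eq_square)
    also have "\<dots> \<le> \<epsilon>" using elim n \<open>0 < \<eta>\<close> \<open>0 < \<epsilon>\<close> by (simp add: field_simps)
    finally have "prob A \<le> \<epsilon>" .
    moreover have "A \<in> sets M" unfolding A_def by measurable
    moreover have "\<bar>(\<Sum>i<n. h (Xs i \<omega>)) / n - c\<bar> \<le> \<eta>" if "\<omega> \<in> space M - A" for \<omega>
    proof -
      have "(\<Sum>i<n. h' (Xs i \<omega>))\<^sup>2 < (\<eta> * n)\<^sup>2" using that by (auto simp: A_def)
      then have "\<bar>\<Sum>i<n. h' (Xs i \<omega>)\<bar>\<^sup>2 < (\<eta> * n)\<^sup>2" unfolding power2_abs .
      moreover have "0 \<le> \<eta> * n" using \<open>0 < \<eta>\<close> by simp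
      ultimately have "\<bar>\<Sum>i<n. h' (Xs i \<omega>)\<bar> < \<eta> * n" by (rule power2_less_imp_less)
      moreover have "(\<Sum>i<n. h (Xs i \<omega>)) / n - c = (\<Sum>i<n. h' (Xs i \<omega>)) / n"
        using n by (simp add: h'_def sum_subtractf diff_divide_distrib)
      ultimately show ?thesis using n by (simp add: abs_divide divide_le_eq less_imp_le)
    qed
    ultimately show ?case by blast
  qed
qed

lemma likely_sum_le:
  fixes h :: "'x \<Rightarrow> real"
  assumes h[measurable]: "h \<in> borel_measurable borel" and int: "integrable P h" and "\<And>x. 0 \<le> h x"
    and "0 < K" "integral\<^sup>L P h \<le> \<epsilon> * K"
  shows "likely M \<epsilon> (\<lambda>n \<omega>. (\<Sum>i<n. h (Xs i \<omega>)) \<le> K * n)"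
proof -
  have "\<forall>\<^sub>F n in sequentially. 0 < real n" by real_asymp
  then show ?thesis unfolding likely_def
  proof eventually_elim
    case (elim n)
    define A where "A = {\<omega>\<in>space M. K * n \<le> (\<Sum>i<n. h (Xs i \<omega>))}"
    have "prob A \<le> expectation (\<lambda>\<omega>. \<Sum>i<n. h (Xs i \<omega>)) / (K * n)"
      unfolding A_def using assms elim integrable_sample[OF h]
      by (intro integral_Markov_inequality_measure[where A = "{}"]) (auto intro!: sum_nonneg)
    also have "expectation (\<lambda>\<omega>. \<Sum>i<n. h (Xs i \<omega>)) = n * integral\<^sup>L P h"
      using int integrable_sample[OF h] integral_sample[OF h] by (simp add: Bochner_Integration.integral_sum)
    also have "n * integral\<^sup>L P h / (K * n) \<le> \<epsilon>" using elim assms by (simp add: field_simps)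
    finally have "prob A \<le> \<epsilon>" .
    moreover have "A \<in> sets M" unfolding A_def by measurable
    ultimately show ?case by (intro bexI[of _ A]) (auto simp: A_def)
  qed
qed

text \<open>
  The maximum of \<open>n\<close> integrable terms is \<open>o(n)\<close> in probability: the union bound and
  \<open>\<eta> n P(h > \<eta> n) \<le> E[h; h > \<eta> n]\<close>, where the right-hand side tends to zero.
\<close>

lemma likely_max_le:
  fixes h :: "'x \<Rightarrow> real" and \<eta> :: real
  assumes h[measurable]: "h \<in> borel_measurable borel" and int: "integrable P h" and pos: "\<And>x. 0 \<le> h x"
    and "0 < \<epsilon>" "0 < \<eta>"
  shows "likely M \<epsilon> (\<lambda>n \<omega>. \<forall>i<n. h (Xs i \<omega>) \<le> \<eta> * n)"
proof -
  define B where "B n = {x. \<eta> * real n < h x}" for n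
  have [measurable]: "B n \<in> sets borel" for n
    unfolding B_def by measurable
  have "(\<lambda>n. LINT x|P. h x * indicator (B n) x) \<longlonglongrightarrow> (LINT x|P. 0)"
  proof (rule integral_dominated_convergence[where w = h])
    show "AE x in P. (\<lambda>n. h x * indicator (B n) x) \<longlonglongrightarrow> 0"
    proof (intro always_eventually allI)
      fix x
      have "\<forall>\<^sub>F n in sequentially. h x \<le> \<eta> * real n" using \<open>0 < \<eta>\<close> by real_asymp
      then have "\<forall>\<^sub>F n in sequentially. h x * indicator (B n) x = 0"
        by eventually_elim (simp add: B_def)
      then show "(\<lambda>n. h x * indicator (B n) x) \<longlonglongrightarrow> 0" by (rule tendsto_eventually)
    qed
  qed (use int pos in \<open>auto simp: indicator_def\<close>)
  then have "\<forall>\<^sub>F n in sequentially. (LINT x|P. h x * indicator (B n) x) < \<epsilon> * \<eta>"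
    using assms by (intro order_tendstoD(2)) auto
  moreover have "\<forall>\<^sub>F n in sequentially. 0 < real n" by real_asymp
  ultimately show ?thesis unfolding likely_def
  proof eventually_elim
    case (elim n)
    interpret P: prob_space P by (rule prob_space_P)
    define A where "A = (\<Union>i<n. {\<omega>\<in>space M. Xs i \<omega> \<in> B n})"
    have intB: "integrable P (\<lambda>x. h x * indicator (B n) x)"
      using integrable_mult_indicator[of "B n" P h] int by (simp add: mult.commute)
    have intI: "integrable P (indicator (B n) :: 'x \<Rightarrow> real)"
      by (intro P.integrable_const_bound[of _ 1]) auto
    have "\<eta> * n * P.prob (B n) = (LINT x|P. \<eta> * real n * (indicator (B n) x :: real))" by simp
    also have "\<dots> \<le> (LINT x|P. h x * indicator (B n) x)"
    proof (rule integral_mono)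
      show "integrable P (\<lambda>x. \<eta> * real n * (indicator (B n) x :: real))"
        using intI by (rule integrable_mult_right)
    qed (use intB in \<open>auto simp: B_def indicator_def\<close>)
    also have "\<dots> \<le> \<epsilon> * \<eta>" using elim by simp
    finally have "n * P.prob (B n) \<le> \<epsilon>" using \<open>0 < \<eta>\<close> by (simp add: mult_ac)
    moreover have "prob A \<le> (\<Sum>i<n. prob {\<omega>\<in>space M. Xs i \<omega> \<in> B n})"
      unfolding A_def by (intro finite_measure_subadditive_finite) auto
    moreover have "(\<Sum>i<n. prob {\<omega>\<in>space M. Xs i \<omega> \<in> B n}) = n * P.prob (B n)"
      by (subst prob_sample) auto
    moreover have "A \<in> sets M" unfolding A_def by measurable
    ultimately show ?case by (intro bexI[of _ A]) (auto simp: A_def B_def not_less)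
  qed
qed

text \<open>
  The characteristic function of a random vector at \<open>t\<close> is that of its normalized projection on \<open>t\<close> at
  the point \<open>\<parallel>t\<parallel>\<close>, so the one-dimensional central limit theorem suffices.
\<close>

lemma sample_mean_char_tendsto:
  fixes f :: "'x \<Rightarrow> real ^ 'q"
  assumes f[measurable]: "f \<in> borel_measurable borel"
    and int: "\<And>v. integrable P (\<lambda>x. (v \<bullet> f x)\<^sup>2)"
    and mean: "\<And>v. (LINT x|P. v \<bullet> f x) = 0" and cov: "\<And>v. (LINT x|P. (v \<bullet> f x)\<^sup>2) = (norm v)\<^sup>2"
  shows "(\<lambda>n. LINT \<omega>|M. iexp (t \<bullet> (sqrt n *\<^sub>R (\<Sum>i<n. (1 / real n) *\<^sub>R f (Xs i \<omega>)))))
     \<longlonglongrightarrow> exp (- (norm t)\<^sup>2 / 2)"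
proof (cases "t = 0")
  case True
  then show ?thesis by (simp add: prob_space)
next
  case False
  define Y where "Y i \<omega> = t \<bullet> f (Xs i \<omega>)" for i \<omega>
  have [measurable]: "Y i \<in> borel_measurable M" for i unfolding Y_def by measurable
  have weak: "weak_conv_m (\<lambda>n. distr M borel (\<lambda>\<omega>. (\<Sum>i<n. Y i \<omega>) / sqrt (n * (norm t)\<^sup>2))) std_normal_distribution"
  proof (rule central_limit_theorem_zero_mean)
    show "indep_vars (\<lambda>i. borel) Y UNIV"
      unfolding Y_def[abs_def] by (rule indep_vars_compose2[OF indep]) auto
    show mean0: "expectation (Y n) = 0" for n
      unfolding Y_def using integral_sample[of "\<lambda>x. t \<bullet> f x"] mean by simp
    show "0 < norm t" using False by simp
    show "integrable M (\<lambda>\<omega>. (Y n \<omega>)\<^sup>2)" for n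
      unfolding Y_def using integrable_sample[of "\<lambda>x. (t \<bullet> f x)\<^sup>2"] int by simp
    show "variance (Y n) = (norm t)\<^sup>2" for n
      unfolding mean0 unfolding Y_def using integral_sample[of "\<lambda>x. (t \<bullet> f x)\<^sup>2"] cov by simp
    show "distr M borel (Y n) = distr P borel (\<lambda>x. t \<bullet> f x)" for n
      unfolding Y_def distr[of n, symmetric] by (subst distr_distr) (auto simp: comp_def)
  qed
  have "(\<lambda>n. char (distr M borel (\<lambda>\<omega>. (\<Sum>i<n. Y i \<omega>) / sqrt (n * (norm t)\<^sup>2))) (norm t))
     \<longlonglongrightarrow> char std_normal_distribution (norm t)"
    by (intro levy_continuity1[OF _ real_dist_normal_dist weak] real_distribution_distr) measurable
  moreover have "char (distr M borel (\<lambda>\<omega>. (\<Sum>i<n. Y i \<omega>) / sqrt (n * (norm t)\<^sup>2))) (norm t) =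
      (LINT \<omega>|M. iexp (t \<bullet> (sqrt n *\<^sub>R (\<Sum>i<n. (1 / real n) *\<^sub>R f (Xs i \<omega>)))))" for n
  proof -
    have "norm t * ((\<Sum>i<n. Y i \<omega>) / sqrt (n * (norm t)\<^sup>2)) =
        t \<bullet> (sqrt n *\<^sub>R (\<Sum>i<n. (1 / real n) *\<^sub>R f (Xs i \<omega>)))" for \<omega>
    proof (cases "n = 0")
      case n: False
      have "norm t * ((\<Sum>i<n. Y i \<omega>) / sqrt (n * (norm t)\<^sup>2)) = (\<Sum>i<n. Y i \<omega>) / sqrt n"
        using False n by (simp add: real_sqrt_mult)
      also have "\<dots> = sqrt n * ((\<Sum>i<n. Y i \<omega>) / n)" 
        using n by (simp add: field_simps)
      also have "\<dots> = t \<bullet> (sqrt n *\<^sub>R (\<Sum>i<n. (1 / real n) *\<^sub>R f (Xs i \<omega>)))"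
        by (simp add: Y_def inner_sum_right sum_divide_distrib)
      finally show ?thesis .
    qed simp
    then show ?thesis unfolding char_def by (subst integral_distr) auto
  qed
  ultimately show ?thesis by (simp add: char_std_normal_distribution)
qed

lemma likely_mean_bounded:
  fixes f :: "'x \<Rightarrow> real ^ 'q"
  assumes f[measurable]: "f \<in> borel_measurable borel"
    and int: "\<And>v. integrable P (\<lambda>x. (v \<bullet> f x)\<^sup>2)"
    and mean: "\<And>v. (LINT x|P. v \<bullet> f x) = 0" and cov: "\<And>v. (LINT x|P. (v \<bullet> f x)\<^sup>2) = (norm v)\<^sup>2"
    and K: "0 < K" "real CARD('q) \<le> \<epsilon> * K\<^sup>2"
  shows "likely M \<epsilon> (\<lambda>n \<omega>. sqrt n * norm (\<Sum>i<n. (1 / real n) *\<^sub>R f (Xs i \<omega>)) \<le> K)"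
proof -
  have "\<forall>\<^sub>F n in sequentially. 0 < real n" by real_asymp
  then show ?thesis unfolding likely_def
  proof eventually_elim
    case (elim n)
    have comp: "f x $ j = axis j 1 \<bullet> f x" for x j by (simp add: inner_axis' )
    have 2: "integrable M (\<lambda>\<omega>. (\<Sum>i<n. f (Xs i \<omega>) $ j)\<^sup>2)"
      "expectation (\<lambda>\<omega>. (\<Sum>i<n. f (Xs i \<omega>) $ j)\<^sup>2) = n" for j
      using second_moment_sum[of "\<lambda>x. f x $ j" n] int[of "axis j 1"] mean[of "axis j 1"] cov[of "axis j 1"]
      by (simp_all add: comp norm_axis_1)
    define T where "T \<omega> = (\<Sum>j\<in>UNIV. (\<Sum>i<n. f (Xs i \<omega>) $ j)\<^sup>2)" for \<omega>
    have intT: "integrable M T" "expectation T = CARD('q) * n"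
      unfolding T_def using 2 by (simp_all add: Bochner_Integration.integral_sum)
    have [measurable]: "T \<in> borel_measurable M" using intT(1) by (rule borel_measurable_integrable)
    have T: "(sqrt n * norm (\<Sum>i<n. (1 / real n) *\<^sub>R f (Xs i \<omega>)))\<^sup>2 = T \<omega> / n" for \<omega>
    proof -
      have "norm (\<Sum>i<n. (1 / real n) *\<^sub>R f (Xs i \<omega>)) = norm (\<Sum>i<n. f (Xs i \<omega>)) / n"
        using elim by (simp flip: scaleR_sum_right)
      moreover have "(norm (\<Sum>i<n. f (Xs i \<omega>)))\<^sup>2 = T \<omega>"
        unfolding T_def by (simp add: norm_square_vec)
      ultimately show ?thesis using elim
        by (simp add: power_mult_distrib power_divide) (simp add: power2_eq_square)
    qed
    have T0: "0 \<le> T \<omega>" for \<omega> unfolding T_def by (intro sum_nonneg) simp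
    define A where "A = {\<omega>\<in>space M. K\<^sup>2 * n \<le> T \<omega>}"
    have "prob A \<le> expectation T / (K\<^sup>2 * n)"
      unfolding A_def using intT(1) elim K T0
      by (intro integral_Markov_inequality_measure[where A = "{}"]) auto
    also have "\<dots> \<le> \<epsilon>" using K elim by (simp add: intT field_simps)
    finally have "prob A \<le> \<epsilon>" .
    moreover have "A \<in> sets M" unfolding A_def by measurable
    moreover have "sqrt n * norm (\<Sum>i<n. (1 / real n) *\<^sub>R f (Xs i \<omega>)) \<le> K" if "\<omega> \<in> space M - A" for \<omega>
    proof (rule power2_le_imp_le)
      show "(sqrt n * norm (\<Sum>i<n. (1 / real n) *\<^sub>R f (Xs i \<omega>)))\<^sup>2 \<le> K\<^sup>2"
        unfolding T using that elim by (auto simp: A_def divide_le_eq)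
    qed (use K in simp)
    ultimately show ?case by blast
  qed
qed

text \<open>
  The law of large numbers for each of the finitely many entries of the second moment matrix, which
  makes the quadratic form close to the identity simultaneously for all \<open>v\<close>. The fourth moments of \<open>f\<close>
  are the second moments of the entries.
\<close>

lemma likely_second_moment:
  fixes f :: "'x \<Rightarrow> real ^ 'q"
  assumes f[measurable]: "f \<in> borel_measurable borel"
    and int: "integrable P (\<lambda>x. norm (f x) ^ 4)"
    and cov: "\<And>j k. (LINT x|P. f x $ j * f x $ k) = (if j = k then 1 else 0)"
    and "0 < \<epsilon>" "0 < \<eta>"
  shows "likely M \<epsilon> (\<lambda>n \<omega>. \<forall>v. \<bar>(\<Sum>i<n. (v \<bullet> f (Xs i \<omega>))\<^sup>2) / n - (norm v)\<^sup>2\<bar> \<le> \<eta> * (norm v)\<^sup>2)"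
proof -
  let ?q = "real CARD('q)"
  define \<epsilon>' \<eta>' where "\<epsilon>' = \<epsilon> / ?q\<^sup>2" and "\<eta>' = \<eta> / ?q\<^sup>2"
  have pos: "0 < \<epsilon>'" "0 < \<eta>'" using assms by (auto simp: \<epsilon>'_def \<eta>'_def)
  have comp: "f x $ j = axis j 1 \<bullet> f x" for x j by (simp add: inner_axis')
  have int2: "integrable P (\<lambda>x. (f x $ j * f x $ k)\<^sup>2)" for j k
  proof (rule Bochner_Integration.integrable_bound[OF int])
    show "(\<lambda>x. (f x $ j * f x $ k)\<^sup>2) \<in> borel_measurable P" unfolding comp by measurable
    have "\<bar>f x $ j * f x $ k\<bar> \<le> norm (f x) * norm (f x)" for x
      unfolding abs_mult by (intro mult_mono component_le_norm_cart) auto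
    then have "(f x $ j * f x $ k)\<^sup>2 \<le> (norm (f x) * norm (f x))\<^sup>2" for x
      by (metis abs_ge_zero power2_abs power_mono)
    then show "AE x in P. norm ((f x $ j * f x $ k)\<^sup>2) \<le> norm (norm (f x) ^ 4)"
      by (simp add: power_mult_distrib flip: power_add)
  qed
  have "likely M \<epsilon>' (\<lambda>n \<omega>. \<bar>(\<Sum>i<n. f (Xs i \<omega>) $ j * f (Xs i \<omega>) $ k) / n - (if j = k then 1 else 0)\<bar> \<le> \<eta>')" for j k
    using likely_mean_near_expectation[of "\<lambda>x. f x $ j * f x $ k" \<epsilon>' \<eta>'] int2 pos unfolding cov by (simp add: comp)
  then have "likely M (card (UNIV :: ('q \<times> 'q) set) * \<epsilon>') (\<lambda>n \<omega>. \<forall>p\<in>UNIV.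
      \<bar>(\<Sum>i<n. f (Xs i \<omega>) $ fst p * f (Xs i \<omega>) $ snd p) / n - (if fst p = snd p then 1 else 0)\<bar> \<le> \<eta>')"
    by (intro likely_Ball_finite finite_measure_axioms) auto
  then show ?thesis
  proof (rule likely_mono)
    show "card (UNIV :: ('q \<times> 'q) set) * \<epsilon>' \<le> \<epsilon>"
      by (simp add: card_cartesian_product \<epsilon>'_def power2_eq_square flip: UNIV_Times_UNIV)
    have det: "\<bar>(\<Sum>i<n. (v \<bullet> a i)\<^sup>2) / n - (norm v)\<^sup>2\<bar> \<le> \<eta> * (norm v)\<^sup>2"
      if a: "\<And>j k. \<bar>(\<Sum>i<n. a i $ j * a i $ k) / n - (if j = k then 1 else 0)\<bar> \<le> \<eta>'"
      for n v and a :: "nat \<Rightarrow> real ^ 'q"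
    proof -
      let ?S = "\<lambda>j k. (\<Sum>i<n. a i $ j * a i $ k) / n"
      have "(v \<bullet> a i)\<^sup>2 = (\<Sum>j\<in>UNIV. \<Sum>k\<in>UNIV. v $ j * v $ k * (a i $ j * a i $ k))" for i
        unfolding inner_vec_def power2_eq_square sum_product by (simp add: mult_ac)
      then have "(\<Sum>i<n. (v \<bullet> a i)\<^sup>2) = (\<Sum>i<n. \<Sum>j\<in>UNIV. \<Sum>k\<in>UNIV. v $ j * v $ k * (a i $ j * a i $ k))"
        by simp
      also have "\<dots> = (\<Sum>j\<in>UNIV. \<Sum>k\<in>UNIV. \<Sum>i<n. v $ j * v $ k * (a i $ j * a i $ k))"
        by (subst sum.swap, intro sum.cong refl, subst sum.swap) simp
      finally have 1: "(\<Sum>i<n. (v \<bullet> a i)\<^sup>2) / n = (\<Sum>j\<in>UNIV. \<Sum>k\<in>UNIV. v $ j * v $ k * ?S j k)"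
        by (simp add: sum_divide_distrib sum_distrib_left)
      have 2: "(norm v)\<^sup>2 = (\<Sum>j\<in>UNIV. \<Sum>k\<in>UNIV. v $ j * v $ k * (if j = k then 1 else 0))"
        unfolding norm_square_vec by (simp add: power2_eq_square if_distrib cong: if_cong)
      have "\<bar>(\<Sum>i<n. (v \<bullet> a i)\<^sup>2) / n - (norm v)\<^sup>2\<bar> =
          \<bar>\<Sum>j\<in>UNIV. \<Sum>k\<in>UNIV. v $ j * v $ k * (?S j k - (if j = k then 1 else 0))\<bar>"
        unfolding 1 2 by (simp only: right_diff_distrib sum_subtractf)
      also have "\<dots> \<le> (\<Sum>j\<in>UNIV. \<Sum>k\<in>UNIV. \<bar>v $ j * v $ k * (?S j k - (if j = k then 1 else 0))\<bar>)"
        by (rule order_trans[OF sum_abs]) (intro sum_mono sum_abs)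
      also have "\<dots> \<le> (\<Sum>j\<in>(UNIV::'q set). \<Sum>k\<in>(UNIV::'q set). norm v * norm v * \<eta>')"
        unfolding abs_mult using a by (intro sum_mono mult_mono component_le_norm_cart) auto
      also have "\<dots> = \<eta> * (norm v)\<^sup>2" by (simp add: \<eta>'_def power2_eq_square)
      finally show ?thesis .
    qed
    show "\<forall>\<^sub>F n in sequentially. \<forall>\<omega>\<in>space M. (\<forall>p\<in>UNIV.
      \<bar>(\<Sum>i<n. f (Xs i \<omega>) $ fst p * f (Xs i \<omega>) $ snd p) / n - (if fst p = snd p then 1 else 0)\<bar> \<le> \<eta>') \<longrightarrow>
      (\<forall>v. \<bar>(\<Sum>i<n. (v \<bullet> f (Xs i \<omega>))\<^sup>2) / n - (norm v)\<^sup>2\<bar> \<le> \<eta> * (norm v)\<^sup>2)"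
      by (intro always_eventually allI ballI impI det) auto
  qed
qed

end

section \<open>Limit theorem for the extended log-likelihood ratio\<close>

lemma integrable_component_mult:
  fixes f :: "'x \<Rightarrow> real ^ 'q"
  assumes f: "f \<in> borel_measurable P" and int: "integrable P (\<lambda>x. (norm (f x))\<^sup>2)"
  shows "integrable P (\<lambda>x. f x $ j * f x $ k)"
proof (rule Bochner_Integration.integrable_bound[OF int])
  have comp: "f x $ i = axis i 1 \<bullet> f x" for x i by (simp add: inner_axis')
  show "(\<lambda>x. f x $ j * f x $ k) \<in> borel_measurable P" unfolding comp using f by measurable
  have "\<bar>f x $ j * f x $ k\<bar> \<le> norm (f x) * norm (f x)" for x
    unfolding abs_mult by (intro mult_mono component_le_norm_cart) auto
  then show "AE x in P. norm (f x $ j * f x $ k) \<le> norm ((norm (f x))\<^sup>2)"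
    by (simp add: power2_eq_square)
qed

text \<open>
  The limit theorem for an estimating function with identity covariance. For a tolerance \<open>\<epsilon>\<close>, first \<open>K\<close>
  is chosen so large and then, depending on \<open>K\<close>, \<open>\<eta>\<close> so small that the sample is typical in the sense of
  \<open>eel_log_ratio_approx\<close> outside an event of probability \<open>\<epsilon>\<close>.
\<close>

lemma eel_log_ratio_converges_standardized:
  fixes g :: "real ^ 'd \<Rightarrow> real ^ 'p \<Rightarrow> real ^ 'q" and Xs :: "nat \<Rightarrow> 'w \<Rightarrow> real ^ 'd"
  assumes "iid_sample M Xs P"
    and f[measurable]: "(\<lambda>x. g x \<theta>\<^sub>0) \<in> borel_measurable borel"
    and int4: "integrable P (\<lambda>x. norm (g x \<theta>\<^sub>0) ^ 4)"
    and mean: "\<And>j. (LINT x|P. g x \<theta>\<^sub>0 $ j) = 0"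
    and cov: "\<And>j k. (LINT x|P. g x \<theta>\<^sub>0 $ j * g x \<theta>\<^sub>0 $ k) = (if j = k then 1 else 0)"
    and G: "integrable P G" "\<And>x. 0 \<le> G x" and r: "0 < r"
    and lip: "AE x in P. \<forall>\<theta>\<in>ball \<theta>\<^sub>0 r. \<forall>\<theta>'\<in>ball \<theta>\<^sub>0 r. norm (g x \<theta> - g x \<theta>') \<le> G x * norm (\<theta> - \<theta>')"
    and \<theta>\<^sub>t[measurable]: "\<And>n. \<theta>\<^sub>t n \<in> borel_measurable M"
    and rate: "big_O_in_probability M (\<lambda>n \<omega>. \<theta>\<^sub>t n \<omega> - \<theta>\<^sub>0) (\<lambda>n. 1 / sqrt (real n))"
  shows "converges_in_distribution M
           (\<lambda>n \<omega>. eel_log_ratio g n (\<lambda>i. Xs i \<omega>) (\<theta>\<^sub>t n \<omega>) \<theta>\<^sub>0)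
           (chi_squared_distribution CARD('q))"
proof -
  interpret iid_sample M Xs P by fact
  interpret P: prob_space P by (rule prob_space_P)
  define f where "f x = g x \<theta>\<^sub>0" for x
  define m where "m n \<omega> = (\<Sum>i<n. (1 / real n) *\<^sub>R f (Xs i \<omega>))" for n \<omega>
  have fb[measurable]: "f \<in> borel_measurable borel" using f by (simp add: f_def[abs_def])
  have Gb[measurable]: "G \<in> borel_measurable borel"
    using borel_measurable_integrable[OF G(1)] by (simp add: measurable_cong_sets[OF sets_P refl])
  have comp: "f x $ j = axis j 1 \<bullet> f x" for x j by (simp add: inner_axis')
  have compb[measurable]: "(\<lambda>x. f x $ j) \<in> borel_measurable borel" for j unfolding comp by measurable
  have int2: "integrable P (\<lambda>x. (norm (f x))\<^sup>2)"
  proof (rule P.square_integrable_imp_integrable)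
    show "integrable P (\<lambda>x. ((norm (f x))\<^sup>2)\<^sup>2)" using int4 by (simp add: f_def)
  qed simp
  have int22: "integrable P (\<lambda>x. f x $ j * f x $ k)" for j k
    by (rule integrable_component_mult[OF _ int2]) measurable
  have int1: "integrable P (\<lambda>x. f x $ j)" for j
    by (rule P.square_integrable_imp_integrable) (use int22[of j j] in \<open>simp_all add: power2_eq_square\<close>)
  have sq: "(v \<bullet> f x)\<^sup>2 = (\<Sum>j\<in>UNIV. \<Sum>k\<in>UNIV. v $ j * v $ k * (f x $ j * f x $ k))" for v x
    unfolding inner_vec_def power2_eq_square sum_product by (simp add: mult_ac)
  have intv: "integrable P (\<lambda>x. (v \<bullet> f x)\<^sup>2)" for v
    unfolding sq using int22 by (intro Bochner_Integration.integrable_sum integrable_mult_right)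
  have meanv: "(LINT x|P. v \<bullet> f x) = 0" for v
  proof -
    have "(LINT x|P. f x $ j) = 0" for j using mean by (simp add: f_def)
    then show ?thesis unfolding inner_vec_def inner_real_def
      by (subst Bochner_Integration.integral_sum) (simp_all add: int1)
  qed
  have covv: "(LINT x|P. (v \<bullet> f x)\<^sup>2) = (norm v)\<^sup>2" for v
  proof -
    have "(LINT x|P. (v \<bullet> f x)\<^sup>2) = (\<Sum>j\<in>UNIV. \<Sum>k\<in>UNIV. v $ j * v $ k * (LINT x|P. f x $ j * f x $ k))"
      unfolding sq using int22 by (simp add: Bochner_Integration.integral_sum Bochner_Integration.integrable_sum)
    also have "\<dots> = (norm v)\<^sup>2"
      unfolding norm_square_vec cov[folded f_def] by (simp add: power2_eq_square if_distrib cong: if_cong)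
    finally show ?thesis .
  qed
  define Y where "Y n \<omega> = (norm (sqrt n *\<^sub>R m n \<omega>))\<^sup>2" for n \<omega>
  show ?thesis
  proof (rule converges_in_distribution_of_weak_conv_m[where Y = Y])
    show "prob_space M" by (rule prob_space_axioms)
    show "real_distribution (chi_squared_distribution CARD('q))" by (rule real_distribution_chi_squared)
    show "Y n \<in> borel_measurable M" for n unfolding Y_def m_def by measurable
    show "weak_conv_m (\<lambda>n. distr M borel (Y n)) (chi_squared_distribution CARD('q))"
      unfolding Y_def[abs_def]
    proof (rule weak_conv_norm_square_chi_squared[OF prob_space_axioms])
      show "(\<lambda>\<omega>. sqrt n *\<^sub>R m n \<omega>) \<in> borel_measurable M" for n unfolding m_def by measurable
      show "(\<lambda>n. LINT \<omega>|M. iexp (t \<bullet> (sqrt n *\<^sub>R m n \<omega>))) \<longlonglongrightarrow> exp (- (norm t)\<^sup>2 / 2)" for t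
        unfolding m_def by (rule sample_mean_char_tendsto[OF fb intv meanv covv])
    qed
    fix \<epsilon> :: real assume \<epsilon>: "0 < \<epsilon>"
    (* Six exceptional events share the probability epsilon; the Lipschitz bound fails on a null set. *)
    define \<epsilon>\<^sub>1 where "\<epsilon>\<^sub>1 = \<epsilon> / 6"
    have \<epsilon>1: "0 < \<epsilon>\<^sub>1" using \<epsilon> by (simp add: \<epsilon>\<^sub>1_def)
    obtain K\<^sub>0 where K\<^sub>0: "\<forall>\<^sub>F n in sequentially. prob {\<omega>\<in>space M. norm (\<theta>\<^sub>t n \<omega> - \<theta>\<^sub>0) > K\<^sub>0 * (1 / sqrt n)} < \<epsilon>\<^sub>1"
      using rate \<epsilon>1 unfolding big_O_in_probability_def by blast
    (* K is at least the bound for the estimation error and makes the Markov bounds for the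
       normalized mean and for the average Lipschitz constant at most epsilon_1. *)
    define K where "K = Max {1, K\<^sub>0, real CARD('q) / \<epsilon>\<^sub>1, integral\<^sup>L P G / \<epsilon>\<^sub>1}"
    have K: "1 \<le> K" "K\<^sub>0 \<le> K" "real CARD('q) / \<epsilon>\<^sub>1 \<le> K" "integral\<^sup>L P G / \<epsilon>\<^sub>1 \<le> K"
      unfolding K_def by (rule Max_ge; simp)+
    have Kq: "real CARD('q) \<le> \<epsilon>\<^sub>1 * K\<^sup>2"
    proof -
      have "real CARD('q) \<le> \<epsilon>\<^sub>1 * K" using K(3) \<epsilon>1 by (simp add: divide_le_eq mult.commute)
      also have "\<dots> \<le> \<epsilon>\<^sub>1 * K\<^sup>2" using K(1) \<epsilon>1 by (intro mult_left_mono) (auto simp: power2_eq_square)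
      finally show ?thesis .
    qed
    define C where "C = 8 * approx_const K * (K + K\<^sup>2)\<^sup>2 + 3 * K\<^sup>2 * (K + K\<^sup>2) ^ 3"
    have ec: "0 < approx_const K" using K(1) unfolding approx_const_def by (intro add_pos_nonneg) auto
    have "0 < K + K\<^sup>2" using K(1) by (intro add_pos_nonneg) auto
    then have C: "0 < C" using ec unfolding C_def by (intro add_pos_nonneg mult_pos_pos) auto
    define \<eta> where "\<eta> = min (1 / (4 * approx_const K)) (\<epsilon> / C)"
    have \<eta>: "0 < \<eta>" using ec C \<epsilon> by (simp add: \<eta>_def)
    have "\<eta> \<le> 1 / (4 * approx_const K)" "\<eta> \<le> \<epsilon> / C" by (auto simp: \<eta>_def)
    then have \<eta>le: "4 * approx_const K * \<eta> \<le> 1" "C * \<eta> \<le> \<epsilon>" using ec C by (simp_all add: field_simps)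
    have rate_likely: "likely M \<epsilon>\<^sub>1 (\<lambda>n \<omega>. norm (\<theta>\<^sub>t n \<omega> - \<theta>\<^sub>0) \<le> K / sqrt n)"
      unfolding likely_def using K\<^sub>0
    proof eventually_elim
      case (elim n)
      let ?A = "{\<omega>\<in>space M. norm (\<theta>\<^sub>t n \<omega> - \<theta>\<^sub>0) > K\<^sub>0 * (1 / sqrt n)}"
      have "?A \<in> sets M" by measurable
      moreover have "norm (\<theta>\<^sub>t n \<omega> - \<theta>\<^sub>0) \<le> K / sqrt n" if "\<omega> \<in> space M - ?A" for \<omega>
        using that divide_right_mono[OF K(2), of "sqrt n"] by (auto simp: not_less)
      ultimately show ?case using elim by (intro bexI[of _ ?A]) auto
    qed
    have AE_lip: "AE \<omega> in M. \<forall>n::nat. \<forall>i. \<forall>\<theta>\<in>ball \<theta>\<^sub>0 r. \<forall>\<theta>'\<in>ball \<theta>\<^sub>0 r.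
        norm (g (Xs i \<omega>) \<theta> - g (Xs i \<omega>) \<theta>') \<le> G (Xs i \<omega>) * norm (\<theta> - \<theta>')"
      unfolding AE_all_countable
    proof (intro allI)
      fix i
      show "AE \<omega> in M. \<forall>\<theta>\<in>ball \<theta>\<^sub>0 r. \<forall>\<theta>'\<in>ball \<theta>\<^sub>0 r.
        norm (g (Xs i \<omega>) \<theta> - g (Xs i \<omega>) \<theta>') \<le> G (Xs i \<omega>) * norm (\<theta> - \<theta>')"
        using AE_distrD[of "Xs i" M borel, OF measurable_Xs lip[folded distr[of i]]] .
    qed
    have "likely M (\<epsilon>\<^sub>1 + (\<epsilon>\<^sub>1 + (\<epsilon>\<^sub>1 + (\<epsilon>\<^sub>1 + (\<epsilon>\<^sub>1 + (\<epsilon>\<^sub>1 + 0)))))) (\<lambda>n \<omega>.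
        sqrt n * norm (m n \<omega>) \<le> K \<and>
        (\<forall>v. \<bar>(\<Sum>i<n. (v \<bullet> f (Xs i \<omega>))\<^sup>2) / n - (norm v)\<^sup>2\<bar> \<le> \<eta> * (norm v)\<^sup>2) \<and>
        (\<forall>i<n. (norm (f (Xs i \<omega>)))\<^sup>2 \<le> \<eta>\<^sup>2 * n) \<and>
        (\<Sum>i<n. G (Xs i \<omega>)) \<le> K * n \<and>
        (\<forall>i<n. G (Xs i \<omega>) \<le> \<eta> * n) \<and>
        norm (\<theta>\<^sub>t n \<omega> - \<theta>\<^sub>0) \<le> K / sqrt n \<and>
        (\<forall>i. \<forall>\<theta>\<in>ball \<theta>\<^sub>0 r. \<forall>\<theta>'\<in>ball \<theta>\<^sub>0 r.
          norm (g (Xs i \<omega>) \<theta> - g (Xs i \<omega>) \<theta>') \<le> G (Xs i \<omega>) * norm (\<theta> - \<theta>')))"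
    proof (intro likely_conj finite_measure_axioms)
      show "likely M \<epsilon>\<^sub>1 (\<lambda>n \<omega>. sqrt n * norm (m n \<omega>) \<le> K)"
        unfolding m_def using K Kq by (intro likely_mean_bounded fb intv meanv covv) auto
      show "likely M \<epsilon>\<^sub>1 (\<lambda>n \<omega>. \<forall>v. \<bar>(\<Sum>i<n. (v \<bullet> f (Xs i \<omega>))\<^sup>2) / n - (norm v)\<^sup>2\<bar> \<le> \<eta> * (norm v)\<^sup>2)"
        using int4 cov \<epsilon>1 \<eta> by (intro likely_second_moment fb) (auto simp: f_def)
      show "likely M \<epsilon>\<^sub>1 (\<lambda>n \<omega>. \<forall>i<n. (norm (f (Xs i \<omega>)))\<^sup>2 \<le> \<eta>\<^sup>2 * n)"
        using int2 \<epsilon>1 \<eta> by (intro likely_max_le) auto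
      show "likely M \<epsilon>\<^sub>1 (\<lambda>n \<omega>. (\<Sum>i<n. G (Xs i \<omega>)) \<le> K * n)"
        using K \<epsilon>1 G by (intro likely_sum_le) (auto simp: field_simps)
      show "likely M \<epsilon>\<^sub>1 (\<lambda>n \<omega>. \<forall>i<n. G (Xs i \<omega>) \<le> \<eta> * n)"
        using \<epsilon>1 \<eta> G by (intro likely_max_le) auto
      show "likely M \<epsilon>\<^sub>1 (\<lambda>n \<omega>. norm (\<theta>\<^sub>t n \<omega> - \<theta>\<^sub>0) \<le> K / sqrt n)" by (rule rate_likely)
      show "likely M 0 (\<lambda>n \<omega>. \<forall>i. \<forall>\<theta>\<in>ball \<theta>\<^sub>0 r. \<forall>\<theta>'\<in>ball \<theta>\<^sub>0 r.
          norm (g (Xs i \<omega>) \<theta> - g (Xs i \<omega>) \<theta>') \<le> G (Xs i \<omega>) * norm (\<theta> - \<theta>'))"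
        using AE_lip by (rule likely_AE) simp
    qed
    then have "likely M \<epsilon> (\<lambda>n \<omega>. \<bar>eel_log_ratio g n (\<lambda>i. Xs i \<omega>) (\<theta>\<^sub>t n \<omega>) \<theta>\<^sub>0 - Y n \<omega>\<bar> \<le> \<epsilon>)"
    proof (rule likely_mono)
      show "\<epsilon>\<^sub>1 + (\<epsilon>\<^sub>1 + (\<epsilon>\<^sub>1 + (\<epsilon>\<^sub>1 + (\<epsilon>\<^sub>1 + (\<epsilon>\<^sub>1 + 0))))) \<le> \<epsilon>" by (simp add: \<epsilon>\<^sub>1_def)
      have "\<forall>\<^sub>F n in sequentially. 1 \<le> \<eta> * real n" using \<eta> by real_asymp
      moreover have "\<forall>\<^sub>F n in sequentially. K / sqrt (real n) < r" using K(1) r by real_asymp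
      ultimately show "\<forall>\<^sub>F n in sequentially. \<forall>\<omega>\<in>space M. (sqrt n * norm (m n \<omega>) \<le> K \<and>
        (\<forall>v. \<bar>(\<Sum>i<n. (v \<bullet> f (Xs i \<omega>))\<^sup>2) / n - (norm v)\<^sup>2\<bar> \<le> \<eta> * (norm v)\<^sup>2) \<and>
        (\<forall>i<n. (norm (f (Xs i \<omega>)))\<^sup>2 \<le> \<eta>\<^sup>2 * n) \<and>
        (\<Sum>i<n. G (Xs i \<omega>)) \<le> K * n \<and>
        (\<forall>i<n. G (Xs i \<omega>) \<le> \<eta> * n) \<and>
        norm (\<theta>\<^sub>t n \<omega> - \<theta>\<^sub>0) \<le> K / sqrt n \<and>
        (\<forall>i. \<forall>\<theta>\<in>ball \<theta>\<^sub>0 r. \<forall>\<theta>'\<in>ball \<theta>\<^sub>0 r.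
          norm (g (Xs i \<omega>) \<theta> - g (Xs i \<omega>) \<theta>') \<le> G (Xs i \<omega>) * norm (\<theta> - \<theta>'))) \<longrightarrow>
        \<bar>eel_log_ratio g n (\<lambda>i. Xs i \<omega>) (\<theta>\<^sub>t n \<omega>) \<theta>\<^sub>0 - Y n \<omega>\<bar> \<le> \<epsilon>"
      proof (eventually_elim, intro ballI impI, elim conjE)
        fix n \<omega>
        assume n: "1 \<le> \<eta> * real n" "K / sqrt (real n) < r"
          and 1: "sqrt n * norm (m n \<omega>) \<le> K"
          and 2: "\<forall>v. \<bar>(\<Sum>i<n. (v \<bullet> f (Xs i \<omega>))\<^sup>2) / n - (norm v)\<^sup>2\<bar> \<le> \<eta> * (norm v)\<^sup>2"
          and 3: "\<forall>i<n. (norm (f (Xs i \<omega>)))\<^sup>2 \<le> \<eta>\<^sup>2 * n"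
          and 4: "(\<Sum>i<n. G (Xs i \<omega>)) \<le> K * n"
          and 5: "\<forall>i<n. G (Xs i \<omega>) \<le> \<eta> * n"
          and 6: "norm (\<theta>\<^sub>t n \<omega> - \<theta>\<^sub>0) \<le> K / sqrt n"
          and 7: "\<forall>i. \<forall>\<theta>\<in>ball \<theta>\<^sub>0 r. \<forall>\<theta>'\<in>ball \<theta>\<^sub>0 r.
          norm (g (Xs i \<omega>) \<theta> - g (Xs i \<omega>) \<theta>') \<le> G (Xs i \<omega>) * norm (\<theta> - \<theta>')"
        have 3: "norm (f (Xs i \<omega>)) \<le> \<eta> * sqrt n" if "i < n" for i
        proof (rule power2_le_imp_le)
          show "(norm (f (Xs i \<omega>)))\<^sup>2 \<le> (\<eta> * sqrt n)\<^sup>2" using 3 that by (simp add: power_mult_distrib)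
        qed (use \<eta> in simp)
        have "\<bar>eel_log_ratio g n (\<lambda>i. Xs i \<omega>) (\<theta>\<^sub>t n \<omega>) \<theta>\<^sub>0 - n * (norm (m n \<omega>))\<^sup>2\<bar> \<le> C * \<eta>"
          unfolding C_def using 1 2 3 4 5 6 7 G(2)
          by (intro eel_log_ratio_approx[where r = r and G = "\<lambda>i. G (Xs i \<omega>)"] \<eta> n K \<eta>le) (auto simp: f_def m_def)
        also have "\<dots> \<le> \<epsilon>" by (rule \<eta>le)
        finally show "\<bar>eel_log_ratio g n (\<lambda>i. Xs i \<omega>) (\<theta>\<^sub>t n \<omega>) \<theta>\<^sub>0 - Y n \<omega>\<bar> \<le> \<epsilon>"
          by (simp add: Y_def power_mult_distrib)
      qed
    qed
    then show "\<forall>\<^sub>F n in sequentially. \<exists>A\<in>sets M. measure M A \<le> \<epsilon> \<and>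
       (\<forall>\<omega>\<in>space M - A. \<bar>eel_log_ratio g n (\<lambda>i. Xs i \<omega>) (\<theta>\<^sub>t n \<omega>) \<theta>\<^sub>0 - Y n \<omega>\<bar> \<le> \<epsilon>)"
      unfolding likely_def .
  qed
qed

text \<open>
  Gram-Schmidt orthonormalization for the inner product \<open>u \<bullet> V v\<close>.
\<close>

lemma positive_definite_orthonormal_family:
  fixes V :: "real ^ 'q ^ 'q"
  assumes V: "positive_definite V"
  obtains b :: "'q \<Rightarrow> real ^ 'q" where "\<And>i j. b i \<bullet> (V *v b j) = (if i = j then 1 else 0)"
proof -
  have sym: "u \<bullet> (V *v v) = v \<bullet> (V *v u)" for u v
  proof -
    have "transpose V = V" using V by (simp add: positive_definite_def)
    then have "u v* V = V *v u" using transpose_matrix_vector[of V u] by simp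
    then show ?thesis by (simp add: inner_commute flip: dot_lmul_matrix)
  qed
  have ex: "\<exists>b :: 'q \<Rightarrow> real ^ 'q. \<forall>i\<in>J. \<forall>j\<in>J. b i \<bullet> (V *v b j) = (if i = j then 1 else 0)" for J
  proof (induction J rule: finite_subset_induct'[OF finite subset_UNIV, consumes 0, case_names empty insert])
    case (insert k J)
    then obtain b :: "'q \<Rightarrow> real ^ 'q" where b: "\<And>i j. i \<in> J \<Longrightarrow> j \<in> J \<Longrightarrow> b i \<bullet> (V *v b j) = (if i = j then 1 else 0)"
      by blast
    let ?W = "(\<lambda>i. V *v b i) ` J"
    have "dim ?W \<le> card ?W" by (intro dim_le_card') simp
    also have "\<dots> \<le> card J" by (intro card_image_le) simp
    also have "\<dots> < card (insert k J)" using insert by simp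
    also have "\<dots> \<le> DIM(real ^ 'q)" by (simp add: card_mono)
    (* The vectors V b_i span a proper subspace while there are fewer than q of them. *)
    finally obtain v where v: "v \<noteq> 0" "\<And>y. y \<in> span ?W \<Longrightarrow> orthogonal v y"
      using orthogonal_to_subspace_exists by blast
    have v0: "v \<bullet> (V *v b i) = 0" "b i \<bullet> (V *v v) = 0" if "i \<in> J" for i
      using v(2)[of "V *v b i"] that sym by (auto simp: orthogonal_def intro: span_base)
    define c where "c = v \<bullet> (V *v v)"
    have c: "0 < c" using V v(1) by (simp add: c_def positive_definite_def)
    define b' where "b' = b(k := (1 / sqrt c) *\<^sub>R v)"
    have "b' i \<bullet> (V *v b' j) = (if i = j then 1 else 0)" if "i \<in> insert k J" "j \<in> insert k J" for i j
    proof -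
      have b'k: "b' k = (1 / sqrt c) *\<^sub>R v" by (simp add: b'_def)
      have b'J: "b' l = b l" if "l \<in> J" for l
        using insert that by (auto simp: b'_def)
      have kk: "b' k \<bullet> (V *v b' k) = 1"
        using c by (simp add: b'k matrix_vector_mult_scaleR flip: c_def)
      have kJ: "b' k \<bullet> (V *v b' l) = 0" "b' l \<bullet> (V *v b' k) = 0" if "l \<in> J" for l
        using v0[OF that] that by (simp_all add: b'J b'k matrix_vector_mult_scaleR)
      have JJ: "b' l \<bullet> (V *v b' l') = (if l = l' then 1 else 0)" if "l \<in> J" "l' \<in> J" for l l'
        using b[OF that] that by (simp add: b'J)
      have "k \<notin> J" using insert by simp
      then show ?thesis using that kk kJ JJ by (cases "i = k"; cases "j = k") simp_all
    qed
    then show ?case by blast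
  qed simp
  obtain b :: "'q \<Rightarrow> real ^ 'q" where b: "\<forall>i\<in>UNIV. \<forall>j\<in>UNIV. b i \<bullet> (V *v b j) = (if i = j then 1 else 0)"
    using ex[of UNIV] by (elim exE)
  show thesis by (rule that[of b]) (use b in simp)
qed

lemma eel_log_ratio_linear_invariance:
  fixes g :: "real ^ 'd \<Rightarrow> real ^ 'p \<Rightarrow> real ^ 'q" and B :: "real ^ 'q ^ 'q"
  assumes B: "\<And>y. B *v y = 0 \<Longrightarrow> y = 0"
  shows "eel_log_ratio (\<lambda>x \<theta>. B *v g x \<theta>) = eel_log_ratio g"
proof -
  have eq: "(\<Sum>i<n. w i *\<^sub>R (B *v g (x i) \<theta>)) = 0 \<longleftrightarrow> (\<Sum>i<n. w i *\<^sub>R g (x i) \<theta>) = 0"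
    for n :: nat and w :: "nat \<Rightarrow> real" and x \<theta>
  proof -
    have "(\<Sum>i<n. w i *\<^sub>R (B *v g (x i) \<theta>)) = B *v (\<Sum>i<n. w i *\<^sub>R g (x i) \<theta>)"
      by (simp add: linear_sum[OF matrix_vector_mul_linear] matrix_vector_mult_scaleR)
    then show ?thesis using B by auto
  qed
  have dom: "el_domain (\<lambda>x \<theta>. B *v g x \<theta>) = el_domain g"
    by (intro ext) (simp add: el_domain_def eq)
  have ratio: "el_ratio (\<lambda>x \<theta>. B *v g x \<theta>) = el_ratio g"
    by (intro ext) (simp add: el_ratio_def eq)
  show ?thesis
    by (intro ext) (simp add: eel_log_ratio_def el_log_ratio_def similarity_inverse_def
        similarity_fibre_def composite_similarity_def dom ratio)
qed

text \<open>
  The mean value inequality on a ball inside the neighbourhood where the first derivative is dominated.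
\<close>

lemma condition2_lipschitz:
  assumes "condition2 P g \<theta>\<^sub>0"
  obtains r G where "0 < r" "integrable P G"
    "AE x in P. \<forall>\<theta>\<in>ball \<theta>\<^sub>0 r. \<forall>\<theta>'\<in>ball \<theta>\<^sub>0 r. norm (g x \<theta> - g x \<theta>') \<le> G x * norm (\<theta> - \<theta>')"
proof -
  obtain Dg D2g N G where N: "open N" "\<theta>\<^sub>0 \<in> N" "integrable P (G :: real ^ 'a \<Rightarrow> real)"
    and AE: "AE x in P.
           (\<forall>\<theta>. (g x has_derivative blinfun_apply (Dg x \<theta>)) (at \<theta>)) \<and>
           (\<forall>\<theta>. (Dg x has_derivative blinfun_apply (D2g x \<theta>)) (at \<theta>)) \<and>
           continuous_on UNIV (Dg x) \<and> continuous_on UNIV (D2g x) \<and>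
           (\<forall>\<theta>\<in>N. norm (Dg x \<theta>) \<le> G x \<and> norm (D2g x \<theta>) \<le> G x)"
    using assms unfolding condition2_def by blast
  obtain r where r: "0 < r" "ball \<theta>\<^sub>0 r \<subseteq> N" using N by (auto simp: open_contains_ball)
  have "AE x in P. \<forall>\<theta>\<in>ball \<theta>\<^sub>0 r. \<forall>\<theta>'\<in>ball \<theta>\<^sub>0 r. norm (g x \<theta> - g x \<theta>') \<le> G x * norm (\<theta> - \<theta>')"
    using AE
  proof eventually_elim
    case (elim x)
    show ?case
    proof (intro ballI)
      fix \<theta> \<theta>' assume "\<theta> \<in> ball \<theta>\<^sub>0 r" "\<theta>' \<in> ball \<theta>\<^sub>0 r"
      then show "norm (g x \<theta> - g x \<theta>') \<le> G x * norm (\<theta> - \<theta>')"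
        using elim r
        by (intro differentiable_bound[where S = "ball \<theta>\<^sub>0 r" and f' = "\<lambda>\<theta>. blinfun_apply (Dg x \<theta>)"])
          (auto intro: has_derivative_at_withinI simp: norm_blinfun.rep_eq[symmetric] subset_iff)
    qed
  qed
  then show thesis using r N that by blast
qed

lemma second_moment_eq_variance_matrix:
  fixes f :: "real ^ 'd \<Rightarrow> real ^ 'q"
  assumes int2: "integrable P (\<lambda>x. (norm (f x))\<^sup>2)" and f: "integrable P f" "integral\<^sup>L P f = 0"
  shows "(LINT x|P. (u \<bullet> f x) * (v \<bullet> f x)) = u \<bullet> (variance_matrix P f *v v)"
proof -
  have fb[measurable]: "f \<in> borel_measurable P" using f by simp
  have comp: "f x $ j = axis j 1 \<bullet> f x" for x j by (simp add: inner_axis')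
  have mean: "(LINT x|P. f x $ j) = 0" for j
    unfolding comp using f by simp
  have int22: "integrable P (\<lambda>x. f x $ j * f x $ k)" for j k
    by (rule integrable_component_mult[OF fb int2])
  have "(u \<bullet> f x) * (v \<bullet> f x) = (\<Sum>j\<in>UNIV. \<Sum>k\<in>UNIV. u $ j * v $ k * (f x $ j * f x $ k))" for x
    unfolding inner_vec_def sum_product by (simp add: mult_ac)
  then have "(LINT x|P. (u \<bullet> f x) * (v \<bullet> f x)) =
      (\<Sum>j\<in>UNIV. \<Sum>k\<in>UNIV. u $ j * v $ k * (LINT x|P. f x $ j * f x $ k))"
    using int22 by (simp add: Bochner_Integration.integral_sum Bochner_Integration.integrable_sum)
  also have "\<dots> = u \<bullet> (variance_matrix P f *v v)"
    by (simp add: variance_matrix_def mean inner_vec_def matrix_vector_mult_def sum_distrib_left mult_ac)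
  finally show ?thesis .
qed

theorem theorem2:
  fixes M :: "'w measure"
    and X :: "'w \<Rightarrow> real ^ 'd"
    and Xs :: "nat \<Rightarrow> 'w \<Rightarrow> real ^ 'd"
    and g :: "real ^ 'd \<Rightarrow> real ^ 'p \<Rightarrow> real ^ 'q"
    and \<theta>\<^sub>0 :: "real ^ 'p"
    and \<theta>\<^sub>t :: "nat \<Rightarrow> 'w \<Rightarrow> real ^ 'p"
  assumes "prob_space M"
    and "X \<in> borel_measurable M"
    and "prob_space.indep_vars M (\<lambda>_. borel) Xs UNIV"
    and "\<And>i. distr M borel (Xs i) = distr M borel X"
    and "\<And>\<theta>. (\<lambda>x. g x \<theta>) \<in> borel_measurable borel"
    and "condition1 (distr M borel X) g \<theta>\<^sub>0"
    and "condition2 (distr M borel X) g \<theta>\<^sub>0"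
    and "condition3 (distr M borel X) g \<theta>\<^sub>0"
    and "AE \<omega> in M. \<forall>\<^sub>F n in sequentially.
           open (el_domain g n (\<lambda>i. Xs i \<omega>)) \<and> \<theta>\<^sub>0 \<in> el_domain g n (\<lambda>i. Xs i \<omega>)"
    and "\<And>n. \<theta>\<^sub>t n \<in> borel_measurable M"
    and "AE \<omega> in M. \<forall>\<^sub>F n in sequentially.
           is_arg_max (el_ratio g n (\<lambda>i. Xs i \<omega>)) (\<lambda>\<theta>. \<theta> \<in> el_domain g n (\<lambda>i. Xs i \<omega>)) (\<theta>\<^sub>t n \<omega>)"
    and "CARD('p) = CARD('q) \<Longrightarrow>
           AE \<omega> in M. \<forall>\<^sub>F n in sequentially. (\<Sum>i<n. g (Xs i \<omega>) (\<theta>\<^sub>t n \<omega>)) = 0"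
    and "big_O_in_probability M (\<lambda>n \<omega>. \<theta>\<^sub>t n \<omega> - \<theta>\<^sub>0) (\<lambda>n. 1 / sqrt (real n))"
  shows "converges_in_distribution M
           (\<lambda>n \<omega>. eel_log_ratio g n (\<lambda>i. Xs i \<omega>) (\<theta>\<^sub>t n \<omega>) \<theta>\<^sub>0)
           (chi_squared_distribution CARD('q))"
proof -
  define P where "P = distr M borel X"
  have iid: "iid_sample M Xs P"
    unfolding iid_sample_def iid_sample_axioms_def P_def using assms(1,3,4) by blast
  interpret iid_sample M Xs P by (rule iid)
  interpret P: prob_space P by (rule prob_space_P)
  define f where "f x = g x \<theta>\<^sub>0" for x
  have fb[measurable]: "f \<in> borel_measurable borel" using assms(5) by (simp add: f_def[abs_def])
  have f: "integrable P f" "integral\<^sup>L P f = 0" "integrable P (\<lambda>x. (norm (f x))\<^sup>2)"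
    and V: "positive_definite (variance_matrix P f)"
    using assms(6) by (auto simp: condition1_def P_def f_def[abs_def])
  have int15: "integrable P (\<lambda>x. norm (f x) ^ 15)"
    using assms(8) by (auto simp: condition3_def P_def f_def)
  obtain b :: "'q \<Rightarrow> real ^ 'q" where b: "\<And>i j. b i \<bullet> (variance_matrix P f *v b j) = (if i = j then 1 else 0)"
    using positive_definite_orthonormal_family[OF V] by blast
  (* The matrix with rows b_i standardizes the estimating function: B V B^T is the identity. *)
  define B :: "real ^ 'q ^ 'q" where "B = (\<chi> i. b i)"
  have Bnth: "(B *v y) $ i = b i \<bullet> y" for y i
    by (simp add: B_def matrix_vector_mult_def inner_vec_def)
  have "B ** (\<chi> k j. (variance_matrix P f *v b j) $ k) = mat 1"
    using b by (simp add: vec_eq_iff matrix_matrix_mult_def mat_def B_def inner_vec_def)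
  then have "(\<chi> k j. (variance_matrix P f *v b j) $ k) ** B = mat 1"
    by (simp add: matrix_left_right_inverse)
  then have Binj: "y = 0" if "B *v y = 0" for y
    using that by (metis matrix_vector_mul_assoc matrix_vector_mul_lid matrix_vector_mult_0_right)
  define c where "c = onorm ((*v) B)"
  have c: "norm (B *v y) \<le> c * norm y" "0 \<le> c" for y
    unfolding c_def by (intro onorm onorm_pos_le matrix_vector_mul_bounded_linear)+
  obtain r G where r: "0 < r" and G: "integrable P G"
    and lip: "AE x in P. \<forall>\<theta>\<in>ball \<theta>\<^sub>0 r. \<forall>\<theta>'\<in>ball \<theta>\<^sub>0 r. norm (g x \<theta> - g x \<theta>') \<le> G x * norm (\<theta> - \<theta>')"
    using condition2_lipschitz[of P g \<theta>\<^sub>0] assms(7) unfolding P_def by blast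
  have Bf[measurable]: "(\<lambda>x. B *v f x) \<in> borel_measurable borel"
    by (rule borel_measurable_continuous_on[OF _ fb])
      (intro linear_continuous_on matrix_vector_mul_bounded_linear)
  have "converges_in_distribution M
           (\<lambda>n \<omega>. eel_log_ratio (\<lambda>x \<theta>. B *v g x \<theta>) n (\<lambda>i. Xs i \<omega>) (\<theta>\<^sub>t n \<omega>) \<theta>\<^sub>0)
           (chi_squared_distribution CARD('q))"
  proof (rule eel_log_ratio_converges_standardized[OF iid, where G = "\<lambda>x. c * \<bar>G x\<bar>" and r = r])
    show "(\<lambda>x. B *v g x \<theta>\<^sub>0) \<in> borel_measurable borel" using Bf by (simp add: f_def)
    show "integrable P (\<lambda>x. norm (B *v g x \<theta>\<^sub>0) ^ 4)"
    proof (rule Bochner_Integration.integrable_bound)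
      show "integrable P (\<lambda>x. c ^ 4 * (1 + norm (f x) ^ 15))"
        using int15 by (intro integrable_mult_right Bochner_Integration.integrable_add) auto
      show "(\<lambda>x. norm (B *v g x \<theta>\<^sub>0) ^ 4) \<in> borel_measurable P" unfolding f_def[symmetric] by measurable
      have "norm (B *v f x) ^ 4 \<le> c ^ 4 * (1 + norm (f x) ^ 15)" for x
      proof -
        have "norm (f x) ^ 4 \<le> 1 + norm (f x) ^ 15"
        proof (cases "norm (f x) \<le> 1")
          case True
          then have "norm (f x) ^ 4 \<le> 1" by (simp add: power_le_one)
          then show ?thesis using zero_le_power[OF norm_ge_zero, of "f x" 15] by linarith
        next
          case False
          then have "norm (f x) ^ 4 \<le> norm (f x) ^ 15" by (intro power_increasing) auto
          then show ?thesis by linarith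
        qed
        moreover have "norm (B *v f x) ^ 4 \<le> (c * norm (f x)) ^ 4" using c by (intro power_mono) auto
        ultimately show ?thesis
          using mult_left_mono[of "norm (f x) ^ 4" _ "c ^ 4"] by (fastforce simp: power_mult_distrib)
      qed
      then show "AE x in P. norm (norm (B *v g x \<theta>\<^sub>0) ^ 4) \<le> norm (c ^ 4 * (1 + norm (f x) ^ 15))"
        using c(2) by (auto simp: f_def)
    qed
    show "(LINT x|P. (B *v g x \<theta>\<^sub>0) $ j) = 0" for j
      using f unfolding Bnth f_def[symmetric] by simp
    show "(LINT x|P. (B *v g x \<theta>\<^sub>0) $ j * (B *v g x \<theta>\<^sub>0) $ k) = (if j = k then 1 else 0)" for j k
      unfolding Bnth f_def[symmetric] second_moment_eq_variance_matrix[OF f(3,1,2)] by (rule b)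
    show "integrable P (\<lambda>x. c * \<bar>G x\<bar>)" using G by auto
    show "0 \<le> c * \<bar>G x\<bar>" for x using c(2) by simp
    show "AE x in P. \<forall>\<theta>\<in>ball \<theta>\<^sub>0 r. \<forall>\<theta>'\<in>ball \<theta>\<^sub>0 r.
        norm (B *v g x \<theta> - B *v g x \<theta>') \<le> c * \<bar>G x\<bar> * norm (\<theta> - \<theta>')"
      using lip
    proof eventually_elim
      case (elim x)
      show ?case
      proof (intro ballI)
        fix \<theta> \<theta>' assume "\<theta> \<in> ball \<theta>\<^sub>0 r" "\<theta>' \<in> ball \<theta>\<^sub>0 r"
        then have "norm (g x \<theta> - g x \<theta>') \<le> G x * norm (\<theta> - \<theta>')" using elim by blast
        also have "\<dots> \<le> \<bar>G x\<bar> * norm (\<theta> - \<theta>')" by (intro mult_right_mono) auto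
        finally have "c * norm (g x \<theta> - g x \<theta>') \<le> c * (\<bar>G x\<bar> * norm (\<theta> - \<theta>'))"
          using c(2) by (intro mult_left_mono)
        then show "norm (B *v g x \<theta> - B *v g x \<theta>') \<le> c * \<bar>G x\<bar> * norm (\<theta> - \<theta>')"
          using c(1)[of "g x \<theta> - g x \<theta>'"] by (simp add: matrix_vector_mult_diff_distrib mult.assoc)
      qed
    qed
  qed (use r assms in auto)
  moreover have "eel_log_ratio (\<lambda>x \<theta>. B *v g x \<theta>) = eel_log_ratio g"
    by (rule eel_log_ratio_linear_invariance) (rule Binj)
  ultimately show ?thesis by simp
qed

end
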